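(* Let $f\in\mathfrak m$, let $\Phi:\mathcal M_n\to\mathcal M_r$ be a unital positive linear map, and let $A\in\mathcal M_n$ be accretive with $W(A)\subset S_\alpha$ for some $0\le\alpha<\pi/2$. Then $$\Re f(\Phi(A))\ge\cos^2(\alpha)\,\Re\,\Phi(f(A)).$$
   Context: A matrix $A$ is accretive if $\Re A=\frac{A+A^*}{2}$ is positive definite. $W(A)$ is the numerical range, $S_\alpha=\{z:\Re z>0,\ |\Im z|\le\tan(\alpha)\Re z\}$. $\le$ is the Löwner order. A linear map $\Phi$ is positive if it preserves positive semidefiniteness and unital if $\Phi(\mathcal I)=\mathcal I$. $\mathfrak m$ is the set of matrix monotone $f:(0,\infty)\to(0,\infty)$ with $f(1)=1$; each extends analytically to $\mathbb C\setminus(-\infty,0]$, and for $X$ with spectrum in $D=\mathbb C\setminus(-\infty,0]$, $f(X)=\frac1{2\pi i}\int_\Gamma f(z)(z\mathcal I-X)^{-1}dz$ with $\Gamma\subset D$ a simple closed curve winding once around each eigenvalue of $X$. *)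

theory Defs
  imports "HOL-Complex_Analysis.Complex_Analysis" "Jordan_Normal_Form.Matrix" "Jordan_Normal_Form.Char_Poly"
begin

definition adj :: "complex mat \<Rightarrow> complex mat" where
  "adj A = mat (dim_col A) (dim_row A) (\<lambda>(i,j). cnj (A $$ (j,i)))"

definition hermitian :: "complex mat \<Rightarrow> bool" where
  "hermitian A \<longleftrightarrow> A \<in> carrier_mat (dim_row A) (dim_row A) \<and> adj A = A"

definition qform :: "complex mat \<Rightarrow> complex vec \<Rightarrow> complex" where
  "qform A x = (\<Sum>i<dim_vec x. cnj (x $ i) * (A *\<^sub>v x) $ i)"

definition psd :: "complex mat \<Rightarrow> bool" where
  "psd A \<longleftrightarrow> hermitian A \<and> (\<forall>x \<in> carrier_vec (dim_row A). 0 \<le> Re (qform A x))"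

definition pd :: "complex mat \<Rightarrow> bool" where
  "pd A \<longleftrightarrow> hermitian A \<and> (\<forall>x \<in> carrier_vec (dim_row A). x \<noteq> 0\<^sub>v (dim_row A) \<longrightarrow> 0 < Re (qform A x))"

definition loewner_le :: "complex mat \<Rightarrow> complex mat \<Rightarrow> bool" where
  "loewner_le A B \<longleftrightarrow> dim_row A = dim_row B \<and> dim_col A = dim_col B \<and> psd (B - A)"

definition re_part :: "complex mat \<Rightarrow> complex mat" where
  "re_part A = (1/2) \<cdot>\<^sub>m (A + adj A)"

definition accretive :: "complex mat \<Rightarrow> bool" where
  "accretive A \<longleftrightarrow> A \<in> carrier_mat (dim_row A) (dim_row A) \<and> pd (re_part A)"

definition numerical_range :: "complex mat \<Rightarrow> complex set" where
  "numerical_range A = {qform A x | x. x \<in> carrier_vec (dim_row A) \<and> (\<Sum>i<dim_vec x. (cmod (x $ i))\<^sup>2) = 1}"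

definition sector :: "real \<Rightarrow> complex set" where
  "sector \<alpha> = {z. 0 < Re z \<and> \<bar>Im z\<bar> \<le> tan \<alpha> * Re z}"

definition slitD :: "complex set" where
  "slitD = UNIV - {z. Im z = 0 \<and> Re z \<le> 0}"

definition resolvent :: "complex mat \<Rightarrow> complex \<Rightarrow> complex mat" where
  "resolvent X z = (SOME B. B \<in> carrier_mat (dim_row X) (dim_row X) \<and>
       (z \<cdot>\<^sub>m 1\<^sub>m (dim_row X) - X) * B = 1\<^sub>m (dim_row X) \<and>
       B * (z \<cdot>\<^sub>m 1\<^sub>m (dim_row X) - X) = 1\<^sub>m (dim_row X))"

definition admissible_contour :: "complex mat \<Rightarrow> (real \<Rightarrow> complex) \<Rightarrow> bool" where
  "admissible_contour X g \<longleftrightarrow> valid_path g \<and> simple_path g \<and> pathfinish g = pathstart g \<and>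
     path_image g \<subseteq> slitD \<and>
     (\<forall>e. eigenvalue X e \<longrightarrow> e \<notin> path_image g \<and> winding_number g e = 1)"

text \<open>holomorphic functional calculus f(X) = (2 pi i)^{-1} \<integral>_\<Gamma> f(z) (zI - X)^{-1} dz, entrywise\<close>
definition mfun :: "(complex \<Rightarrow> complex) \<Rightarrow> complex mat \<Rightarrow> complex mat" where
  "mfun f X = (let g = (SOME g. admissible_contour X g) in
     mat (dim_row X) (dim_row X)
       (\<lambda>(i,j). contour_integral g (\<lambda>z. f z * resolvent X z $$ (i,j)) / (2 * pi * \<i>)))"

text \<open>the class \<m>: (analytic extensions of) matrix monotone f:(0,\<infinity>)\<rightarrow>(0,\<infinity>) with f(1)=1,
  monotone in every matrix dimension\<close>
definition matrix_monotone_class :: "(complex \<Rightarrow> complex) \<Rightarrow> bool" where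
  "matrix_monotone_class f \<longleftrightarrow> f holomorphic_on slitD \<and>
     (\<forall>x::real. 0 < x \<longrightarrow> f (complex_of_real x) \<in> \<real> \<and> 0 < Re (f (complex_of_real x))) \<and>
     f 1 = 1 \<and>
     (\<forall>m. \<forall>A \<in> carrier_mat m m. \<forall>B \<in> carrier_mat m m.
        pd A \<and> pd B \<and> loewner_le A B \<longrightarrow> loewner_le (mfun f A) (mfun f B))"

definition positive_linear_map :: "nat \<Rightarrow> nat \<Rightarrow> (complex mat \<Rightarrow> complex mat) \<Rightarrow> bool" where
  "positive_linear_map n r \<Phi> \<longleftrightarrow>
     (\<forall>A \<in> carrier_mat n n. \<Phi> A \<in> carrier_mat r r) \<and>
     (\<forall>A \<in> carrier_mat n n. \<forall>B \<in> carrier_mat n n. \<Phi> (A + B) = \<Phi> A + \<Phi> B) \<and>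
     (\<forall>c. \<forall>A \<in> carrier_mat n n. \<Phi> (c \<cdot>\<^sub>m A) = c \<cdot>\<^sub>m \<Phi> A) \<and>
     (\<forall>A \<in> carrier_mat n n. psd A \<longrightarrow> psd (\<Phi> A))"

definition unital :: "nat \<Rightarrow> nat \<Rightarrow> (complex mat \<Rightarrow> complex mat) \<Rightarrow> bool" where
  "unital n r \<Phi> \<longleftrightarrow> \<Phi> (1\<^sub>m n) = 1\<^sub>m r"

end

theory Submission
  imports Defs "Jordan_Normal_Form.Schur_Decomposition"
begin

text \<open>Fix a vector \<open>x\<close>. The quadratic form at \<open>x\<close> of the difference of the two sides is \<open>Re (1/(2\<pi>\<i>) \<integral> f(z) s(z) dz)\<close>
  for a rational function \<open>s\<close>, and for \<open>f(z) = z (1 + t) / (z + t)\<close> its value is, up to a positive factor, \<open>- s\<^sub>1(- t)\<close>,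
  where \<open>s\<^sub>1\<close> is the strictly proper part of \<open>z s(z)\<close>. Nonnegativity for these \<open>f\<close> is linear algebra:
  a positive map satisfies \<open>\<Phi>(Z)\<inverse> \<le> \<Phi>(Z\<inverse>)\<close>, and the sector condition gives \<open>cos\<^sup>2 \<alpha> (Re A)\<inverse> \<le> Re (A\<inverse>)\<close>.

  Loewner's integral representation is avoided by duality. A polynomial that is nonnegative on the
  negative half-axis is a sum of terms \<open>a a\<^sup>*\<close> and \<open>- z b b\<^sup>*\<close>, with \<open>u\<^sup>*(z) = cnj (u (cnj z))\<close>, so it suffices that
  \<open>\<integral> f u u\<^sup>* / (2\<pi>\<i>) \<ge> 0 \<ge> \<integral> (f/z) u u\<^sup>* / (2\<pi>\<i>)\<close> for strictly proper rational \<open>u\<close>. The first inequality is the derivative of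
  matrix monotonicity at a diagonal matrix in a rank-one direction. For the second,
  \<open>\<integral> f u u\<^sup>* / (z - s)\<^sup>2 \<ge> 0\<close> shows that \<open>\<integral> f u u\<^sup>* / (z - s)\<close> is nondecreasing in \<open>s > 0\<close>, over a contour enclosing \<open>s\<close>;
  the limit \<open>s \<rightarrow> \<infinity>\<close> vanishes since \<open>f\<close> grows at most linearly, and positivity of \<open>f\<close> handles \<open>s \<rightarrow> 0\<close>.\<close>


section \<open>Contour integrals over circles in the right half-plane\<close>

abbreviation disc :: "real \<Rightarrow> real \<Rightarrow> complex set" where
  "disc c r \<equiv> ball (complex_of_real c) r"

abbreviation circ :: "real \<Rightarrow> real \<Rightarrow> complex set" where
  "circ c r \<equiv> sphere (complex_of_real c) r"

lemma slitD_eq: "slitD = - \<real>\<^sub>\<le>\<^sub>0"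
  by (auto simp: slitD_def complex_nonpos_Reals_iff)

lemma open_slitD: "open slitD"
  unfolding slitD_eq by (simp add: open_Compl)

lemma of_real_in_slitD [simp]: "complex_of_real x \<in> slitD \<longleftrightarrow> 0 < x"
  by (auto simp: slitD_def)

lemma slitD_simply_connected: "simply_connected slitD"
proof (rule starlike_imp_simply_connected)
  show "starlike slitD" unfolding starlike_def
  proof (intro bexI ballI)
    show "(1::complex) \<in> slitD" by (simp add: slitD_def)
    fix z :: complex assume z: "z \<in> slitD"
    show "closed_segment 1 z \<subseteq> slitD"
    proof
      fix w assume "w \<in> closed_segment 1 z"
      then obtain u where u: "0 \<le> u" "u \<le> 1" "w = (1 - u) *\<^sub>R 1 + u *\<^sub>R z"
        by (auto simp: in_segment)
      have im: "Im w = u * Im z" and re: "Re w = (1 - u) + u * Re z" by (auto simp: u(3))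
      show "w \<in> slitD"
      proof (rule ccontr)
        assume "w \<notin> slitD"
        then have *: "Im w = 0" "Re w \<le> 0" by (auto simp: slitD_def)
        from * im have "u = 0 \<or> Im z = 0" by auto
        then show False
        proof
          assume "u = 0" then show False using re * by simp
        next
          assume "Im z = 0"
          then have "Re z > 0" using z by (auto simp: slitD_def)
          then have "u * Re z \<ge> 0" using u by simp
          moreover have "u * Re z > 0 \<or> 1 - u > 0" using u \<open>Re z > 0\<close> by (cases "u = 1") auto
          ultimately show False using re * u by linarith
        qed
      qed
    qed
  qed
qed

lemma halfplane_subset_slitD: "{z. 0 < Re z} \<subseteq> slitD"
  by (auto simp: slitD_def)

lemma Re_pos_cball:
  assumes "r < c" "z \<in> cball (complex_of_real c) r" shows "0 < Re z"
proof -
  have "\<bar>Re (complex_of_real c - z)\<bar> \<le> cmod (complex_of_real c - z)" by (rule abs_Re_le_cmod)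
  then show ?thesis using assms by (simp add: dist_norm)
qed

lemma cball_subset_slitD: "r < c \<Longrightarrow> cball (complex_of_real c) r \<subseteq> slitD"
  using Re_pos_cball halfplane_subset_slitD by blast

lemma winding_number_slitD:
  assumes "path g" "path_image g \<subseteq> slitD" "pathfinish g = pathstart g" "z \<notin> slitD"
  shows "winding_number g z = 0"
  using assms slitD_simply_connected simply_connected_imp_winding_number_zero by blast

lemma enclosing_disc:
  fixes S :: "complex set"
  assumes "finite S" "\<And>z. z \<in> S \<Longrightarrow> 0 < Re z"
  obtains c r where "0 < r" "r < c" "S \<subseteq> disc c r"
proof -
  define d where "d = Min (insert 1 (Re ` S)) / 2"
  have d: "0 < d" "\<And>z. z \<in> S \<Longrightarrow> 2 * d \<le> Re z"
    using assms by (auto simp: d_def)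
  define M where "M = Max (insert 0 ((\<lambda>z. (cmod z)\<^sup>2) ` S))"
  have M: "0 \<le> M" "\<And>z. z \<in> S \<Longrightarrow> (cmod z)\<^sup>2 \<le> M"
    using assms by (auto simp: M_def)
  define c where "c = M / d + d + 1"
  have c: "0 < c - d" "M < c * (2 * d)"
  proof -
    have "c * (2*d) = 2 * M + 2 * d^2 + 2 * d" using d by (simp add: c_def field_simps power2_eq_square)
    then show "M < c * (2 * d)" using d M
      by (smt (verit) zero_le_power2)
    have "M / d \<ge> 0" using d M by simp
    then show "0 < c - d" by (simp add: c_def)
  qed
  have "S \<subseteq> ball (complex_of_real c) (c - d)"
  proof
    fix z assume z: "z \<in> S"
    have "(cmod (complex_of_real c - z))\<^sup>2 = c\<^sup>2 - 2 * c * Re z + (cmod z)\<^sup>2"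
      by (simp only: cmod_power2 minus_complex.simps Re_complex_of_real Im_complex_of_real)
         (simp add: power2_diff)
    also have "\<dots> \<le> c\<^sup>2 - 2 * c * (2 * d) + M"
      using d(2)[OF z] M(2)[OF z] c d by (intro add_mono diff_mono mult_left_mono) auto
    also have "\<dots> < (c - d)\<^sup>2"
      using c(2) by (simp add: power2_eq_square algebra_simps) (use d in \<open>smt (verit) mult_pos_pos\<close>)
    finally have "cmod (complex_of_real c - z) < c - d"
      by (rule power2_less_imp_less) (use c(1) in simp)
    then show "z \<in> ball (complex_of_real c) (c - d)" by (simp add: dist_norm)
  qed
  then show thesis using that[of "c - d" c] c d by auto
qed

definition cint :: "real \<Rightarrow> real \<Rightarrow> (complex \<Rightarrow> complex) \<Rightarrow> complex" where
  "cint c r F = contour_integral (circlepath (complex_of_real c) r) F / (2 * pi * \<i>)"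

lemma winding_number_circlepath_outside:
  assumes "0 < r" "w \<notin> cball z r" shows "winding_number (circlepath z r) w = 0"
  by (rule winding_number_zero_outside[where s = "cball z r"])
     (use assms in \<open>auto simp: valid_path_imp_path\<close>)

lemma cint_residues:
  assumes "0 < r" "r < c" "finite pts" "F holomorphic_on slitD - pts"
    "pts \<inter> circ c r = {}"
  shows "cint c r F = (\<Sum>p \<in> pts \<inter> disc c r. residue F p)"
proof -
  let ?g = "circlepath (complex_of_real c) r"
  have img: "path_image ?g = circ c r" using assms by simp
  have sub: "path_image ?g \<subseteq> slitD"
    using cball_subset_slitD[OF assms(2)] sphere_cball unfolding img by blast
  have "contour_integral ?g F = 2 * pi * \<i> * (\<Sum>p\<in>pts. winding_number ?g p * residue F p)"
  proof (rule Residue_theorem[OF open_slitD _ assms(3,4)])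
    show "connected slitD" using slitD_simply_connected simply_connected_imp_connected by blast
    show "path_image ?g \<subseteq> slitD - pts" using sub assms(5) unfolding img by blast
    show "\<forall>z. z \<notin> slitD \<longrightarrow> winding_number ?g z = 0"
      using winding_number_slitD[of ?g] sub by (auto simp: valid_path_imp_path)
  qed auto
  also have "(\<Sum>p\<in>pts. winding_number ?g p * residue F p)
      = (\<Sum>p\<in>pts. if p \<in> disc c r then residue F p else 0)"
  proof (rule sum.cong[OF refl])
    fix p assume p: "p \<in> pts"
    show "winding_number ?g p * residue F p = (if p \<in> disc c r then residue F p else 0)"
    proof (cases "p \<in> disc c r")
      case True
      then have "winding_number ?g p = 1"
        by (intro winding_number_circlepath) (simp add: dist_norm norm_minus_commute)
      then show ?thesis using True by simp
    next
      case False
      then have "p \<notin> cball (complex_of_real c) r" using p assms(5) by (auto simp: less_le)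
      then show ?thesis using False winding_number_circlepath_outside[OF assms(1)] by simp
    qed
  qed
  also have "\<dots> = (\<Sum>p \<in> pts \<inter> disc c r. residue F p)"
    by (simp add: sum.inter_restrict[OF assms(3)])
  finally show ?thesis by (simp add: cint_def)
qed

lemma contour_integral_eq_cint:
  assumes "0 < r" "r < c" "finite pts" "F holomorphic_on slitD - pts"
    and pts: "pts \<subseteq> disc c r"
    and g: "valid_path g" "pathfinish g = pathstart g" "path_image g \<subseteq> slitD"
      "\<And>e. e \<in> pts \<Longrightarrow> e \<notin> path_image g \<and> winding_number g e = 1"
  shows "contour_integral g F / (2 * pi * \<i>) = cint c r F"
proof -
  have "contour_integral g F = 2 * pi * \<i> * (\<Sum>p\<in>pts. winding_number g p * residue F p)"
  proof (rule Residue_theorem[OF open_slitD _ assms(3,4) g(1,2)])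
    show "connected slitD" using slitD_simply_connected simply_connected_imp_connected by blast
    show "path_image g \<subseteq> slitD - pts" using g by blast
    show "\<forall>z. z \<notin> slitD \<longrightarrow> winding_number g z = 0"
      using winding_number_slitD[of g] g by (auto simp: valid_path_imp_path)
  qed
  also have "(\<Sum>p\<in>pts. winding_number g p * residue F p) = (\<Sum>p\<in>pts. residue F p)"
    using g(4) by (intro sum.cong) auto
  also have "\<dots> = cint c r F"
    using pts by (subst cint_residues[OF assms(1-4)]) (auto simp: Int_absorb2)
  finally show ?thesis by simp
qed

lemma cint_integrable:
  assumes "continuous_on (circ c r) F" "0 < r"
  shows "F contour_integrable_on circlepath (complex_of_real c) r"
  using assms by (intro contour_integrable_continuous_circlepath) simp

lemma cint_add:
  assumes "continuous_on (circ c r) F" "continuous_on (circ c r) G" "0 < r"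
  shows "cint c r (\<lambda>z. F z + G z) = cint c r F + cint c r G"
  unfolding cint_def by (subst contour_integral_add) (use assms cint_integrable in \<open>auto simp: add_divide_distrib\<close>)

lemma cint_cmult:
  assumes "continuous_on (circ c r) F" "0 < r"
  shows "cint c r (\<lambda>z. a * F z) = a * cint c r F"
  unfolding cint_def by (subst contour_integral_lmul) (use assms cint_integrable in auto)

lemma cint_uminus: "cint c r (\<lambda>z. - F z) = - cint c r F"
  unfolding cint_def by (simp add: contour_integral_neg)

lemma cint_sum:
  assumes "finite I" "\<And>i. i \<in> I \<Longrightarrow> continuous_on (circ c r) (F i)" "0 < r"
  shows "cint c r (\<lambda>z. \<Sum>i\<in>I. F i z) = (\<Sum>i\<in>I. cint c r (F i))"
  unfolding cint_def by (subst contour_integral_sum) (use assms cint_integrable in \<open>auto simp: sum_divide_distrib\<close>)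

lemma cint_cong:
  assumes "\<And>z. z \<in> circ c r \<Longrightarrow> F z = G z" "0 < r"
  shows "cint c r F = cint c r G"
  unfolding cint_def using assms by (metis contour_integral_cong path_image_circlepath_nonneg less_imp_le)

lemma cint_cauchy:
  assumes "F holomorphic_on cball (complex_of_real c) r" "w \<in> disc c r"
  shows "cint c r (\<lambda>z. F z / (z - w)) = F w"
proof -
  have "norm (w - complex_of_real c) < r" using assms(2) by (simp add: dist_norm norm_minus_commute)
  from contour_integral_unique[OF Cauchy_integral_circlepath_simple[OF assms(1) this]]
  show ?thesis by (simp add: cint_def)
qed

lemma cint_cauchy_deriv:
  assumes "F holomorphic_on cball (complex_of_real c) r" "w \<in> disc c r"
  shows "cint c r (\<lambda>z. F z / (z - w)\<^sup>2) = deriv F w"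
proof -
  have F: "continuous_on (cball (complex_of_real c) r) F" "F holomorphic_on disc c r"
    using assms(1) holomorphic_on_imp_continuous_on holomorphic_on_subset ball_subset_cball by blast+
  from DERIV_imp_deriv[OF Cauchy_derivative_integral_circlepath(2)[OF F assms(2)]]
  show ?thesis by (simp add: cint_def)
qed

lemma cint_holomorphic:
  assumes "F holomorphic_on cball (complex_of_real c) r" "0 < r"
  shows "cint c r F = 0"
proof -
  have "contour_integral (circlepath (complex_of_real c) r) F = 0"
    using assms by (intro contour_integral_unique Cauchy_theorem_convex_simple[where S="cball (complex_of_real c) r"]) auto
  then show ?thesis by (simp add: cint_def)
qed

lemma cint_tendsto:
  assumes "eventually (\<lambda>n. continuous_on (circ c r) (F n)) A"
    "uniform_limit (circ c r) F G A" "A \<noteq> bot" "0 < r"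
  shows "((\<lambda>n. cint c r (F n)) \<longlongrightarrow> cint c r G) A"
proof -
  have "eventually (\<lambda>n. F n contour_integrable_on circlepath (complex_of_real c) r) A"
    using assms(1) by eventually_elim (use assms(4) cint_integrable in auto)
  then have "((\<lambda>n. contour_integral (circlepath (complex_of_real c) r) (F n)) \<longlongrightarrow> contour_integral (circlepath (complex_of_real c) r) G) A"
    using assms contour_integral_uniform_limit_circlepath(2)[of F "complex_of_real c" r A G] by auto
  then show ?thesis unfolding cint_def by (intro tendsto_divide) auto
qed

definition reflect :: "(complex \<Rightarrow> complex) \<Rightarrow> complex \<Rightarrow> complex" where
  "reflect u z = cnj (u (cnj z))"

lemma cnj_mem_ball [simp]: "cnj z \<in> disc c r \<longleftrightarrow> z \<in> disc c r"
proof -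
  have "cmod (complex_of_real c - cnj z) = cmod (cnj (complex_of_real c - z))" by simp
  also have "\<dots> = cmod (complex_of_real c - z)" by (rule complex_mod_cnj)
  finally show ?thesis by (simp add: dist_norm)
qed

lemma cnj_mem_sphere [simp]: "cnj z \<in> circ c r \<longleftrightarrow> z \<in> circ c r"
proof -
  have "cmod (complex_of_real c - cnj z) = cmod (cnj (complex_of_real c - z))" by simp
  also have "\<dots> = cmod (complex_of_real c - z)" by (rule complex_mod_cnj)
  finally show ?thesis by (simp add: dist_norm)
qed

lemma continuous_on_reflect:
  assumes "continuous_on (circ c r) u"
  shows "continuous_on (circ c r) (reflect u)"
proof -
  have "continuous_on (cnj ` circ c r) u"
    using assms by (rule continuous_on_subset) (metis cnj_mem_sphere image_subsetI)
  then have "continuous_on (circ c r) (\<lambda>z. u (cnj z))"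
    by (rule continuous_on_compose2) (auto intro: continuous_intros)
  then show ?thesis unfolding reflect_def by (rule continuous_on_cnj)
qed

lemma cint_reflect:
  assumes "0 < r"
  shows "cint c r (reflect F) = cnj (cint c r F)"
proof -
  let ?g = "circlepath (complex_of_real c) r"
  have eq: "cnj \<circ> ?g = part_circlepath (complex_of_real c) r (- 0) (- (2 * pi))"
    by (rule ext) (simp add: circlepath_def part_circlepath_def linepath_def exp_cnj)
  have "contour_integral (cnj \<circ> ?g) F = cnj (contour_integral ?g (cnj \<circ> F \<circ> cnj))"
    by (rule contour_integral_cnj) simp
  also have "cnj \<circ> F \<circ> cnj = reflect F" by (auto simp: reflect_def)
  also have "contour_integral (cnj \<circ> ?g) F = - contour_integral ?g F"
  proof -
    have "contour_integral (part_circlepath (complex_of_real c) r 0 (- (2 * pi))) F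
      = - contour_integral (part_circlepath (complex_of_real c) r (- (2*pi)) 0) F"
      by (rule contour_integral_part_circlepath_reverse)
    also have "part_circlepath (complex_of_real c) r (- (2*pi)) 0 = ?g"
    proof (rule ext)
      fix x
      have "exp (\<i> * (- (2 * pi) * (1 - x))) = exp (\<i> * (2 * pi * x) - 2 * of_real pi * \<i>)"
        by (rule arg_cong[where f = exp]) (simp add: complex_eq_iff algebra_simps)
      also have "\<dots> = exp (\<i> * (2 * pi * x))"
        by (simp only: exp_diff exp_two_pi_i div_by_1)
      finally show "part_circlepath (complex_of_real c) r (- (2*pi)) 0 x = ?g x"
        by (simp add: circlepath_def part_circlepath_def linepath_def algebra_simps)
    qed
    finally show ?thesis unfolding eq by simp
  qed
  finally have "cnj (contour_integral ?g (reflect F)) = - contour_integral ?g F" by simp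
  then have *: "contour_integral ?g (reflect F) = - cnj (contour_integral ?g F)"
    by (metis complex_cnj_cnj complex_cnj_minus)
  show ?thesis unfolding cint_def * by (simp)
qed

section \<open>Functional calculus and the first-order consequence of matrix monotonicity\<close>

lemma smult_mat_vec:
  fixes A :: "'a :: comm_ring_1 mat"
  assumes "A \<in> carrier_mat n m" "v \<in> carrier_vec m"
  shows "(k \<cdot>\<^sub>m A) *\<^sub>v v = k \<cdot>\<^sub>v (A *\<^sub>v v)"
  using assms by (intro eq_vecI) (auto simp: scalar_prod_def sum_distrib_left mult_ac)

lemma resolvent_eqI:
  assumes "X \<in> carrier_mat n n" "M \<in> carrier_mat n n" "(z \<cdot>\<^sub>m 1\<^sub>m n - X) * M = 1\<^sub>m n"
  shows "resolvent X z = M"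
proof -
  let ?Y = "z \<cdot>\<^sub>m 1\<^sub>m n - X"
  have Y: "?Y \<in> carrier_mat n n" using assms(1) by auto
  have left: "M * ?Y = 1\<^sub>m n" by (rule mat_mult_left_right_inverse[OF Y assms(2,3)])
  have dim: "dim_row X = n" using assms(1) by auto
  show ?thesis unfolding resolvent_def dim
  proof (rule some_equality)
    show "M \<in> carrier_mat n n \<and> ?Y * M = 1\<^sub>m n \<and> M * ?Y = 1\<^sub>m n" using assms left by auto
    fix B assume B: "B \<in> carrier_mat n n \<and> ?Y * B = 1\<^sub>m n \<and> B * ?Y = 1\<^sub>m n"
    have "B = B * (?Y * M)" unfolding assms(3) using B by (simp add: right_mult_one_mat[of B n n])
    also have "\<dots> = (B * ?Y) * M" by (rule assoc_mult_mat[symmetric, of _ n n _ n _ n]) (use B Y assms in auto)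
    also have "\<dots> = M" using B assms by simp
    finally show "B = M" .
  qed
qed

lemma resolvent_adj_mat:
  assumes X: "X \<in> carrier_mat n n" and z: "\<not> eigenvalue X z"
  shows "resolvent X z = mat n n (\<lambda>(i,j). poly (adj_mat (char_poly_matrix X) $$ (i,j)) z / poly (char_poly X) z)"
proof (rule resolvent_eqI[OF X])
  let ?C = "char_poly_matrix X" and ?p = "char_poly X"
  let ?M = "mat n n (\<lambda>(i,j). poly (adj_mat ?C $$ (i,j)) z / poly ?p z)"
  have C: "?C \<in> carrier_mat n n" using X by simp
  have nz: "poly ?p z \<noteq> 0" using z eigenvalue_root_char_poly[OF X] by simp
  show "(z \<cdot>\<^sub>m 1\<^sub>m n - X) * ?M = 1\<^sub>m n"
  proof (rule eq_matI)
    fix i j assume "i < dim_row (1\<^sub>m n :: complex mat)" "j < dim_col (1\<^sub>m n :: complex mat)"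
    then have ij: "i < n" "j < n" by auto
    have "(?C * adj_mat ?C) $$ (i,j) = (?p \<cdot>\<^sub>m 1\<^sub>m n) $$ (i,j)"
      using adj_mat(2)[OF C] by (simp add: char_poly_def)
    then have "(\<Sum>k<n. ?C $$ (i,k) * adj_mat ?C $$ (k,j)) = (if i = j then ?p else 0)"
      using ij C adj_mat(1)[OF C] by (auto simp: scalar_prod_def atLeast0LessThan)
    then have *: "(\<Sum>k<n. poly (?C $$ (i,k)) z * poly (adj_mat ?C $$ (k,j)) z) = (if i = j then poly ?p z else 0)"
      by (metis (no_types, lifting) poly_0 poly_mult poly_sum sum.cong)
    have "((z \<cdot>\<^sub>m 1\<^sub>m n - X) * ?M) $$ (i,j)
        = (\<Sum>k<n. (z \<cdot>\<^sub>m 1\<^sub>m n - X) $$ (i,k) * (poly (adj_mat ?C $$ (k,j)) z / poly ?p z))"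
      using ij X by (auto simp: scalar_prod_def atLeast0LessThan intro!: sum.cong)
    also have "\<dots> = (\<Sum>k<n. poly (?C $$ (i,k)) z * poly (adj_mat ?C $$ (k,j)) z / poly ?p z)"
      using ij X by (intro sum.cong) (auto simp: char_poly_matrix_def)
    also have "\<dots> = (if i = j then 1 else 0)"
      using * nz by (simp add: sum_divide_distrib[symmetric])
    finally show "((z \<cdot>\<^sub>m 1\<^sub>m n - X) * ?M) $$ (i,j) = 1\<^sub>m n $$ (i,j)" using ij by simp
  qed (use X in auto)
qed auto

lemma finite_eigenvalues:
  assumes "(X :: complex mat) \<in> carrier_mat n n" shows "finite {e. eigenvalue X e}"
proof -
  have "char_poly X \<noteq> 0" using degree_monic_char_poly[OF assms] by auto
  then show ?thesis using eigenvalue_root_char_poly[OF assms] poly_roots_finite by simp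
qed

lemma resolvent_holomorphic:
  assumes X: "X \<in> carrier_mat n n" and ij: "i < n" "j < n"
  shows "(\<lambda>z. resolvent X z $$ (i,j)) holomorphic_on - {e. eigenvalue X e}"
proof (rule holomorphic_transform)
  show "(\<lambda>z. poly (adj_mat (char_poly_matrix X) $$ (i,j)) z / poly (char_poly X) z) holomorphic_on - {e. eigenvalue X e}"
    using eigenvalue_root_char_poly[OF X] by (intro holomorphic_intros) auto
qed (use ij in \<open>simp add: resolvent_adj_mat[OF X]\<close>)

lemma mfun_eq_cint:
  assumes X: "X \<in> carrier_mat n n" and f: "f holomorphic_on slitD" and rc: "0 < r" "r < c"
    and ev: "{e. eigenvalue X e} \<subseteq> disc c r"
  shows "mfun f X = mat n n (\<lambda>(i,j). cint c r (\<lambda>z. f z * resolvent X z $$ (i,j)))"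
proof -
  have dim: "dim_row X = n" using X by auto
  define g where "g = (SOME g. admissible_contour X g)"
  have "admissible_contour X (circlepath (complex_of_real c) r)"
    unfolding admissible_contour_def
  proof (intro conjI allI impI)
    show "path_image (circlepath (complex_of_real c) r) \<subseteq> slitD"
      using cball_subset_slitD[OF rc(2)] sphere_cball rc by auto
    fix e assume "eigenvalue X e"
    then have e: "e \<in> disc c r" using ev by auto
    then show "e \<notin> path_image (circlepath (complex_of_real c) r)" using rc by simp
    show "winding_number (circlepath (complex_of_real c) r) e = 1"
      using e by (intro winding_number_circlepath) (simp add: dist_norm norm_minus_commute)
  qed (use rc in \<open>auto simp: simple_path_circlepath\<close>)
  then have adm: "admissible_contour X g" unfolding g_def by (rule someI[of "admissible_contour X"])
  have "contour_integral g (\<lambda>z. f z * resolvent X z $$ (i,j)) / (2 * pi * \<i>) = cint c r (\<lambda>z. f z * resolvent X z $$ (i,j))"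
    if "i < n" "j < n" for i j
    using adm unfolding admissible_contour_def
    by (intro contour_integral_eq_cint[OF rc finite_eigenvalues[OF X] _ ev] holomorphic_intros
        holomorphic_on_subset[OF f] holomorphic_on_subset[OF resolvent_holomorphic[OF X that]]) auto
  then show ?thesis unfolding mfun_def dim g_def[symmetric] Let_def
    by (intro cong_mat) auto
qed

lemma holomorphic_continuous_sphere:
  assumes "F holomorphic_on S" "sphere c r \<subseteq> S"
  shows "continuous_on (sphere c r) F"
  using assms holomorphic_on_imp_continuous_on continuous_on_subset by blast

lemma sphere_subset_slitD: "r < c \<Longrightarrow> circ c r \<subseteq> slitD"
  using cball_subset_slitD sphere_cball by blast

lemma mfun_functional:
  assumes X: "X \<in> carrier_mat n n" and f: "f holomorphic_on slitD" and rc: "0 < r" "r < c"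
    and ev: "{e. eigenvalue X e} \<subseteq> disc c r"
  shows "(\<Sum>i<n. \<Sum>j<n. k i j * mfun f X $$ (i,j)) =
    cint c r (\<lambda>z. f z * (\<Sum>i<n. \<Sum>j<n. k i j * resolvent X z $$ (i,j)))"
proof -
  have R: "continuous_on (circ c r) (\<lambda>z. f z * resolvent X z $$ (i,j))" if "i < n" "j < n" for i j
    using ev by (intro continuous_intros holomorphic_continuous_sphere[OF f] holomorphic_continuous_sphere[OF resolvent_holomorphic[OF X that]]
       sphere_subset_slitD rc) auto
  have "cint c r (\<lambda>z. f z * (\<Sum>i<n. \<Sum>j<n. k i j * resolvent X z $$ (i,j)))
    = cint c r (\<lambda>z. \<Sum>i<n. \<Sum>j<n. k i j * (f z * resolvent X z $$ (i,j)))"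
    by (simp add: sum_distrib_left mult.left_commute)
  also have "\<dots> = (\<Sum>i<n. cint c r (\<lambda>z. \<Sum>j<n. k i j * (f z * resolvent X z $$ (i,j))))"
    by (intro cint_sum rc continuous_on_sum continuous_on_mult_left R) auto
  also have "\<dots> = (\<Sum>i<n. \<Sum>j<n. cint c r (\<lambda>z. k i j * (f z * resolvent X z $$ (i,j))))"
    by (intro sum.cong refl cint_sum rc continuous_on_mult_left R) auto
  also have "\<dots> = (\<Sum>i<n. \<Sum>j<n. k i j * cint c r (\<lambda>z. f z * resolvent X z $$ (i,j)))"
    using R by (intro sum.cong refl cint_cmult rc) auto
  also have "\<dots> = (\<Sum>i<n. \<Sum>j<n. k i j * mfun f X $$ (i,j))"
    unfolding mfun_eq_cint[OF assms] by (intro sum.cong refl) simp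
  finally show ?thesis by simp
qed

lemma qform_sum:
  assumes "M \<in> carrier_mat n n" "x \<in> carrier_vec n"
  shows "qform M x = (\<Sum>i<n. \<Sum>j<n. (cnj (x $ i) * x $ j) * M $$ (i,j))"
  using assms unfolding qform_def
  by (auto simp: scalar_prod_def sum_distrib_left mult_ac atLeast0LessThan intro!: sum.cong)

lemma qform_minus:
  assumes "A \<in> carrier_mat n n" "B \<in> carrier_mat n n" "x \<in> carrier_vec n"
  shows "qform (A - B) x = qform A x - qform B x"
proof -
  have "A - B \<in> carrier_mat n n" using assms by (intro minus_carrier_mat)
  from qform_sum[OF this assms(3)] show ?thesis
    unfolding qform_sum[OF assms(1,3)] qform_sum[OF assms(2,3)]
    using assms by (simp add: sum_subtractf[symmetric] right_diff_distrib)
qed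

definition diag_ones :: "nat \<Rightarrow> (nat \<Rightarrow> real) \<Rightarrow> real \<Rightarrow> complex mat" where
  "diag_ones m x \<eta> = mat m m (\<lambda>(i,j). complex_of_real ((if i = j then x i else 0) + \<eta>))"

lemma diag_ones_carrier [simp]: "diag_ones m x \<eta> \<in> carrier_mat m m"
  by (simp add: diag_ones_def)

lemma diag_ones_resolvent:
  assumes z: "\<And>i. i < m \<Longrightarrow> z \<noteq> complex_of_real (x i)"
    and h: "h = (\<Sum>i<m. 1 / (z - complex_of_real (x i)))" "1 - \<eta> * h \<noteq> 0"
  shows "resolvent (diag_ones m x \<eta>) z = mat m m (\<lambda>(i,j). (if i = j then 1 / (z - complex_of_real (x i)) else 0)
      + \<eta> / ((1 - \<eta> * h) * (z - complex_of_real (x i)) * (z - complex_of_real (x j))))"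
    (is "_ = ?M")
    and "\<not> eigenvalue (diag_ones m x \<eta>) z"
proof -
  let ?D = "diag_ones m x \<eta>"
  have D: "?D \<in> carrier_mat m m" by simp
  have inv: "(z \<cdot>\<^sub>m 1\<^sub>m m - ?D) * ?M = 1\<^sub>m m"
  proof (rule eq_matI)
    fix i j assume "i < dim_row (1\<^sub>m m :: complex mat)" "j < dim_col (1\<^sub>m m :: complex mat)"
    then have ij: "i < m" "j < m" by auto
    define y where "y = (\<lambda>k. z - complex_of_real (x k))"
    define d where "d = 1 - \<eta> * h"
    have y0: "y k \<noteq> 0" if "k < m" for k using z[OF that] by (simp add: y_def)
    have d0: "d \<noteq> 0" using h(2) by (simp add: d_def)
    have "((z \<cdot>\<^sub>m 1\<^sub>m m - ?D) * ?M) $$ (i,j)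
      = (\<Sum>k<m. ((if k = i then y i else 0) - \<eta>) * ((if k = j then 1 / y j else 0) + \<eta> / (d * y k * y j)))"
      using ij by (auto simp: diag_ones_def scalar_prod_def atLeast0LessThan y_def d_def intro!: sum.cong)
    also have "\<dots> = (\<Sum>k<m. (if k = i then y i * ((if i = j then 1 / y j else 0) + \<eta> / (d * y i * y j)) else 0)
       - (if k = j then \<eta> / y j else 0) - (\<eta>^2 / (d * y j)) * (1 / y k))"
    proof (intro sum.cong refl)
      have dist: "(A - e) * (B + C) = A * (B + C) - e * B - e * C" for A e B C :: complex
        by (simp add: ring_distribs)
      show "((if k = i then y i else 0) - \<eta>) * ((if k = j then 1 / y j else 0) + \<eta> / (d * y k * y j))
        = (if k = i then y i * ((if i = j then 1 / y j else 0) + \<eta> / (d * y i * y j)) else 0)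
       - (if k = j then \<eta> / y j else 0) - (\<eta>^2 / (d * y j)) * (1 / y k)" for k
        unfolding dist by (auto simp: power2_eq_square mult_ac)
    qed
    also have "\<dots> = y i * ((if i = j then 1 / y j else 0) + \<eta> / (d * y i * y j))
        - \<eta> / y j - (\<eta>^2 / (d * y j)) * h"
      unfolding h(1) using ij by (simp add: sum_subtractf sum_distrib_left y_def)
    also have "\<dots> = (if i = j then 1 else 0) + (\<eta> / (d * y j) - \<eta> / y j - (\<eta>^2 / (d * y j)) * h)"
      using y0[OF ij(1)] y0[OF ij(2)] d0 by (simp add: field_simps)
    also have "\<eta> / (d * y j) - \<eta> / y j - (\<eta>^2 / (d * y j)) * h = (\<eta> - \<eta> * d - \<eta>^2 * h) / (d * y j)"
      using y0[OF ij(2)] d0 by (simp add: field_simps)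
    also have "\<eta> - \<eta> * d - \<eta>^2 * h = 0"
      by (simp add: d_def algebra_simps power2_eq_square)
    also have "(if i = j then 1 else 0) + 0 / (d * y j) = (if i = j then 1 else 0)" by simp
    finally show "((z \<cdot>\<^sub>m 1\<^sub>m m - ?D) * ?M) $$ (i,j) = 1\<^sub>m m $$ (i,j)" using ij by simp
  qed (auto simp: diag_ones_def)
  show "resolvent ?D z = ?M" by (rule resolvent_eqI[OF D _ inv]) auto
  show "\<not> eigenvalue ?D z"
  proof
    assume "eigenvalue ?D z"
    then obtain v where v: "v \<in> carrier_vec m" "v \<noteq> 0\<^sub>v m" "?D *\<^sub>v v = z \<cdot>\<^sub>v v"
      by (auto simp: eigenvalue_def eigenvector_def diag_ones_def)
    have Y: "z \<cdot>\<^sub>m 1\<^sub>m m - ?D \<in> carrier_mat m m" by (rule minus_carrier_mat) simp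
    have "(z \<cdot>\<^sub>m 1\<^sub>m m - ?D) *\<^sub>v v = (z \<cdot>\<^sub>m 1\<^sub>m m) *\<^sub>v v - ?D *\<^sub>v v"
      by (rule minus_mult_distrib_mat_vec[of _ m m]) (use v in auto)
    also have "(z \<cdot>\<^sub>m 1\<^sub>m m) *\<^sub>v v = z \<cdot>\<^sub>v v" using v by (simp add: smult_mat_vec[of _ m m])
    finally have 0: "(z \<cdot>\<^sub>m 1\<^sub>m m - ?D) *\<^sub>v v = 0\<^sub>v m" using v by auto
    have "?M * (z \<cdot>\<^sub>m 1\<^sub>m m - ?D) = 1\<^sub>m m"
      by (rule mat_mult_left_right_inverse[OF Y _ inv]) simp
    then have "v = ?M * (z \<cdot>\<^sub>m 1\<^sub>m m - ?D) *\<^sub>v v" using v by simp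
    also have "\<dots> = ?M *\<^sub>v ((z \<cdot>\<^sub>m 1\<^sub>m m - ?D) *\<^sub>v v)"
      by (rule assoc_mult_mat_vec[of _ m m _ m]) (use v Y in auto)
    also have "\<dots> = 0\<^sub>v m" unfolding 0 by (auto simp: scalar_prod_def)
    finally show False using v by simp
  qed
qed

lemma diag_ones_hermitian: "hermitian (diag_ones m x \<eta>)"
  unfolding hermitian_def adj_def by (auto simp: diag_ones_def intro!: eq_matI)

lemma qform_diag_ones:
  assumes y: "y \<in> carrier_vec m"
  shows "Re (qform (diag_ones m x \<eta>) y) = (\<Sum>i<m. x i * (cmod (y $ i))\<^sup>2) + \<eta> * (cmod (\<Sum>i<m. y $ i))\<^sup>2"
proof -
  have sq: "complex_of_real ((cmod w)\<^sup>2) = cnj w * w" for w by (metis complex_norm_square mult.commute)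
  have "qform (diag_ones m x \<eta>) y = (\<Sum>i<m. \<Sum>j<m. (if j = i then x i * (cnj (y $ i) * y $ i) else 0) + \<eta> * (cnj (y $ i) * y $ j))"
    unfolding qform_sum[OF diag_ones_carrier y]
    by (intro sum.cong refl) (auto simp: diag_ones_def algebra_simps)
  also have "\<dots> = (\<Sum>i<m. x i * (cnj (y $ i) * y $ i)) + \<eta> * (\<Sum>i<m. \<Sum>j<m. cnj (y $ i) * y $ j)"
    by (simp add: sum.distrib sum_distrib_left)
  also have "(\<Sum>i<m. \<Sum>j<m. cnj (y $ i) * y $ j) = cnj (\<Sum>i<m. y $ i) * (\<Sum>i<m. y $ i)"
    by (simp add: sum_product)
  finally show ?thesis unfolding sq[symmetric] by (simp del: of_real_power)
qed

lemma diag_ones_mono: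
  assumes f: "matrix_monotone_class f" and x: "\<And>i. i < m \<Longrightarrow> 0 < x i" and \<eta>: "0 \<le> \<eta>"
    and y: "y \<in> carrier_vec m"
  shows "Re (qform (mfun f (diag_ones m x 0)) y) \<le> Re (qform (mfun f (diag_ones m x \<eta>)) y)"
proof -
  have pd: "pd (diag_ones m x \<eta>')" if "0 \<le> \<eta>'" for \<eta>'
    unfolding pd_def
  proof (intro conjI diag_ones_hermitian ballI impI)
    fix v :: "complex Matrix.vec"
    assume "v \<in> carrier_vec (dim_row (diag_ones m x \<eta>'))" "v \<noteq> 0\<^sub>v (dim_row (diag_ones m x \<eta>'))"
    then have v: "v \<in> carrier_vec m" "v \<noteq> 0\<^sub>v m" by (auto simp: diag_ones_def)
    then obtain i where i: "i < m" "v $ i \<noteq> 0" by (metis carrier_vecD eq_vecI index_zero_vec)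
    have "0 < (\<Sum>i<m. x i * (cmod (v $ i))\<^sup>2)"
      by (rule sum_pos2[of _ i]) (use i x in \<open>auto intro!: mult_nonneg_nonneg simp: less_imp_le\<close>)
    then show "0 < Re (qform (diag_ones m x \<eta>') v)" unfolding qform_diag_ones[OF v(1)]
      using that by (simp add: add_pos_nonneg)
  qed
  have diff: "diag_ones m x \<eta> - diag_ones m x 0 = diag_ones m (\<lambda>_. 0) \<eta>"
    by (rule eq_matI) (auto simp: diag_ones_def)
  have "psd (diag_ones m (\<lambda>_. 0) \<eta>)"
    unfolding psd_def
  proof (intro conjI diag_ones_hermitian ballI)
    fix v :: "complex Matrix.vec"
    assume "v \<in> carrier_vec (dim_row (diag_ones m (\<lambda>_. 0) \<eta>))"
    then have "v \<in> carrier_vec m" by (simp add: diag_ones_def)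
    from qform_diag_ones[OF this] show "0 \<le> Re (qform (diag_ones m (\<lambda>_. 0) \<eta>) v)" using \<eta> by simp
  qed
  then have "loewner_le (diag_ones m x 0) (diag_ones m x \<eta>)"
    unfolding loewner_le_def diff by (simp add: diag_ones_def)
  then have "loewner_le (mfun f (diag_ones m x 0)) (mfun f (diag_ones m x \<eta>))"
    using f pd \<eta> unfolding matrix_monotone_class_def by (meson diag_ones_carrier order_refl)
  then have nn: "0 \<le> Re (qform (mfun f (diag_ones m x \<eta>) - mfun f (diag_ones m x 0)) y)"
    using y unfolding loewner_le_def psd_def by (auto simp: mfun_def diag_ones_def Let_def)
  have car: "mfun f (diag_ones m x \<eta>') \<in> carrier_mat m m" for \<eta>'
    by (simp add: mfun_def diag_ones_def Let_def)
  have "qform (mfun f (diag_ones m x \<eta>) - mfun f (diag_ones m x 0)) y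
    = qform (mfun f (diag_ones m x \<eta>)) y - qform (mfun f (diag_ones m x 0)) y"
    by (rule qform_minus[OF car car y])
  then show ?thesis using nn by simp
qed


lemma uniform_limit_linear_bound:
  fixes F :: "real \<Rightarrow> complex \<Rightarrow> complex"
  assumes "0 < e" and b: "\<And>h z. 0 < h \<Longrightarrow> h < e \<Longrightarrow> z \<in> S \<Longrightarrow> cmod (F h z - G z) \<le> K * h"
  shows "uniform_limit S F G (at_right 0)"
proof (rule uniform_limitI)
  fix d :: real assume d: "0 < d"
  have "((\<lambda>h. K * h) \<longlongrightarrow> K * 0) (at_right 0)" by (intro tendsto_intros)
  then have "eventually (\<lambda>h. K * h < d) (at_right 0)" using d by (simp add: order_tendstoD)
  moreover have "eventually (\<lambda>h. 0 < h \<and> h < e) (at_right (0::real))"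
    using assms(1) by (auto simp: eventually_at_right_field)
  ultimately show "eventually (\<lambda>h. \<forall>z\<in>S. dist (F h z) (G z) < d) (at_right 0)"
    by eventually_elim (use b in \<open>force simp: dist_norm\<close>)
qed

lemma cint_pos_simple:
  fixes m :: nat and x :: "nat \<Rightarrow> real"
  assumes f: "matrix_monotone_class f" and rc: "0 < r" "r < c"
    and x: "\<And>i. i < m \<Longrightarrow> complex_of_real (x i) \<in> disc c r"
    and u: "u = (\<lambda>z. \<Sum>i<m. a i / (z - complex_of_real (x i)))"
  shows "0 \<le> Re (cint c r (\<lambda>z. f z * (u z * reflect u z)))"
proof -
  let ?B = "disc c r" and ?S = "circ c r"
  have fh: "f holomorphic_on slitD" using f by (simp add: matrix_monotone_class_def)
  have fc: "continuous_on ?S f"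
    by (rule holomorphic_continuous_sphere[OF fh sphere_subset_slitD[OF rc(2)]])
  have xpos: "0 < x i" if "i < m" for i
    using Re_pos_cball[OF rc(2), of "complex_of_real (x i)"] x[OF that] by auto
  obtain d where d: "0 < d" "\<And>i z. i < m \<Longrightarrow> z \<notin> ?B \<Longrightarrow> d \<le> cmod (z - complex_of_real (x i))"
  proof -
    define d where "d = Min (insert r ((\<lambda>i. r - cmod (complex_of_real c - complex_of_real (x i))) ` {..<m}))"
    have "0 < d" unfolding d_def
      by (subst Min_gr_iff) (use rc x in \<open>auto simp: dist_norm simp del: of_real_diff\<close>)
    moreover have "d \<le> cmod (z - complex_of_real (x i))" if "i < m" "z \<notin> ?B" for i z
    proof -
      have "d \<le> r - cmod (complex_of_real c - complex_of_real (x i))" unfolding d_def using that by (intro Min_le) auto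
      also have "r \<le> cmod (complex_of_real c - z)" using that by (simp add: dist_norm)
      also have "\<dots> \<le> cmod (complex_of_real c - complex_of_real (x i)) + cmod (z - complex_of_real (x i))"
        using norm_triangle_ineq4[of "complex_of_real c - complex_of_real (x i)" "z - complex_of_real (x i)"] by simp
      finally show ?thesis by simp
    qed
    ultimately show thesis using that by blast
  qed
  have ne: "z \<noteq> complex_of_real (x i)" if "i < m" "z \<notin> ?B" for i z
    using x that by blast
  have S: "z \<notin> ?B" if "z \<in> ?S" for z using that by auto
  define h where "h = (\<lambda>z. \<Sum>i<m. 1 / (z - complex_of_real (x i)))"
  have hb: "cmod (h z) \<le> m / d" if "z \<notin> ?B" for z
  proof -
    have "cmod (h z) \<le> (\<Sum>i<m. 1 / d)" unfolding h_def
    proof (rule sum_norm_le)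
      fix i assume "i \<in> {..<m}"
      then have "d \<le> cmod (z - complex_of_real (x i))" using d(2) that by simp
      then show "cmod (1 / (z - complex_of_real (x i))) \<le> 1 / d"
        using d(1) by (simp add: norm_divide frac_le)
    qed
    then show ?thesis by simp
  qed
  define e where "e = d / (2 * m + 1)"
  have e: "0 < e" using d by (simp add: e_def)
  have small: "cmod (\<eta> * h z) \<le> 1/2" if "0 \<le> \<eta>" "\<eta> < e" "z \<notin> ?B" for \<eta> z
  proof -
    have "cmod (\<eta> * h z) \<le> e * (m / d)" unfolding norm_mult
      by (rule mult_mono) (use that hb[OF that(3)] in auto)
    also have "\<dots> \<le> 1/2" using d by (simp add: e_def field_simps)
    finally show ?thesis .
  qed
  have den: "1 / 2 \<le> cmod (1 - \<eta> * h z)" if "0 \<le> \<eta>" "\<eta> < e" "z \<notin> ?B" for \<eta> z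
    using small[OF that] norm_triangle_ineq2[of 1 "\<eta> * h z"] by simp
  have hc: "continuous_on ?S h" unfolding h_def
    by (intro continuous_intros) (use ne S in auto)
  have uc: "continuous_on ?S u" unfolding u
    by (intro continuous_intros) (use ne S in auto)
  have ruc: "continuous_on ?S (reflect u)" by (rule continuous_on_reflect[OF uc])
  define y where "y = Matrix.vec m a"
  have y: "y \<in> carrier_vec m" by (simp add: y_def)
  define F where "F = (\<lambda>\<eta> z. f z * (u z * reflect u z) / (1 - complex_of_real \<eta> * h z))"
  have ru: "reflect u z = (\<Sum>i<m. cnj (a i) / (z - complex_of_real (x i)))" for z
    unfolding reflect_def u by simp
  have Fpos: "0 \<le> Re (cint c r (F \<eta>))" and Fc: "continuous_on ?S (F \<eta>)" if \<eta>: "0 < \<eta>" "\<eta> < e" for \<eta>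
  proof -
    have ev: "{e. eigenvalue (diag_ones m x \<eta>') e} \<subseteq> ?B" if "0 \<le> \<eta>'" "\<eta>' < e" for \<eta>'
    proof (rule ccontr)
      assume "\<not> ?thesis"
      then obtain z where z: "eigenvalue (diag_ones m x \<eta>') z" "z \<notin> ?B" by blast
      have "1 - \<eta>' * h z \<noteq> 0" using den[OF that z(2)] by auto
      moreover have "z \<noteq> complex_of_real (x i)" if "i < m" for i using ne[OF that z(2)] .
      ultimately have "\<not> eigenvalue (diag_ones m x \<eta>') z"
        by (intro diag_ones_resolvent(2)[where h = "h z"]) (simp_all add: h_def)
      then show False using z(1) by contradiction
    qed
    show Fc: "continuous_on ?S (F \<eta>)" unfolding F_def
    proof (intro continuous_intros fc uc ruc hc ballI notI)
      fix z assume "z \<in> ?S" "1 - complex_of_real \<eta> * h z = 0"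
      then show False using den[OF less_imp_le[OF \<eta>(1)] \<eta>(2) S] by fastforce
    qed
    have q: "qform (mfun f (diag_ones m x \<eta>')) y = cint c r (\<lambda>z. f z * (\<Sum>i<m. \<Sum>j<m. (cnj (y $ i) * y $ j) * resolvent (diag_ones m x \<eta>') z $$ (i,j)))"
      if "0 \<le> \<eta>'" "\<eta>' < e" for \<eta>'
    proof -
      have "mfun f (diag_ones m x \<eta>') \<in> carrier_mat m m" by (simp add: mfun_def diag_ones_def Let_def)
      from qform_sum[OF this y] show ?thesis
        using mfun_functional[OF diag_ones_carrier fh rc ev[OF that]] by simp
    qed
    have R: "(\<Sum>i<m. \<Sum>j<m. (cnj (y $ i) * y $ j) * resolvent (diag_ones m x \<eta>') z $$ (i,j))
       = (\<Sum>i<m. cnj (a i) * a i / (z - complex_of_real (x i))) + \<eta>' * (u z * reflect u z) / (1 - \<eta>' * h z)"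
      if "0 \<le> \<eta>'" "\<eta>' < e" "z \<in> ?S" for \<eta>' z
    proof -
      let ?y = "\<lambda>k. z - complex_of_real (x k)"
      have nz: "1 - \<eta>' * h z \<noteq> 0" using den[OF that(1,2) S[OF that(3)]] by auto
      have "resolvent (diag_ones m x \<eta>') z = mat m m (\<lambda>(i,j). (if i = j then 1 / ?y i else 0)
         + \<eta>' / ((1 - \<eta>' * h z) * ?y i * ?y j))"
        by (rule diag_ones_resolvent(1)[OF _ _ nz]) (use ne S[OF that(3)] in \<open>simp_all add: h_def\<close>)
      then have "(\<Sum>i<m. \<Sum>j<m. (cnj (y $ i) * y $ j) * resolvent (diag_ones m x \<eta>') z $$ (i,j))
        = (\<Sum>i<m. \<Sum>j<m. (if j = i then cnj (a i) * a i / ?y i else 0)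
           + \<eta>' / (1 - \<eta>' * h z) * ((cnj (a i) / ?y i) * (a j / ?y j)))"
        by (intro sum.cong refl) (simp add: y_def distrib_left mult_ac)
      also have "\<dots> = (\<Sum>i<m. cnj (a i) * a i / ?y i) + \<eta>' / (1 - \<eta>' * h z) * ((\<Sum>i<m. cnj (a i) / ?y i) * (\<Sum>j<m. a j / ?y j))"
        unfolding sum_product unfolding sum_distrib_left by (simp add: sum.distrib)
      finally show ?thesis unfolding ru by (simp add: u mult_ac)
    qed
    let ?D = "\<lambda>z. \<Sum>i<m. cnj (a i) * a i / (z - complex_of_real (x i))"
    have Dc: "continuous_on ?S (\<lambda>z. f z * ?D z)"
      using ne S by (intro continuous_intros fc) auto
    have q\<eta>: "qform (mfun f (diag_ones m x \<eta>)) y = cint c r (\<lambda>z. f z * ?D z) + \<eta> * cint c r (F \<eta>)"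
    proof -
      have "qform (mfun f (diag_ones m x \<eta>)) y = cint c r (\<lambda>z. f z * ?D z + \<eta> * F \<eta> z)"
        unfolding q[OF less_imp_le[OF \<eta>(1)] \<eta>(2)]
        by (rule cint_cong) (use R \<eta> rc in \<open>auto simp: F_def algebra_simps\<close>)
      then show ?thesis using Dc Fc rc
        by (simp add: cint_add cint_cmult continuous_on_mult_left)
    qed
    have q0: "qform (mfun f (diag_ones m x 0)) y = cint c r (\<lambda>z. f z * ?D z)"
      unfolding q[OF order_refl e]
      by (rule cint_cong) (use R[OF order_refl e] rc in auto)
    have "Re (qform (mfun f (diag_ones m x 0)) y) \<le> Re (qform (mfun f (diag_ones m x \<eta>)) y)"
      by (rule diag_ones_mono[OF f xpos less_imp_le[OF \<eta>(1)] y])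
    then have "0 \<le> Re (\<eta> * cint c r (F \<eta>))" unfolding q\<eta> q0 by simp
    then show "0 \<le> Re (cint c r (F \<eta>))" using \<eta> by (simp add: zero_le_mult_iff)
  qed
  define w where "w = (\<lambda>z. f z * (u z * reflect u z))"
  have "continuous_on ?S w" unfolding w_def by (intro continuous_intros fc uc ruc)
  then obtain K where K: "0 < K" "\<And>z. z \<in> ?S \<Longrightarrow> cmod (w z) \<le> K"
    using compact_continuous_image[of ?S w] compact_imp_bounded[of "w ` ?S"]
    by (auto simp: bounded_pos)
  have "uniform_limit ?S F w (at_right 0)"
  proof (rule uniform_limit_linear_bound[OF e])
    fix \<eta> z assume \<eta>: "0 < \<eta>" "\<eta> < e" and z: "z \<in> ?S"
    have nz: "1 - \<eta> * h z \<noteq> 0" using den[of \<eta> z] S[OF z] \<eta> by auto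
    have "F \<eta> z - w z = w z * (\<eta> * h z) / (1 - \<eta> * h z)"
      unfolding F_def w_def[symmetric] w_def[THEN fun_cong, symmetric] using nz by (simp add: field_simps)
    also have "cmod \<dots> = cmod (w z) * (\<eta> * cmod (h z)) / cmod (1 - \<eta> * h z)"
      using \<eta> by (simp add: norm_divide norm_mult)
    also have "\<dots> \<le> (K * (\<eta> * (m / d))) / (1/2)"
      using K(1) K(2)[OF z] hb[OF S[OF z]] den[of \<eta> z] S[OF z] \<eta> d(1)
      by (intro frac_le mult_mono mult_nonneg_nonneg) auto
    finally show "cmod (F \<eta> z - w z) \<le> (2 * K * m / d) * \<eta>" by (simp add: algebra_simps)
  qed
  moreover have near: "eventually (\<lambda>\<eta>. 0 < \<eta> \<and> \<eta> < e) (at_right (0::real))"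
    using e by (auto simp: eventually_at_right_field)
  ultimately have "((\<lambda>\<eta>. cint c r (F \<eta>)) \<longlongrightarrow> cint c r w) (at_right 0)"
    using rc by (intro cint_tendsto) (auto elim!: eventually_mono intro: Fc)
  then have "((\<lambda>\<eta>. Re (cint c r (F \<eta>))) \<longlongrightarrow> Re (cint c r w)) (at_right 0)" by (rule tendsto_Re)
  then have "0 \<le> Re (cint c r w)"
    by (rule tendsto_lowerbound) (use near Fpos in \<open>auto elim!: eventually_mono\<close>)
  then show ?thesis by (simp add: w_def)
qed

inductive polar :: "real \<Rightarrow> real \<Rightarrow> (complex \<Rightarrow> complex) \<Rightarrow> bool" for c r :: real where
  sum: "(\<And>i::nat. i < m \<Longrightarrow> complex_of_real (x i) \<in> disc c r) \<Longrightarrow>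
    polar c r (\<lambda>z. \<Sum>i<m. a i / (z - complex_of_real (x i)))"
| limit: "(\<And>k::nat. polar c r (u k)) \<Longrightarrow> uniform_limit (circ c r) u l sequentially \<Longrightarrow> polar c r l"

lemma polar_continuous:
  assumes "polar c r u" shows "continuous_on (circ c r) u"
  using assms
proof induction
  case (sum m x a)
  then show ?case by (intro continuous_intros) force
next
  case (limit u l)
  show ?case by (rule uniform_limit_theorem[OF _ limit(2)]) (use limit(3) in auto)
qed

lemma polar_bounded:
  assumes "polar c r u"
  shows "bounded (u ` circ c r)" "bounded (reflect u ` circ c r)"
  using compact_continuous_image[OF polar_continuous[OF assms]]
    compact_continuous_image[OF continuous_on_reflect[OF polar_continuous[OF assms]]]
  by (auto intro: compact_imp_bounded)

lemma uniform_limit_reflect: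
  assumes "uniform_limit (circ c r) u l F"
  shows "uniform_limit (circ c r) (\<lambda>k. reflect (u k)) (reflect l) F"
proof (rule uniform_limitI)
  fix e :: real assume "0 < e"
  from uniform_limitD[OF assms this]
  show "\<forall>\<^sub>F k in F. \<forall>z\<in>circ c r. dist (reflect (u k) z) (reflect l z) < e"
  proof eventually_elim
    case (elim k)
    show ?case
    proof
      fix z assume "z \<in> circ c r"
      then have "cnj z \<in> circ c r" using cnj_mem_sphere by blast
      then have "dist (u k (cnj z)) (l (cnj z)) < e" using elim by blast
      then show "dist (reflect (u k) z) (reflect l z) < e"
        unfolding reflect_def dist_norm by (metis complex_cnj_diff complex_mod_cnj)
    qed
  qed
qed

lemma cint_pos:
  assumes f: "matrix_monotone_class f" and rc: "0 < r" "r < c" and "polar c r u"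
  shows "0 \<le> Re (cint c r (\<lambda>z. f z * (u z * reflect u z)))"
  using assms(4)
proof induction
  case (sum m x a)
  then show ?case by (intro cint_pos_simple[OF f rc, of m x _ a]) auto
next
  case (limit u l)
  let ?S = "circ c r"
  have "f holomorphic_on slitD" using f by (simp add: matrix_monotone_class_def)
  then have fc: "continuous_on ?S f"
    by (rule holomorphic_continuous_sphere[OF _ sphere_subset_slitD[OF rc(2)]])
  have l: "polar c r l" using polar.limit[OF limit(1,2)] .
  have fb: "bounded (f ` ?S)" by (intro compact_imp_bounded compact_continuous_image fc compact_sphere)
  have ub: "bounded ((\<lambda>z. l z * reflect l z) ` ?S)"
    by (intro compact_imp_bounded compact_continuous_image continuous_on_mult polar_continuous[OF l]
        continuous_on_reflect) auto
  have ul: "uniform_limit ?S (\<lambda>k z. f z * (u k z * reflect (u k) z)) (\<lambda>z. f z * (l z * reflect l z)) sequentially"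
    by (rule uniform_lim_mult[OF uniform_limit_const
         uniform_lim_mult[OF limit(2) uniform_limit_reflect[OF limit(2)] polar_bounded(1,2)[OF l]] fb ub])
  have "(\<lambda>k. cint c r (\<lambda>z. f z * (u k z * reflect (u k) z))) \<longlonglongrightarrow> cint c r (\<lambda>z. f z * (l z * reflect l z))"
    by (rule cint_tendsto[OF _ ul])
       (use rc limit(1) fc polar_continuous continuous_on_reflect in \<open>auto intro!: always_eventually continuous_on_mult\<close>)
  then have "(\<lambda>k. Re (cint c r (\<lambda>z. f z * (u k z * reflect (u k) z)))) \<longlonglongrightarrow> Re (cint c r (\<lambda>z. f z * (l z * reflect l z)))"
    by (rule tendsto_Re)
  then show ?case by (rule tendsto_lowerbound) (use limit(3) in auto)
qed

section \<open>Uniform limits of sums of simple poles\<close>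

lemma bounded_image_sphere:
  assumes "continuous_on (sphere (c :: complex) r) g" shows "bounded ((g :: complex \<Rightarrow> complex) ` sphere c r)"
  by (rule compact_imp_bounded[OF compact_continuous_image[OF assms compact_sphere]])

lemma polar_cong:
  assumes "polar c r u" "\<And>z. z \<in> circ c r \<Longrightarrow> v z = u z"
  shows "polar c r v"
proof (rule polar.limit[of c r "\<lambda>_. u"])
  show "uniform_limit (circ c r) (\<lambda>_. u) v sequentially"
    by (rule uniform_limitI) (use assms(2) in auto)
qed (fact assms(1))

lemma polar_cmult:
  assumes "polar c r u" shows "polar c r (\<lambda>z. b * u z)"
  using assms
proof induction
  case (sum m x a)
  have "polar c r (\<lambda>z. \<Sum>i<m. (b * a i) / (z - complex_of_real (x i)))"
    by (rule polar.sum) (rule sum)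
  then show ?case by (simp add: sum_distrib_left)
next
  case (limit u l)
  have "uniform_limit (circ c r) (\<lambda>k z. b * u k z) (\<lambda>z. b * l z) sequentially"
    by (rule uniform_lim_mult[OF uniform_limit_const limit(2) _ polar_bounded(1)[OF polar.limit[OF limit(1,2)]]])
       (rule bounded_image_sphere[OF continuous_on_const])
  then show ?case by (rule polar.limit[OF limit(3)])
qed

lemma polar_zero: "polar c r (\<lambda>z. 0)"
  using polar.sum[of 0 "\<lambda>_. 0" c r "\<lambda>_. 0"] by simp

lemma polar_add_sum:
  fixes m :: nat
  assumes "polar c r v" and x: "\<And>i. i < m \<Longrightarrow> complex_of_real (x i) \<in> disc c r"
  shows "polar c r (\<lambda>z. (\<Sum>i<m. a i / (z - complex_of_real (x i))) + v z)"
  using assms(1)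
proof induction
  case (sum k y b)
  define xx where "xx = (\<lambda>i. if i < m then x i else y (i - m))"
  define aa where "aa = (\<lambda>i. if i < m then a i else b (i - m))"
  have "(\<Sum>i<m + k. g i) = (\<Sum>i<m. g i) + (\<Sum>i<k. g (m + i))" for g :: "nat \<Rightarrow> complex"
    by (induction k) (auto simp: add.assoc)
  then have "(\<Sum>i<m+k. aa i / (z - complex_of_real (xx i)))
    = (\<Sum>i<m. a i / (z - complex_of_real (x i))) + (\<Sum>i<k. b i / (z - complex_of_real (y i)))" for z
    by (simp add: aa_def xx_def)
  moreover have "polar c r (\<lambda>z. \<Sum>i<m+k. aa i / (z - complex_of_real (xx i)))"
    by (rule polar.sum) (use x sum in \<open>auto simp: xx_def simp del: mem_ball\<close>)
  ultimately show ?case by simp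
next
  case (limit u l)
  show ?case
    by (rule polar.limit[OF limit(3) uniform_limit_add[OF uniform_limit_const limit(2)]])
qed

lemma polar_add:
  assumes "polar c r u" "polar c r v" shows "polar c r (\<lambda>z. u z + v z)"
  using assms(1)
proof induction
  case (sum m x a)
  then show ?case by (rule polar_add_sum[OF assms(2)])
next
  case (limit u l)
  show ?case
    by (rule polar.limit[OF limit(3) uniform_limit_add[OF limit(2) uniform_limit_const]])
qed

lemma polar_sum:
  assumes "finite I" "\<And>i. i \<in> I \<Longrightarrow> polar c r (u i)"
  shows "polar c r (\<lambda>z. \<Sum>i\<in>I. u i z)"
  using assms by (induction I rule: finite_induct) (auto intro: polar_zero polar_add)

lemma polar_simple:
  assumes "complex_of_real x \<in> disc c r"
  shows "polar c r (\<lambda>z. 1 / (z - complex_of_real x))"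
  using polar.sum[of "Suc 0" "\<lambda>_. x" c r "\<lambda>_. 1"] assms by simp

lemma polar_pair_distinct:
  assumes "complex_of_real x \<in> disc c r" "complex_of_real y \<in> disc c r" "x \<noteq> y"
  shows "polar c r (\<lambda>z. 1 / ((z - complex_of_real x) * (z - complex_of_real y)))"
proof (rule polar_cong)
  let ?d = "1 / (complex_of_real x - complex_of_real y)"
  show "polar c r (\<lambda>z. ?d * (1 / (z - complex_of_real x)) + (- ?d) * (1 / (z - complex_of_real y)))"
    by (intro polar_add polar_cmult polar_simple assms)
  fix z assume "z \<in> circ c r"
  then have "z \<noteq> complex_of_real x" "z \<noteq> complex_of_real y" using assms by auto
  moreover have "complex_of_real x - complex_of_real y \<noteq> 0" using assms(3) by simp
  ultimately show "1 / ((z - complex_of_real x) * (z - complex_of_real y))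
     = ?d * (1 / (z - complex_of_real x)) + (- ?d) * (1 / (z - complex_of_real y))"
    by (simp add: divide_simps)
qed

lemma polar_pair:
  assumes "complex_of_real x \<in> disc c r" "complex_of_real y \<in> disc c r"
  shows "polar c r (\<lambda>z. 1 / ((z - complex_of_real x) * (z - complex_of_real y)))"
proof (cases "x = y")
  case False then show ?thesis using polar_pair_distinct assms by blast
next
  case True
  let ?S = "circ c r"
  define d where "d = r - dist c x"
  have d: "0 < d" using assms(1) by (simp add: d_def)
  define t where "t = (\<lambda>k::nat. x + (d / 2) / real (Suc k))"
  have tx: "t k \<noteq> x" "\<bar>t k - x\<bar> \<le> d / 2" for k
    using d by (auto simp: t_def field_simps)
  have tb: "complex_of_real (t k) \<in> disc c r" for k
    using tx(2)[of k] d unfolding d_def by (simp add: dist_real_def abs_if split: if_splits)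
  have sep: "d / 2 \<le> cmod (z - complex_of_real y)" if "\<bar>y - x\<bar> \<le> d / 2" "z \<in> ?S" for y z
  proof -
    have "r = cmod (complex_of_real c - z)" using that by (simp add: dist_norm)
    also have "\<dots> \<le> cmod (complex_of_real c - complex_of_real y) + cmod (z - complex_of_real y)"
      using norm_triangle_ineq4[of "complex_of_real c - complex_of_real y" "z - complex_of_real y"] by simp
    also have "cmod (complex_of_real c - complex_of_real y) = \<bar>c - y\<bar>"
      by (metis norm_of_real of_real_diff)
    finally have "r \<le> \<bar>c - y\<bar> + cmod (z - complex_of_real y)" .
    moreover have "\<bar>c - y\<bar> \<le> \<bar>c - x\<bar> + \<bar>y - x\<bar>" by simp
    moreover have "d = r - \<bar>c - x\<bar>" by (simp add: d_def dist_real_def)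
    ultimately show ?thesis using that(1) by argo
  qed
  have tl: "t \<longlonglongrightarrow> x"
  proof -
    have "(\<lambda>k. x + (d/2) * inverse (real (Suc k))) \<longlonglongrightarrow> x + (d/2) * 0"
      by (rule tendsto_add[OF tendsto_const tendsto_mult[OF tendsto_const LIMSEQ_inverse_real_of_nat]])
    then show ?thesis by (simp only: t_def divide_inverse[of "d / 2"] mult_zero_right add_0_right)
  qed
  have "polar c r (\<lambda>z. 1 / ((z - complex_of_real x) * (z - complex_of_real x)))"
  proof (rule polar.limit)
    show "polar c r (\<lambda>z. 1 / ((z - complex_of_real x) * (z - complex_of_real (t k))))" for k
      by (rule polar_pair_distinct) (use assms(1) tb[of k] tx(1)[of k] in \<open>auto simp del: mem_ball\<close>)
    show "uniform_limit ?S (\<lambda>k z. 1 / ((z - complex_of_real x) * (z - complex_of_real (t k))))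
      (\<lambda>z. 1 / ((z - complex_of_real x) * (z - complex_of_real x))) sequentially"
    proof (rule uniform_limitI)
      fix e :: real assume e: "0 < e"
      have "0 < e * (d/2)^3" using e d by simp
      from tendstoD[OF tl this]
      show "\<forall>\<^sub>F k in sequentially. \<forall>z\<in>?S. dist (1 / ((z - complex_of_real x) * (z - complex_of_real (t k))))
          (1 / ((z - complex_of_real x) * (z - complex_of_real x))) < e"
      proof eventually_elim
        case (elim k)
        show ?case
        proof
          fix z assume z: "z \<in> ?S"
          define p q where "p = z - complex_of_real x" and "q = z - complex_of_real (t k)"
          have pq: "d / 2 \<le> cmod p" "d / 2 \<le> cmod q"
            using sep[OF _ z, of x] sep[OF tx(2) z] d by (auto simp: p_def q_def)
          then have nz: "p \<noteq> 0" "q \<noteq> 0" using d by auto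
          have "1 / (p * q) - 1 / (p * p) = (p - q) / (p * p * q)" using nz by (simp add: field_simps)
          also have "p - q = complex_of_real (t k - x)" by (simp add: p_def q_def)
          finally have "cmod (1 / (p * q) - 1 / (p * p)) = \<bar>t k - x\<bar> / (cmod p * cmod p * cmod q)"
            by (simp add: norm_divide norm_mult del: of_real_diff)
          also have "\<dots> \<le> \<bar>t k - x\<bar> / ((d/2) * (d/2) * (d/2))"
            using pq d by (intro divide_left_mono mult_mono mult_pos_pos) (auto intro: less_le_trans[of 0 "d/2"])
          also have "\<dots> < e" using elim d by (simp add: dist_real_def field_simps power3_eq_cube)
          finally show "dist (1 / ((z - complex_of_real x) * (z - complex_of_real (t k))))
              (1 / ((z - complex_of_real x) * (z - complex_of_real x))) < e"
            by (simp add: dist_norm p_def q_def)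
        qed
      qed
    qed
  qed
  then show ?thesis using True by simp
qed

lemma bounded_inverse_sphere:
  assumes "w \<in> disc c r"
  shows "bounded ((\<lambda>z. 1 / (z - w)) ` circ c r)"
  by (intro bounded_image_sphere continuous_intros) (use assms in auto)

lemma polar_div_real:
  assumes "polar c r u" "complex_of_real y \<in> disc c r"
  shows "polar c r (\<lambda>z. u z * (1 / (z - complex_of_real y)))"
  using assms(1)
proof induction
  case (sum m x a)
  have "polar c r (\<lambda>z. \<Sum>i<m. a i * (1 / ((z - complex_of_real (x i)) * (z - complex_of_real y))))"
    by (intro polar_sum polar_cmult polar_pair assms) (use sum in \<open>auto simp del: mem_ball\<close>)
  then show ?case by (simp add: sum_divide_distrib)
next
  case (limit u l)
  show ?case
    by (rule polar.limit[OF limit(3) uniform_lim_mult[OF limit(2) uniform_limit_const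
         polar_bounded(1)[OF polar.limit[OF limit(1,2)]] bounded_inverse_sphere[OF assms(2)]]])
qed

lemma polar_div:
  assumes u: "polar c r u" and w: "w \<in> disc c r"
  shows "polar c r (\<lambda>z. u z / (z - w))"
proof -
  let ?S = "circ c r" and ?c = "complex_of_real c"
  have r: "0 < r" using w by (auto intro: le_less_trans[OF zero_le_dist])
  have pw: "polar c r (\<lambda>z. u z * (1 / (z - ?c)) ^ k)" for k
  proof (induction k)
    case (Suc k)
    have "polar c r (\<lambda>z. (u z * (1 / (z - ?c)) ^ k) * (1 / (z - complex_of_real c)))"
      by (rule polar_div_real[OF Suc]) (use r in simp)
    then show ?case by (simp add: mult_ac)
  qed (use u in simp)
  define q where "q = cmod (w - ?c) / r"
  have q: "0 \<le> q" "q < 1" using w r by (auto simp: q_def dist_norm norm_minus_commute)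
  obtain B where B: "0 < B" "\<And>z. z \<in> ?S \<Longrightarrow> cmod (u z / (z - w)) \<le> B"
  proof -
    have "continuous_on ?S (\<lambda>z. u z / (z - w))"
      by (intro continuous_intros polar_continuous[OF u]) (use w in auto)
    then have "bounded ((\<lambda>z. u z / (z - w)) ` ?S)" by (rule bounded_image_sphere)
    then show thesis using that by (auto simp: bounded_pos)
  qed
  show ?thesis
  proof (rule polar.limit)
    show "polar c r (\<lambda>z. \<Sum>k<K. (w - ?c) ^ k * (u z * (1 / (z - ?c)) ^ Suc k))" for K
      by (intro polar_sum polar_cmult pw) auto
    show "uniform_limit ?S (\<lambda>K z. \<Sum>k<K. (w - ?c) ^ k * (u z * (1 / (z - ?c)) ^ Suc k)) (\<lambda>z. u z / (z - w)) sequentially"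
    proof (rule uniform_limitI)
      fix e :: real assume e: "0 < e"
      have "(\<lambda>K. B * q ^ K) \<longlonglongrightarrow> B * 0" by (intro tendsto_intros LIMSEQ_power_zero) (use q in auto)
      then have "\<forall>\<^sub>F K in sequentially. B * q ^ K < e" using e by (simp add: order_tendstoD)
      then show "\<forall>\<^sub>F K in sequentially. \<forall>z\<in>?S. dist (\<Sum>k<K. (w - ?c) ^ k * (u z * (1 / (z - ?c)) ^ Suc k)) (u z / (z - w)) < e"
      proof eventually_elim
        case (elim K)
        show ?case
        proof
          fix z assume z: "z \<in> ?S"
          define p where "p = z - ?c"
          define v where "v = w - ?c"
          have p: "cmod p = r" using z by (simp add: p_def dist_norm norm_minus_commute)
          have p0: "p \<noteq> 0" using p r by auto
          have pv: "p - v = z - w" by (simp add: p_def v_def)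
          have zw: "z - w \<noteq> 0" using z w by auto
          define s where "s = v / p"
          have s1: "s \<noteq> 1" using pv zw p0 by (auto simp: s_def)
          have "(\<Sum>k<K. v ^ k * (u z * (1 / p) ^ Suc k)) = u z / p * (\<Sum>k<K. s ^ k)"
            by (simp add: sum_distrib_left s_def power_divide field_simps)
          also have "\<dots> = u z / p * ((1 - s ^ K) / (1 - s))"
            using s1 by (subst sum_gp_strict) auto
          also have "\<dots> = u z / (p * (1 - s)) - u z / (p * (1 - s)) * s ^ K"
            by (simp add: field_simps diff_divide_distrib)
          also have "p * (1 - s) = z - w" using p0 pv by (simp add: s_def algebra_simps)
          finally have "dist (\<Sum>k<K. v ^ k * (u z * (1 / p) ^ Suc k)) (u z / (z - w)) = cmod (u z / (z - w)) * cmod s ^ K"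
            by (simp add: dist_norm norm_mult norm_divide norm_power)
          also have "cmod s = q" using p by (simp add: s_def q_def v_def norm_divide)
          also have "cmod (u z / (z - w)) * q ^ K \<le> B * q ^ K"
            using B(2)[OF z] q by (intro mult_right_mono) auto
          also have "\<dots> < e" by (rule elim)
          finally show "dist (\<Sum>k<K. (w - ?c) ^ k * (u z * (1 / (z - ?c)) ^ Suc k)) (u z / (z - w)) < e"
            by (simp add: p_def v_def)
        qed
      qed
    qed
  qed
qed

lemma polar_inverse:
  assumes w: "w \<in> disc c r"
  shows "polar c r (\<lambda>z. 1 / (z - w))"
proof (rule polar_cong)
  have r: "0 < r" using w by (auto intro: le_less_trans[OF zero_le_dist])
  have c: "complex_of_real c \<in> disc c r" using r by simp
  show "polar c r (\<lambda>z. 1 / (z - complex_of_real c) + (w - complex_of_real c) * (1 / (z - complex_of_real c) / (z - w)))"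
    by (intro polar_add polar_cmult polar_div polar_simple w c)
  fix z assume z: "z \<in> circ c r"
  then have "z - w \<noteq> 0" "z - complex_of_real c \<noteq> 0" using w r by auto
  then show "1 / (z - w) = 1 / (z - complex_of_real c) + (w - complex_of_real c) * (1 / (z - complex_of_real c) / (z - w))"
    by (simp add: divide_simps)
qed

lemma polar_inverse_prod:
  assumes "ws \<noteq> []" "set ws \<subseteq> disc c r"
  shows "polar c r (\<lambda>z. 1 / poly (\<Prod>w\<leftarrow>ws. [:- w, 1:]) z)"
  using assms
proof (induction ws rule: list_nonempty_induct)
  case (single w)
  then show ?case using polar_inverse[of w c r] by (simp del: mem_ball)
next
  case (cons w ws)
  then have "polar c r (\<lambda>z. 1 / poly (\<Prod>w\<leftarrow>ws. [:- w, 1:]) z / (z - w))"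
    by (intro polar_div) (auto simp del: mem_ball)
  then show ?case by (rule polar_cong) (simp add: algebra_simps)
qed

lemma polar_rational:
  assumes "degree b < length ws" "set ws \<subseteq> disc c r"
  shows "polar c r (\<lambda>z. poly b z / poly (\<Prod>w\<leftarrow>ws. [:- w, 1:]) z)"
  using assms
proof (induction ws arbitrary: b)
  case (Cons w ws)
  let ?e = "\<Prod>w\<leftarrow>w # ws. [:- w, 1:]" and ?e' = "\<Prod>w\<leftarrow>ws. [:- w, 1:]"
  have w: "w \<in> disc c r" using Cons.prems by auto
  define b' where "b' = synthetic_div b w"
  have bz: "poly b z = poly b w + (z - w) * poly b' z" for z
  proof -
    have "poly b z = poly ([:- w, 1:] * synthetic_div b w + [:poly b w:]) z"
      by (simp only: synthetic_div_correct')
    then show ?thesis by (simp add: b'_def algebra_simps)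
  qed
  have inv: "polar c r (\<lambda>z. poly b w * (1 / poly ?e z))"
    by (intro polar_cmult polar_inverse_prod) (use Cons.prems in auto)
  have rest: "polar c r (\<lambda>z. poly b' z / poly ?e' z)"
  proof (cases "degree b = 0")
    case True
    then have "b' = 0" by (simp add: b'_def synthetic_div_eq_0_iff)
    then show ?thesis by (simp add: polar_zero)
  next
    case False
    then have "degree b' < length ws" using Cons.prems by (simp add: b'_def degree_synthetic_div)
    then show ?thesis using Cons by (auto simp del: mem_ball)
  qed
  show ?case
  proof (rule polar_cong[OF polar_add[OF inv rest]])
    fix z assume "z \<in> circ c r"
    then have "z - w \<noteq> 0" using w by auto
    moreover have "poly ?e z = (z - w) * poly ?e' z" by (simp add: algebra_simps)
    ultimately show "poly b z / poly ?e z = poly b w * (1 / poly ?e z) + poly b' z / poly ?e' z"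
      unfolding bz[of z] by (simp add: add_divide_distrib)
  qed
qed auto

section \<open>Linear growth and the kernel of \<open>- f(z)/z\<close>\<close>

lemma complex_derivative_real:
  fixes F :: "complex \<Rightarrow> complex" and x :: real
  assumes "(F has_field_derivative D) (at (complex_of_real x))"
  shows "((\<lambda>t. Re (F (complex_of_real t))) has_real_derivative Re D) (at x)"
proof -
  have "((\<lambda>t. F (complex_of_real t)) has_vector_derivative D) (at x)"
    by (rule has_vector_derivative_real_field[OF assms])
  from bounded_linear.has_vector_derivative[OF bounded_linear_Re this]
  show ?thesis by (simp add: has_real_derivative_iff_has_vector_derivative)
qed

context
  fixes f :: "complex \<Rightarrow> complex"
  assumes f: "matrix_monotone_class f"
begin

lemma mm_holomorphic: "f holomorphic_on slitD"
  using f by (simp add: matrix_monotone_class_def)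

lemma mm_real: "0 < x \<Longrightarrow> f (complex_of_real x) = complex_of_real (Re (f (complex_of_real x)))"
  using f by (auto simp: matrix_monotone_class_def complex_is_Real_iff complex_eq_iff)

lemma mm_pos: "0 < x \<Longrightarrow> 0 < Re (f (complex_of_real x))"
  using f by (simp add: matrix_monotone_class_def)

lemma mm_continuous: "r < c \<Longrightarrow> continuous_on (circ c r) f"
  by (rule holomorphic_continuous_sphere[OF mm_holomorphic sphere_subset_slitD])

lemma mm_reflect:
  assumes "0 < Re z" shows "reflect f z = f z"
proof -
  let ?H = "{z. 0 < Re z}"
  have op: "open ?H" by (rule open_halfspace_Re_gt)
  have cn: "connected ?H" by (intro convex_connected convex_halfspace_Re_gt)
  have fH: "f holomorphic_on ?H"
    by (rule holomorphic_on_subset[OF mm_holomorphic halfplane_subset_slitD])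
  have "cnj \<circ> f \<circ> cnj holomorphic_on ?H"
  proof (rule holomorphic_on_compose_cnj_cnj[OF _ op])
    have "cnj ` ?H \<subseteq> ?H" by auto
    then show "f holomorphic_on cnj ` ?H" using fH holomorphic_on_subset by blast
  qed
  then have rH: "reflect f holomorphic_on ?H" by (simp add: reflect_def[abs_def] o_def)
  have lim: "1 islimpt (complex_of_real ` {0<..})"
    unfolding islimpt_approachable
  proof (intro allI impI)
    fix e :: real assume e: "0 < e"
    have "dist (complex_of_real (1 + e / 2)) 1 = cmod (complex_of_real (e / 2))"
      unfolding dist_norm by simp
    also have "\<dots> = e / 2" using e by (simp only: norm_of_real)
    finally have "dist (complex_of_real (1 + e / 2)) 1 < e" using e by simp
    moreover have "complex_of_real (1 + e / 2) \<noteq> 1"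
      using e by (metis add_cancel_left_right half_gt_zero less_irrefl of_real_eq_1_iff)
    moreover have "1 + e / 2 \<in> {0<..}" using e by simp
    ultimately show "\<exists>w\<in>complex_of_real ` {0<..}. w \<noteq> 1 \<and> dist w 1 < e" by blast
  qed
  have "reflect f z - f z = 0"
  proof (rule analytic_continuation[OF holomorphic_on_diff[OF rH fH] op cn _ _ lim])
    show "complex_of_real ` {0<..} \<subseteq> ?H" by auto
    fix w assume "w \<in> complex_of_real ` {0<..}"
    then obtain x where "w = complex_of_real x" "0 < x" by auto
    then show "reflect f w - f w = 0" using mm_real[of x] by (metis complex_cnj_complex_of_real diff_self reflect_def)
  qed (use assms in auto)
  then show ?thesis by simp
qed

lemma loewner_two_points:
  fixes p q x y :: real
  assumes "0 < x" "0 < y" "x \<noteq> y"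
  shows "0 \<le> p\<^sup>2 * Re (deriv f x) + 2 * p * q * ((Re (f x) - Re (f y)) / (x - y)) + q\<^sup>2 * Re (deriv f y)"
proof -
  obtain c r where rc: "0 < r" "r < c" and sub: "{complex_of_real x, complex_of_real y} \<subseteq> disc c r"
    by (rule enclosing_disc[of "{complex_of_real x, complex_of_real y}"]) (use assms in auto)
  let ?B = "disc c r" and ?S = "circ c r"
  have x: "complex_of_real x \<in> ?B" and y: "complex_of_real y \<in> ?B" using sub by auto
  have hol: "f holomorphic_on cball (complex_of_real c) r"
    by (rule holomorphic_on_subset[OF mm_holomorphic cball_subset_slitD[OF rc(2)]])
  have fc: "continuous_on ?S f" by (rule mm_continuous[OF rc(2)])
  have ne: "z \<noteq> complex_of_real x" "z \<noteq> complex_of_real y" if "z \<in> ?S" for z using x y that by auto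
  let ?x = "complex_of_real x" and ?y = "complex_of_real y"
  define u where "u = (\<lambda>z. p * (1 / (z - ?x)) + q * (1 / (z - ?y)))"
  have "polar c r u" unfolding u_def by (intro polar_add polar_cmult polar_simple x y)
  from cint_pos[OF f rc this] have pos: "0 \<le> Re (cint c r (\<lambda>z. f z * (u z * reflect u z)))" .
  let ?k = "2 * p * q / (?x - ?y)"
  have xy: "?x - ?y \<noteq> 0" using assms(3) by simp
  have "cint c r (\<lambda>z. f z * (u z * reflect u z)) =
     cint c r (\<lambda>z. (complex_of_real (p\<^sup>2) * (f z / (z - ?x)\<^sup>2) + complex_of_real (q\<^sup>2) * (f z / (z - ?y)\<^sup>2))
       + (?k * (f z / (z - ?x)) + (- ?k) * (f z / (z - ?y))))"
  proof (rule cint_cong[OF _ rc(1)])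
    fix z assume z: "z \<in> ?S"
    have ru: "reflect u z = u z" by (simp add: reflect_def u_def)
    define A B e where "A = 1 / (z - ?x)" and "B = 1 / (z - ?y)" and "e = 1 / (?x - ?y)"
    have "z - ?x \<noteq> 0" "z - ?y \<noteq> 0" using ne[OF z] by auto
    then have AB: "A * B = e * (A - B)"
      unfolding A_def B_def e_def using xy by (simp add: divide_simps)
    have "f z * (u z * u z) = f z * (p\<^sup>2 * (A * A) + q\<^sup>2 * (B * B) + 2 * p * q * (A * B))"
      unfolding u_def A_def[symmetric] B_def[symmetric] by (simp add: power2_eq_square algebra_simps)
    also have "\<dots> = (p\<^sup>2 * (f z * (A * A)) + q\<^sup>2 * (f z * (B * B))) + (2 * p * q * e * (f z * A) + (- (2 * p * q * e)) * (f z * B))"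
      unfolding AB by (simp add: algebra_simps)
    finally show "f z * (u z * reflect u z) = (complex_of_real (p\<^sup>2) * (f z / (z - ?x)\<^sup>2) + complex_of_real (q\<^sup>2) * (f z / (z - ?y)\<^sup>2))
       + (?k * (f z / (z - ?x)) + (- ?k) * (f z / (z - ?y)))"
      unfolding ru by (simp add: A_def B_def e_def power2_eq_square)
  qed
  also have "\<dots> = (p\<^sup>2 * deriv f ?x + q\<^sup>2 * deriv f ?y) + (?k * f ?x + (- ?k) * f ?y)"
  proof -
    have c1: "continuous_on ?S (\<lambda>z. f z / (z - w)\<^sup>2)" "continuous_on ?S (\<lambda>z. f z / (z - w))"
      if "w \<in> ?B" for w
      using that by (auto intro!: continuous_intros fc)
    show ?thesis
      by (simp only: cint_add cint_cmult continuous_on_add continuous_on_mult_left c1 x y rc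
         cint_cauchy[OF hol] cint_cauchy_deriv[OF hol] of_real_power)
  qed
  also have "\<dots> = (p\<^sup>2 * deriv f ?x + q\<^sup>2 * deriv f ?y) + complex_of_real (2 * p * q * ((Re (f ?x) - Re (f ?y)) / (x - y)))"
    by (subst (1 2) mm_real) (use assms in \<open>simp_all add: diff_divide_distrib right_diff_distrib\<close>)
  finally have "Re (cint c r (\<lambda>z. f z * (u z * reflect u z))) = p\<^sup>2 * Re (deriv f x) + 2 * p * q * ((Re (f x) - Re (f y)) / (x - y)) + q\<^sup>2 * Re (deriv f y)"
    by (simp only: plus_complex.simps Re_complex_of_real) (simp flip: of_real_power)
  then show ?thesis using pos by simp
qed

lemma mm_real_derivative:
  "0 < x \<Longrightarrow> ((\<lambda>t. Re (f (complex_of_real t))) has_real_derivative Re (deriv f (complex_of_real x))) (at x)"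
  by (intro complex_derivative_real holomorphic_derivI[OF mm_holomorphic open_slitD]) simp

lemma mm_deriv_nonneg: "0 < x \<Longrightarrow> 0 \<le> Re (deriv f (complex_of_real x))"
  using loewner_two_points[of x "x + 1" 1 0] by simp

lemma mm_linear_growth:
  assumes "1 \<le> y"
  shows "Re (f (complex_of_real y)) \<le> 1 + Re (deriv f 1) * (y - 1)"
proof (rule ccontr)
  define k where "k = Re (deriv f 1)"
  define F where "F = (\<lambda>t. Re (f (complex_of_real t)) - 1)"
  define F' where "F' = (\<lambda>t. Re (deriv f (complex_of_real t)))"
  have f1: "f 1 = 1" using f by (simp add: matrix_monotone_class_def)
  assume "\<not> ?thesis"
  then have Fy: "k * (y - 1) < F y" by (simp add: F_def k_def)
  have k0: "0 \<le> k" using mm_deriv_nonneg[of 1] by (simp add: k_def)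
  have dF: "(F has_real_derivative F' t) (at t)" if "0 < t" for t
    using DERIV_diff[OF mm_real_derivative[OF that] DERIV_const[of 1]] unfolding F_def F'_def by simp
  have "F 1 = 0" by (simp add: F_def f1)
  then have y1: "1 < y" using Fy assms by (cases "y = 1") auto
  have q: "0 \<le> p\<^sup>2 * k + 2 * p * s * (F t / (t - 1)) + s\<^sup>2 * F' t" if "1 < t" for p s t
  proof -
    have "(1 - Re (f t)) / (1 - t) = F t / (t - 1)"
      using that by (simp add: F_def divide_simps) (simp add: algebra_simps)
    then show ?thesis using loewner_two_points[of 1 t p s] that by (simp add: f1 k_def F'_def)
  qed
  have kpos: "0 < k"
  proof (rule ccontr)
    assume "\<not> 0 < k" then have "k = 0" using k0 by simp
    define D where "D = F y / (y - 1)"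
    have D: "0 < D" using Fy y1 \<open>k = 0\<close> by (simp add: D_def)
    have "0 \<le> 2 * (- (F' y + 1) / (2 * D)) * 1 * D + F' y"
      using q[OF y1, of "- (F' y + 1) / (2 * D)" 1] \<open>k = 0\<close> by (simp add: D_def)
    also have "\<dots> = - 1" using D by (simp add: field_simps)
    finally show False by simp
  qed
  have ineq: "(F t)\<^sup>2 \<le> k * F' t * (t - 1)\<^sup>2" if "1 < t" for t
  proof -
    define D where "D = F t / (t - 1)"
    have "0 \<le> D\<^sup>2 * k + 2 * D * (- k) * D + (- k)\<^sup>2 * F' t" using q[OF that, of D "- k"] by (simp add: D_def)
    then have "0 \<le> k * (k * F' t - D\<^sup>2)" by (simp add: power2_eq_square algebra_simps)
    then have "D\<^sup>2 \<le> k * F' t" using kpos by (simp add: zero_le_mult_iff)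
    then have "D\<^sup>2 * (t - 1)\<^sup>2 \<le> k * F' t * (t - 1)\<^sup>2" by (intro mult_right_mono) auto
    moreover have "D * (t - 1) = F t" using that by (simp add: D_def)
    ultimately show ?thesis by (metis power_mult_distrib)
  qed
  have Fpos: "0 < F t" if "y \<le> t" for t
  proof -
    have "F y \<le> F t"
    proof (rule DERIV_nonneg_imp_nondecreasing[OF that])
      fix s assume "y \<le> s"
      then have "0 < s" using y1 by simp
      then show "\<exists>d. DERIV F s :> d \<and> 0 \<le> d"
        using dF[of s] mm_deriv_nonneg[of s] unfolding F'_def by blast
    qed
    moreover have "0 \<le> k * (y - 1)" using k0 y1 by simp
    ultimately show ?thesis using Fy by linarith
  qed
  define \<psi> where "\<psi> = (\<lambda>t. 1 / (k * (t - 1)) - 1 / F t)"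
  have mono: "\<psi> y \<le> \<psi> t" if "y \<le> t" for t
  proof (rule DERIV_nonneg_imp_nondecreasing[OF that])
    fix s assume s: "y \<le> s" "s \<le> t"
    have s1: "1 < s" using s y1 by simp
    have "(\<psi> has_real_derivative - (k / (k * (s - 1))\<^sup>2) + F' s / (F s)\<^sup>2) (at s)"
      unfolding \<psi>_def using dF[of s] Fpos[OF s(1)] s1 kpos
      by (auto intro!: derivative_eq_intros simp: power2_eq_square)
    moreover have "k / (k * (s - 1))\<^sup>2 \<le> F' s / (F s)\<^sup>2"
    proof -
      have "0 < (k * (s - 1))\<^sup>2" "0 < (F s)\<^sup>2" using kpos s1 Fpos[OF s(1)] by auto
      moreover have "k * (F s)\<^sup>2 \<le> F' s * (k * (s - 1))\<^sup>2"
        using mult_left_mono[OF ineq[OF s1] k0] by (simp add: power_mult_distrib power2_eq_square mult_ac)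
      ultimately show ?thesis by (simp add: divide_simps mult_ac)
    qed
    ultimately show "\<exists>d. DERIV \<psi> s :> d \<and> 0 \<le> d" by (intro exI conjI) auto
  qed
  have \<psi>y: "0 < \<psi> y"
  proof -
    have "0 < k * (y - 1)" using kpos y1 by simp
    then have "1 / F y < 1 / (k * (y - 1))" using Fy by (intro frac_less2) auto
    then show ?thesis by (simp add: \<psi>_def)
  qed
  define t where "t = y + 1 / (k * \<psi> y)"
  have t: "y \<le> t" using kpos \<psi>y by (simp add: t_def)
  have "1 / (k * \<psi> y) < t - 1" using y1 by (simp add: t_def)
  then have "1 < \<psi> y * (k * (t - 1))" using kpos \<psi>y by (simp add: field_simps)
  moreover have "0 < k * (t - 1)" using kpos t y1 by simp
  ultimately have "1 / (k * (t - 1)) < \<psi> y" by (simp add: divide_simps)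
  moreover have "\<psi> t < 1 / (k * (t - 1))" using Fpos[OF t] by (simp add: \<psi>_def)
  ultimately show False using mono[OF t] by simp
qed


lemma mm_growth_rational:
  assumes "degree b < degree e"
  shows "((\<lambda>s. Re (f (complex_of_real s)) * (cmod (poly b (complex_of_real s) / poly e (complex_of_real s)))\<^sup>2) \<longlongrightarrow> 0) at_top"
proof -
  define k where "k = Re (deriv f 1)"
  have k0: "0 \<le> k" using mm_deriv_nonneg[of 1] by (simp add: k_def)
  have at: "filterlim complex_of_real at_infinity at_top"
    by (rule filterlim_of_real_at_infinity)
  have e0: "e \<noteq> 0" using assms by auto
  have "degree ([:0, 1:] * b * b) < degree (e * e)"
  proof (cases "b = 0")
    case False
    then show ?thesis using assms e0 by (simp add: degree_mult_eq)
  qed (use assms e0 in \<open>simp add: degree_mult_eq\<close>)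
  from filterlim_compose[OF poly_divide_tendsto_0_at_infinity[OF this] at]
  have lim: "((\<lambda>s. (1 + k) * cmod (poly ([:0, 1:] * b * b) (complex_of_real s) / poly (e * e) (complex_of_real s))) \<longlongrightarrow> (1 + k) * 0) at_top"
    by (intro tendsto_mult tendsto_const tendsto_norm_zero)
  show ?thesis
  proof (rule tendsto_sandwich[OF _ _ tendsto_const lim[simplified mult_zero_right]])
    show "\<forall>\<^sub>F s in at_top. 0 \<le> Re (f (complex_of_real s)) * (cmod (poly b (complex_of_real s) / poly e (complex_of_real s)))\<^sup>2"
      using eventually_gt_at_top[of 0] by eventually_elim (simp add: mm_pos less_imp_le)
    show "\<forall>\<^sub>F s in at_top. Re (f (complex_of_real s)) * (cmod (poly b (complex_of_real s) / poly e (complex_of_real s)))\<^sup>2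
       \<le> (1 + k) * cmod (poly ([:0, 1:] * b * b) (complex_of_real s) / poly (e * e) (complex_of_real s))"
      using eventually_ge_at_top[of 1]
    proof eventually_elim
      case (elim s)
      have "Re (f (complex_of_real s)) \<le> 1 + k * (s - 1)" using mm_linear_growth[OF elim] by (simp add: k_def)
      also have "\<dots> \<le> (1 + k) * s" using elim k0 by (simp add: algebra_simps)
      finally have "Re (f (complex_of_real s)) * (cmod (poly b (complex_of_real s) / poly e (complex_of_real s)))\<^sup>2
         \<le> (1 + k) * s * (cmod (poly b (complex_of_real s) / poly e (complex_of_real s)))\<^sup>2"
        by (rule mult_right_mono) simp
      also have "\<dots> = (1 + k) * cmod (poly ([:0, 1:] * b * b) (complex_of_real s) / poly (e * e) (complex_of_real s))"
        using elim by (simp add: norm_divide norm_mult power2_eq_square)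
      finally show ?case .
    qed
  qed
qed

lemma cint_neg_inverse:
  assumes rc: "0 < r" "r < c" and ws: "set ws \<subseteq> disc c r" and deg: "degree b < length ws"
    and u: "u = (\<lambda>z. poly b z / poly (\<Prod>w\<leftarrow>ws. [:- w, 1:]) z)"
  shows "Re (cint c r (\<lambda>z. f z / z * (u z * reflect u z))) \<le> 0"
proof -
  let ?S = "circ c r" and ?B = "disc c r"
  define e where "e = (\<Prod>w\<leftarrow>ws. [:- w, 1:])"
  define pts where "pts = set ws \<union> cnj ` set ws"
  define h where "h = (\<lambda>z. f z * (u z * reflect u z))"
  have pz: "poly e z = 0 \<longleftrightarrow> z \<in> set ws" for z
    unfolding e_def by (induction ws) (auto simp: poly_prod_list)
  have fin: "finite pts" by (simp add: pts_def)
  have ptsB: "pts \<subseteq> ?B" using ws by (auto simp: pts_def simp del: mem_ball)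
  have hol_u: "u holomorphic_on - pts"
    unfolding u e_def[symmetric] using pz by (auto intro!: holomorphic_intros simp: pts_def)
  have ru: "reflect u = (\<lambda>z. poly (map_poly cnj b) z / poly (map_poly cnj e) z)"
    by (auto simp: reflect_def u e_def[symmetric])
  have hol_ru: "reflect u holomorphic_on - pts"
    unfolding ru
  proof (rule holomorphic_on_divide[OF poly_holomorphic_on[OF holomorphic_on_ident] poly_holomorphic_on[OF holomorphic_on_ident]])
    fix z assume "z \<in> - pts"
    then have "cnj z \<notin> set ws" unfolding pts_def by (metis ComplD UnI2 complex_cnj_cnj image_eqI)
    then show "poly (map_poly cnj e) z \<noteq> 0" using pz by simp
  qed
  have hol_h: "h holomorphic_on slitD - pts"
    unfolding h_def by (intro holomorphic_intros holomorphic_on_subset[OF mm_holomorphic]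
        holomorphic_on_subset[OF hol_u] holomorphic_on_subset[OF hol_ru]) auto
  have deg_e: "degree e = length ws"
    unfolding e_def by (simp add: degree_linear_factors)
  define G where "G = (\<lambda>s. Re (h (complex_of_real s)) + Re (cint c r (\<lambda>z. h z / (z - complex_of_real s))))"
  have mono: "G \<epsilon> \<le> G s" if \<epsilon>: "0 < \<epsilon>" "\<epsilon> < c - r" and s: "c + r < s" for \<epsilon> s
  proof -
    have sp: "0 < s" using s rc by linarith
    have fin2: "finite (pts \<union> {complex_of_real \<epsilon>, complex_of_real s})" using fin by simp
    have "0 < Re z" if "z \<in> pts \<union> {complex_of_real \<epsilon>, complex_of_real s}" for z
      using that ptsB Re_pos_cball[OF rc(2)] ball_subset_cball \<epsilon> sp by auto
    then obtain c' r' where rc': "0 < r'" "r' < c'"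
        and sub: "pts \<union> {complex_of_real \<epsilon>, complex_of_real s} \<subseteq> ball (complex_of_real c') r'"
      using enclosing_disc[OF fin2] by metis
    let ?S' = "sphere (complex_of_real c') r'" and ?B' = "ball (complex_of_real c') r'"
    have hc: "continuous_on ?S' h"
      by (rule holomorphic_continuous_sphere[OF hol_h]) (use sphere_subset_slitD[OF rc'(2)] sub in force)
    define g where "g = (\<lambda>w. cint c' r' (\<lambda>z. h z / (z - w)))"
    have eqG: "G t = Re (g (complex_of_real t))"
      if t: "0 < t" "complex_of_real t \<in> ?B'" "complex_of_real t \<notin> cball (complex_of_real c) r" for t
    proof -
      let ?t = "complex_of_real t"
      let ?F = "\<lambda>z. h z / (z - ?t)"
      have tp: "?t \<notin> pts" using t(3) ptsB ball_subset_cball by blast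
      have holF: "?F holomorphic_on slitD - insert ?t pts"
        by (intro holomorphic_intros holomorphic_on_subset[OF hol_h]) auto
      have "g ?t = (\<Sum>p\<in>insert ?t pts \<inter> ?B'. residue ?F p)" unfolding g_def
        by (rule cint_residues[OF rc' _ holF]) (use fin t sub in auto)
      also have "insert ?t pts \<inter> ?B' = insert ?t pts" using t sub by (auto simp del: mem_ball)
      also have "(\<Sum>p\<in>insert ?t pts. residue ?F p) = residue ?F ?t + (\<Sum>p\<in>pts. residue ?F p)"
        using fin tp by simp
      also have "residue ?F ?t = h ?t"
        by (rule residue_simple[of "slitD - pts"])
           (use t tp hol_h fin in \<open>auto intro!: open_Diff open_slitD finite_imp_closed\<close>)
      also have "(\<Sum>p\<in>pts. residue ?F p) = (\<Sum>p\<in>insert ?t pts \<inter> ?B. residue ?F p)"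
        using ptsB t(3) ball_subset_cball by (intro sum.cong) blast+
      also have "\<dots> = cint c r ?F"
        by (rule cint_residues[OF rc _ holF, symmetric]) (use fin t(3) ptsB in auto)
      finally show ?thesis by (simp add: G_def)
    qed
    have der: "\<exists>d. ((\<lambda>x. Re (g (complex_of_real x))) has_real_derivative d) (at t) \<and> 0 \<le> d"
      if t: "complex_of_real t \<in> ?B'" for t
    proof -
      let ?t = "complex_of_real t"
      have int: "((\<lambda>z. h z / (z - w) ^ 1) has_contour_integral contour_integral (circlepath (complex_of_real c') r') (\<lambda>z. h z / (z - w)))
         (circlepath (complex_of_real c') r')" if "w \<in> ?B'" for w
      proof -
        have "continuous_on ?S' (\<lambda>z. h z / (z - w))" using that by (auto intro!: continuous_intros hc)
        from has_contour_integral_integral[OF cint_integrable[OF this rc'(1)]] show ?thesis by simp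
      qed
      have hc': "continuous_on (path_image (circlepath (complex_of_real c') r')) h" using hc rc' by simp
      from Cauchy_next_derivative_circlepath(2)[OF hc' int _ t]
      have "((\<lambda>w. contour_integral (circlepath (complex_of_real c') r') (\<lambda>z. h z / (z - w)))
        has_field_derivative contour_integral (circlepath (complex_of_real c') r') (\<lambda>z. h z / (z - ?t)\<^sup>2)) (at ?t)"
        by (simp add: power2_eq_square)
      from DERIV_cdivide[OF this, of "2 * pi * \<i>"]
      have "(g has_field_derivative cint c' r' (\<lambda>z. h z / (z - ?t)\<^sup>2)) (at ?t)"
        by (simp add: g_def[abs_def] cint_def)
      from complex_derivative_real[OF this]
      have "((\<lambda>x. Re (g (complex_of_real x))) has_real_derivative Re (cint c' r' (\<lambda>z. h z / (z - ?t)\<^sup>2))) (at t)" .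
      moreover have "0 \<le> Re (cint c' r' (\<lambda>z. h z / (z - ?t)\<^sup>2))"
      proof -
        define v where "v = (\<lambda>z. u z / (z - ?t))"
        have "set ws \<subseteq> ?B'" using sub unfolding pts_def by blast
        then have "polar c' r' v" unfolding v_def u
          by (intro polar_div polar_rational deg t)
        from cint_pos[OF f rc' this] have "0 \<le> Re (cint c' r' (\<lambda>z. f z * (v z * reflect v z)))" .
        also have "(\<lambda>z. f z * (v z * reflect v z)) = (\<lambda>z. h z / (z - ?t)\<^sup>2)"
          by (auto simp: v_def h_def reflect_def power2_eq_square)
        finally show "0 \<le> Re (cint c' r' (\<lambda>z. h z / (z - ?t)\<^sup>2))" .
      qed
      ultimately show ?thesis by blast
    qed
    have "Re (g (complex_of_real \<epsilon>)) \<le> Re (g (complex_of_real s))"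
    proof (rule DERIV_nonneg_imp_nondecreasing[where f = "\<lambda>x. Re (g (complex_of_real x))"])
      show "\<epsilon> \<le> s" using \<epsilon> s rc by linarith
      fix t assume t: "\<epsilon> \<le> t" "t \<le> s"
      have "dist c' \<epsilon> < r'" "dist c' s < r'" using sub by auto
      then have "dist c' t < r'" using t unfolding dist_real_def by linarith
      then show "\<exists>d. ((\<lambda>x. Re (g (complex_of_real x))) has_real_derivative d) (at t) \<and> 0 \<le> d"
        by (intro der) simp
    qed
    moreover have "complex_of_real \<epsilon> \<notin> cball (complex_of_real c) r" "complex_of_real s \<notin> cball (complex_of_real c) r"
      using \<epsilon> s rc by (auto simp: dist_real_def)
    ultimately show ?thesis using eqG[of \<epsilon>] eqG[of s] \<epsilon> sp sub by (simp del: mem_ball mem_cball)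
  qed
  have reh: "Re (h (complex_of_real t)) = Re (f (complex_of_real t)) * (cmod (u (complex_of_real t)))\<^sup>2" if "0 < t" for t
  proof -
    have "u (complex_of_real t) * reflect u (complex_of_real t) = complex_of_real ((cmod (u (complex_of_real t)))\<^sup>2)"
      unfolding reflect_def by (simp add: complex_norm_square del: of_real_power)
    then show ?thesis unfolding h_def by simp
  qed
  have hcont: "continuous_on ?S h"
    by (rule holomorphic_continuous_sphere[OF hol_h]) (use sphere_subset_slitD[OF rc(2)] ptsB in force)
  obtain K where K: "0 < K" "\<And>z. z \<in> ?S \<Longrightarrow> cmod (h z) \<le> K"
    using bounded_image_sphere[OF hcont] by (auto simp: bounded_pos)
  have step: "Re (cint c r (\<lambda>z. h z / (z - complex_of_real \<epsilon>))) \<le> 0" if \<epsilon>: "0 < \<epsilon>" "\<epsilon> < c - r" for \<epsilon>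
  proof -
    have "((\<lambda>s. cint c r (\<lambda>z. h z / (z - complex_of_real s))) \<longlongrightarrow> cint c r (\<lambda>z. 0)) at_top"
    proof (rule cint_tendsto[OF _ _ _ rc(1)])
      show "\<forall>\<^sub>F s in at_top. continuous_on ?S (\<lambda>z. h z / (z - complex_of_real s))"
        using eventually_gt_at_top[of "c + r"]
      proof eventually_elim
        case (elim s)
        have "z \<noteq> complex_of_real s" if "z \<in> ?S" for z
          using that elim rc by (auto simp: dist_real_def)
        then show ?case by (auto intro!: continuous_intros hcont)
      qed
      show "uniform_limit ?S (\<lambda>s z. h z / (z - complex_of_real s)) (\<lambda>z. 0) at_top"
      proof (rule uniform_limitI)
        fix d :: real assume d: "0 < d"
        show "\<forall>\<^sub>F s in at_top. \<forall>z\<in>?S. dist (h z / (z - complex_of_real s)) 0 < d"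
          using eventually_gt_at_top[of "c + r + K / d"]
        proof eventually_elim
          case (elim s)
          show ?case
          proof
            fix z assume z: "z \<in> ?S"
            have "cmod (complex_of_real c - complex_of_real s) = \<bar>c - s\<bar>"
              by (metis norm_of_real of_real_diff)
            moreover have "cmod (complex_of_real c - complex_of_real s) \<le> cmod (complex_of_real c - z) + cmod (z - complex_of_real s)"
              using norm_triangle_ineq[of "complex_of_real c - z" "z - complex_of_real s"] by simp
            moreover have "cmod (complex_of_real c - z) = r" using z by (simp add: dist_norm)
            ultimately have "K / d < cmod (z - complex_of_real s)" using elim by linarith
            moreover have "0 < K / d" using K d by simp
            ultimately have "K < d * cmod (z - complex_of_real s)" "0 < cmod (z - complex_of_real s)"
              using d by (simp add: field_simps, linarith)
            then have "cmod (h z) / cmod (z - complex_of_real s) < d"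
              using K(2)[OF z] by (simp add: divide_less_eq)
            then show "dist (h z / (z - complex_of_real s)) 0 < d" by (simp add: norm_divide)
          qed
        qed
      qed
    qed simp
    then have l1: "((\<lambda>s. Re (cint c r (\<lambda>z. h z / (z - complex_of_real s)))) \<longlongrightarrow> 0) at_top"
      using tendsto_Re cint_cmult[of c r "\<lambda>z. 0" 0] rc(1) by (fastforce simp: cint_def)
    have l2: "((\<lambda>s. Re (f (complex_of_real s)) * (cmod (u (complex_of_real s)))\<^sup>2) \<longlongrightarrow> 0) at_top"
      unfolding u e_def[symmetric] by (rule mm_growth_rational) (simp add: deg deg_e)
    have "((\<lambda>s. Re (f (complex_of_real s)) * (cmod (u (complex_of_real s)))\<^sup>2
       + Re (cint c r (\<lambda>z. h z / (z - complex_of_real s)))) \<longlongrightarrow> 0 + 0) at_top"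
      by (rule tendsto_add[OF l2 l1])
    moreover have "\<forall>\<^sub>F s in at_top. Re (cint c r (\<lambda>z. h z / (z - complex_of_real \<epsilon>)))
        \<le> Re (f (complex_of_real s)) * (cmod (u (complex_of_real s)))\<^sup>2
       + Re (cint c r (\<lambda>z. h z / (z - complex_of_real s)))"
      using eventually_gt_at_top[of "c + r"]
    proof eventually_elim
      case (elim s)
      then have sp: "0 < s" using rc by linarith
      have "0 \<le> Re (f (complex_of_real \<epsilon>)) * (cmod (u (complex_of_real \<epsilon>)))\<^sup>2"
        using mm_pos[OF \<epsilon>(1)] by (simp add: less_imp_le)
      then show ?case using mono[OF \<epsilon> elim] unfolding G_def reh[OF \<epsilon>(1)] reh[OF sp] by linarith
    qed
    ultimately have "Re (cint c r (\<lambda>z. h z / (z - complex_of_real \<epsilon>))) \<le> 0 + 0"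
      by (rule tendsto_lowerbound) simp
    then show ?thesis by simp
  qed
  define d where "d = (c - r) / 2"
  have d: "0 < d" using rc by (simp add: d_def)
  have sep: "d \<le> cmod (z - complex_of_real \<epsilon>)" "d \<le> cmod z" if "0 < \<epsilon>" "\<epsilon> < d" "z \<in> ?S" for \<epsilon> z
  proof -
    have "2 * d \<le> Re z"
    proof -
      have "\<bar>Re (complex_of_real c - z)\<bar> \<le> r" using abs_Re_le_cmod[of "complex_of_real c - z"] that by (simp add: dist_norm)
      then show ?thesis by (simp add: d_def)
    qed
    moreover have "Re z \<le> cmod z" by (rule complex_Re_le_cmod)
    moreover have "Re z - \<epsilon> \<le> cmod (z - complex_of_real \<epsilon>)" using complex_Re_le_cmod[of "z - complex_of_real \<epsilon>"] by simp
    ultimately show "d \<le> cmod (z - complex_of_real \<epsilon>)" "d \<le> cmod z" using that d by linarith+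
  qed
  have ev: "\<forall>\<^sub>F \<epsilon> in at_right (0::real). 0 < \<epsilon> \<and> \<epsilon> < d"
    using d by (auto simp: eventually_at_right_field)
  have "((\<lambda>\<epsilon>. cint c r (\<lambda>z. h z / (z - complex_of_real \<epsilon>))) \<longlongrightarrow> cint c r (\<lambda>z. h z / z)) (at_right 0)"
  proof (rule cint_tendsto[OF _ _ _ rc(1)])
    show "\<forall>\<^sub>F \<epsilon> in at_right 0. continuous_on ?S (\<lambda>z. h z / (z - complex_of_real \<epsilon>))"
      using ev
    proof eventually_elim
      case (elim \<epsilon>)
      have "z - complex_of_real \<epsilon> \<noteq> 0" if "z \<in> ?S" for z
        using sep(1)[of \<epsilon> z] elim that d by auto
      then show ?case by (intro continuous_intros hcont) auto
    qed
    show "uniform_limit ?S (\<lambda>\<epsilon> z. h z / (z - complex_of_real \<epsilon>)) (\<lambda>z. h z / z) (at_right 0)"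
    proof (rule uniform_limit_linear_bound[OF d])
      fix \<epsilon> z assume \<epsilon>: "0 < \<epsilon>" "\<epsilon> < d" and z: "z \<in> ?S"
      define y where "y = z - complex_of_real \<epsilon>"
      have y: "d \<le> cmod y" "d \<le> cmod z" using sep[OF \<epsilon> z] by (simp_all add: y_def)
      then have nz: "y \<noteq> 0" "z \<noteq> 0" using d by auto
      have "h z / y - h z / z = h z * (z - y) / (y * z)" using nz by (simp add: field_simps)
      also have "z - y = complex_of_real \<epsilon>" by (simp add: y_def)
      also have "cmod (h z * complex_of_real \<epsilon> / (y * z)) = cmod (h z) * \<epsilon> / (cmod y * cmod z)"
        using \<epsilon> by (simp add: norm_divide norm_mult)
      also have "\<dots> \<le> K * \<epsilon> / (d * d)"
        using K y d \<epsilon> z by (intro frac_le mult_mono) auto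
      finally show "cmod (h z / (z - complex_of_real \<epsilon>) - h z / z) \<le> K / (d * d) * \<epsilon>" by (simp add: y_def)
    qed
  qed simp
  then have "((\<lambda>\<epsilon>. Re (cint c r (\<lambda>z. h z / (z - complex_of_real \<epsilon>)))) \<longlongrightarrow> Re (cint c r (\<lambda>z. h z / z))) (at_right 0)"
    by (rule tendsto_Re)
  then have "Re (cint c r (\<lambda>z. h z / z)) \<le> 0"
  proof (rule tendsto_upperbound)
    show "\<forall>\<^sub>F \<epsilon> in at_right 0. Re (cint c r (\<lambda>z. h z / (z - complex_of_real \<epsilon>))) \<le> 0"
      using ev by eventually_elim (rule step, auto simp: d_def)
  qed simp
  then show ?thesis by (simp add: h_def)
qed

end

section \<open>Polynomials nonnegative on the negative half-axis\<close>

inductive sq_cone :: "nat \<Rightarrow> (complex \<Rightarrow> complex) \<Rightarrow> bool" for k where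
  square: "2 * degree a \<le> k \<Longrightarrow> sq_cone k (\<lambda>z. poly a z * reflect (poly a) z)"
| neg_square: "2 * degree b + 1 \<le> k \<Longrightarrow> sq_cone k (\<lambda>z. - z * (poly b z * reflect (poly b) z))"
| add: "sq_cone k F \<Longrightarrow> sq_cone k G \<Longrightarrow> sq_cone k (\<lambda>z. F z + G z)"

lemma sq_cone_mult_norm:
  assumes "sq_cone k F"
  shows "sq_cone (k + 2) (\<lambda>z. (z - w) * (z - cnj w) * F z)"
  using assms
proof induction
  case (square a)
  have "degree ([:- w, 1:] * a) \<le> degree a + 1"
    by (rule order_trans[OF degree_mult_le]) simp
  then have "2 * degree ([:- w, 1:] * a) \<le> k + 2" using square by linarith
  from sq_cone.square[OF this] show ?case
    by (rule back_subst[of "sq_cone (k + 2)"]) (auto simp: reflect_def algebra_simps)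
next
  case (neg_square a)
  have "degree ([:- w, 1:] * a) \<le> degree a + 1"
    by (rule order_trans[OF degree_mult_le]) simp
  then have "2 * degree ([:- w, 1:] * a) + 1 \<le> k + 2" using neg_square by linarith
  from sq_cone.neg_square[OF this] show ?case
    by (rule back_subst[of "sq_cone (k + 2)"]) (auto simp: reflect_def algebra_simps)
next
  case (add F G)
  from sq_cone.add[OF add.IH] show ?case
    by (rule back_subst[of "sq_cone (k + 2)"]) (auto simp: algebra_simps)
qed

lemma sq_cone_mult_linear:
  assumes "sq_cone k F" "0 \<le> x"
  shows "sq_cone (k + 1) (\<lambda>z. (complex_of_real x - z) * F z)"
  using assms(1)
proof induction
  case (square a)
  let ?a = "Polynomial.smult (complex_of_real (sqrt x)) a"
  have sq: "complex_of_real (sqrt x) * complex_of_real (sqrt x) = complex_of_real x"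
    using assms(2) by (simp flip: of_real_mult)
  have "2 * degree ?a \<le> k + 1" "2 * degree a + 1 \<le> k + 1"
    using square degree_smult_le[of "complex_of_real (sqrt x)" a] by linarith+
  from sq_cone.add[OF sq_cone.square[OF this(1)] sq_cone.neg_square[OF this(2)]] show ?case
  proof (rule back_subst[of "sq_cone (k + 1)"], intro ext)
    fix z
    have "poly ?a z * reflect (poly ?a) z = (complex_of_real (sqrt x) * complex_of_real (sqrt x)) * (poly a z * reflect (poly a) z)"
      by (simp add: reflect_def mult_ac)
    then show "poly ?a z * reflect (poly ?a) z + - z * (poly a z * reflect (poly a) z)
      = (complex_of_real x - z) * (poly a z * reflect (poly a) z)"
      unfolding sq by (simp add: algebra_simps)
  qed
next
  case (neg_square a)
  let ?a = "Polynomial.smult (complex_of_real (sqrt x)) a"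
  have sq: "complex_of_real (sqrt x) * complex_of_real (sqrt x) = complex_of_real x"
    using assms(2) by (simp flip: of_real_mult)
  have "2 * degree ?a + 1 \<le> k + 1" "2 * degree ([:0, 1:] * a) \<le> k + 1"
    using neg_square degree_smult_le[of "complex_of_real (sqrt x)" a] degree_mult_le[of "[:0, 1:]" a] by auto
  from sq_cone.add[OF sq_cone.square[OF this(2)] sq_cone.neg_square[OF this(1)]] show ?case
  proof (rule back_subst[of "sq_cone (k + 1)"], intro ext)
    fix z
    have "poly ?a z * reflect (poly ?a) z = (complex_of_real (sqrt x) * complex_of_real (sqrt x)) * (poly a z * reflect (poly a) z)"
      by (simp add: reflect_def mult_ac)
    then have A: "poly ?a z * reflect (poly ?a) z = complex_of_real x * (poly a z * reflect (poly a) z)"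
      unfolding sq .
    have B: "poly ([:0, 1:] * a) z * reflect (poly ([:0, 1:] * a)) z = z * z * (poly a z * reflect (poly a) z)"
      by (simp add: reflect_def mult_ac)
    show "poly ([:0, 1:] * a) z * reflect (poly ([:0, 1:] * a)) z + - z * (poly ?a z * reflect (poly ?a) z)
      = (complex_of_real x - z) * (- z * (poly a z * reflect (poly a) z))"
      unfolding A B by (simp add: algebra_simps)
  qed
next
  case (add F G)
  from sq_cone.add[OF add.IH] show ?case
    by (rule back_subst[of "sq_cone (k + 1)"]) (auto simp: algebra_simps)
qed

lemma eventually_not_in_finite:
  fixes x :: "'a :: t1_space"
  assumes "finite T" shows "eventually (\<lambda>y. y \<notin> T) (at x within A)"
  using assms
proof (induction T rule: finite_induct)
  case (insert a T)
  show ?case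
    using insert.IH eventually_neq_at_within[of a x A] by eventually_elim auto
qed simp

lemma poly_root_factor:
  fixes N :: "complex poly"
  assumes "poly N w = 0" "0 < degree N"
  obtains Q where "N = [:- w, 1:] * Q" "degree N = Suc (degree Q)"
proof -
  have "N = [:- w, 1:] * synthetic_div N w" using synthetic_div_correct'[of w N] assms(1) by simp
  moreover have "degree N = Suc (degree (synthetic_div N w))" using assms(2) by (simp add: degree_synthetic_div)
  ultimately show thesis using that by blast
qed

text \<open>Only nonnegativity off a finite set is assumed, so that linear factors can be divided out
  without a continuity argument.\<close>

lemma sq_cone_poly:
  assumes "finite T" "\<And>t. 0 < t \<Longrightarrow> t \<notin> T \<Longrightarrow> poly N (complex_of_real (- t)) \<in> \<real>\<^sub>\<ge>\<^sub>0"
  shows "sq_cone (degree N) (poly N)"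
  using assms
proof (induction "degree N" arbitrary: N T rule: less_induct)
  case less
  have "infinite {t. 0 < t \<and> t \<notin> T}"
  proof -
    have "{t. 0 < t \<and> t \<notin> T} = {0<..} - T" by auto
    then show ?thesis using less.prems(1) infinite_Ioi[of "0::real"] by simp
  qed
  have refl_N: "map_poly cnj N = N"
  proof (rule ccontr)
    assume "map_poly cnj N \<noteq> N"
    then have "finite {z. poly (map_poly cnj N - N) z = 0}" by (intro poly_roots_finite) simp
    moreover have "(\<lambda>t. complex_of_real (- t)) ` {t. 0 < t \<and> t \<notin> T} \<subseteq> {z. poly (map_poly cnj N - N) z = 0}"
    proof clarify
      fix t :: real assume "0 < t" "t \<notin> T"
      then have "poly N (complex_of_real (- t)) \<in> \<real>\<^sub>\<ge>\<^sub>0" by (rule less.prems)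
      then show "poly (map_poly cnj N - N) (complex_of_real (- t)) = 0"
        by (auto simp: complex_nonneg_Reals_iff complex_eq_iff)
    qed
    ultimately have "finite ((\<lambda>t. complex_of_real (- t)) ` {t. 0 < t \<and> t \<notin> T})" by (rule finite_subset[rotated])
    then have "finite {t. 0 < t \<and> t \<notin> T}" by (rule finite_imageD) (auto simp: inj_on_def)
    then show False using \<open>infinite {t. 0 < t \<and> t \<notin> T}\<close> by contradiction
  qed
  show ?case
  proof (cases "degree N = 0")
    case True
    then obtain q where q: "N = [:q:]" by (rule degree_eq_zeroE)
    obtain t where "0 < t" "t \<notin> T" using \<open>infinite {t. 0 < t \<and> t \<notin> T}\<close> not_finite_existsD by auto
    then have "q \<in> \<real>\<^sub>\<ge>\<^sub>0" using less.prems(2)[of t] q by simp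
    then obtain x where x: "0 \<le> x" "q = complex_of_real x" by (auto elim: nonneg_Reals_cases)
    have "2 * degree [:complex_of_real (sqrt x):] \<le> degree N" by simp
    from sq_cone.square[OF this] show ?thesis
      by (rule back_subst[of "sq_cone (degree N)"]) (use x in \<open>auto simp: q reflect_def simp flip: of_real_mult\<close>)
  next
    case False
    then have "\<not> constant (poly N)" by (simp add: constant_degree)
    then obtain w where w: "poly N w = 0" using fundamental_theorem_of_algebra by blast
    obtain Q where Q: "N = [:- w, 1:] * Q" "degree N = Suc (degree Q)"
      using poly_root_factor[OF w] False by auto
    have NQ: "poly N z = (z - w) * poly Q z" for z unfolding Q(1) by (simp add: algebra_simps)
    have two: ?thesis if root: "poly Q (cnj w) = 0" and dQ: "0 < degree Q"
    proof -
      obtain R where R: "Q = [:- cnj w, 1:] * R" "degree Q = Suc (degree R)"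
        using poly_root_factor[OF root dQ] by auto
      have NR: "poly N z = (z - w) * (z - cnj w) * poly R z" for z
        unfolding NQ R(1) by (simp add: algebra_simps)
      have "sq_cone (degree R) (poly R)"
      proof (rule less.hyps)
        show "degree R < degree N" using Q(2) R(2) by simp
        show "finite (insert (- Re w) T)" using less.prems(1) by simp
        fix t :: real assume t: "0 < t" "t \<notin> insert (- Re w) T"
        let ?z = "complex_of_real (- t)"
        have "?z - w \<noteq> 0" using t by (auto simp: complex_eq_iff)
        then have p: "0 < (cmod (?z - w))\<^sup>2" by simp
        have "(?z - w) * (?z - cnj w) = (?z - w) * cnj (?z - w)" by simp
        also have "\<dots> = complex_of_real ((cmod (?z - w))\<^sup>2)" by (rule complex_norm_square[symmetric])
        finally have "poly N ?z = complex_of_real ((cmod (?z - w))\<^sup>2) * poly R ?z" unfolding NR by simp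
        moreover have "poly N ?z \<in> \<real>\<^sub>\<ge>\<^sub>0" using less.prems(2) t by auto
        ultimately show "poly R ?z \<in> \<real>\<^sub>\<ge>\<^sub>0"
          using p by (auto simp: complex_nonneg_Reals_iff zero_le_mult_iff simp del: of_real_power)
      qed
      from sq_cone_mult_norm[OF this, of w] show ?thesis
        unfolding Q(2) R(2) by (rule back_subst[of "sq_cone (degree R + 2)", THEN back_subst[of "\<lambda>k. sq_cone k (poly N)"]])
           (auto simp: NR)
    qed
    consider "Im w \<noteq> 0" | x where "w = complex_of_real x" "0 \<le> x" | x where "w = complex_of_real x" "x < 0"
      by (metis complex_is_Real_iff linorder_not_le of_real_Re)
    then show ?thesis
    proof cases
      case 1
      have "poly N (cnj w) = 0" using w poly_map_poly_cnj[of N "cnj w"] unfolding refl_N by simp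
      moreover have "cnj w - w \<noteq> 0" using 1 by (auto simp: complex_eq_iff)
      ultimately have "poly Q (cnj w) = 0" unfolding NQ by simp
      moreover have "0 < degree Q"
      proof (rule ccontr)
        assume "\<not> 0 < degree Q"
        then obtain q where "Q = [:q:]" by (auto elim: degree_eq_zeroE)
        then show False using \<open>poly Q (cnj w) = 0\<close> Q False by auto
      qed
      ultimately show ?thesis by (rule two)
    next
      case (2 x)
      have "sq_cone (degree (- Q)) (poly (- Q))"
      proof (rule less.hyps)
        show "degree (- Q) < degree N" using Q(2) by simp
        fix t :: real assume t: "0 < t" "t \<notin> T"
        have "poly N (complex_of_real (- t)) = complex_of_real (t + x) * poly (- Q) (complex_of_real (- t))"
          unfolding NQ 2(1) by (simp add: algebra_simps)
        moreover have "poly N (complex_of_real (- t)) \<in> \<real>\<^sub>\<ge>\<^sub>0" by (rule less.prems(2)[OF t])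
        moreover have "0 < t + x" using t 2 by simp
        ultimately show "poly (- Q) (complex_of_real (- t)) \<in> \<real>\<^sub>\<ge>\<^sub>0"
          by (auto simp: complex_nonneg_Reals_iff mult_le_0_iff simp del: of_real_add)
      qed (fact less.prems(1))
      from sq_cone_mult_linear[OF this 2(2)] have "sq_cone (degree N) (\<lambda>z. (complex_of_real x - z) * poly (- Q) z)"
        by (simp add: Q(2))
      then show ?thesis
        by (rule back_subst[of "sq_cone (degree N)"]) (auto simp: NQ 2(1) algebra_simps)
    next
      case (3 x)
      define g where "g = (\<lambda>s. Re (poly Q (complex_of_real s)))"
      have Im0: "Im (poly Q (complex_of_real s)) = 0 \<and> 0 \<le> (s - x) * g s" if "s < 0" "s \<noteq> x" "- s \<notin> T" for s
      proof -
        have "poly N (complex_of_real s) \<in> \<real>\<^sub>\<ge>\<^sub>0" using less.prems(2)[of "- s"] that by simp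
        moreover have "poly N (complex_of_real s) = complex_of_real (s - x) * poly Q (complex_of_real s)"
          unfolding NQ 3(1) by simp
        ultimately show ?thesis using that by (auto simp: complex_nonneg_Reals_iff g_def simp del: of_real_diff)
      qed
      have lim: "((\<lambda>s. poly Q (complex_of_real s)) \<longlongrightarrow> poly Q w) (at x within A)" for A
        unfolding 3(1) by (intro tendsto_intros)
      have nT: "eventually (\<lambda>s. - s \<notin> T) (at x within A)" for A
        using eventually_not_in_finite[of "uminus ` T" x A] less.prems(1)
        by (auto elim!: eventually_mono) (metis image_eqI minus_minus)
      have neg: "eventually (\<lambda>s. s < 0) (at x within A)" for A
        using 3(2) by (intro order_tendstoD(2)[OF tendsto_ident_at])
      have right: "eventually (\<lambda>s. x < s) (at_right x)" and left: "eventually (\<lambda>s. s < x) (at_left x)"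
        by (simp_all add: eventually_at_right_less eventually_at_left_real eventually_at_filter)
      have "0 \<le> Re (poly Q w)"
      proof (rule tendsto_lowerbound[OF tendsto_Re[OF lim[of "{x<..}"]]])
        show "eventually (\<lambda>s. 0 \<le> Re (poly Q (complex_of_real s))) (at_right x)"
          using nT neg right
        proof eventually_elim
          case (elim s)
          then have "0 \<le> (s - x) * g s" using Im0[of s] by simp
          then show ?case using elim by (simp add: zero_le_mult_iff g_def)
        qed
      qed simp
      moreover have "Re (poly Q w) \<le> 0"
      proof (rule tendsto_upperbound[OF tendsto_Re[OF lim[of "{..<x}"]]])
        show "eventually (\<lambda>s. Re (poly Q (complex_of_real s)) \<le> 0) (at_left x)"
          using nT neg left
        proof eventually_elim
          case (elim s)
          then have "0 \<le> (s - x) * g s" using Im0[of s] by simp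
          then show ?case using elim by (simp add: zero_le_mult_iff g_def)
        qed
      qed simp
      moreover have "Im (poly Q w) = 0"
      proof (rule tendsto_unique[OF _ tendsto_Im[OF lim[of "{x<..}"]]])
        show "((\<lambda>s. Im (poly Q (complex_of_real s))) \<longlongrightarrow> 0) (at_right x)"
        proof (rule tendsto_eventually)
          show "eventually (\<lambda>s. Im (poly Q (complex_of_real s)) = 0) (at_right x)"
            using nT neg right by eventually_elim (use Im0 in auto)
        qed
      qed simp
      ultimately have root: "poly Q w = 0" by (simp add: complex_eq_iff)
      have cw: "cnj w = w" using 3 by simp
      have "0 < degree Q"
      proof (rule ccontr)
        assume "\<not> 0 < degree Q"
        then obtain q where "Q = [:q:]" by (auto elim: degree_eq_zeroE)
        then show False using root Q False by auto
      qed
      then show ?thesis using two root cw by simp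
    qed
  qed
qed

lemma reflect_divide: "reflect (\<lambda>z. u z / v z) z = reflect u z / reflect v z"
  by (simp add: reflect_def)

lemma poly_linear_factors_eq_0: "poly (\<Prod>w\<leftarrow>ws. [:- w, 1:]) z = 0 \<longleftrightarrow> z \<in> set (ws :: complex list)"
  by (induction ws) (auto simp: algebra_simps)

lemma cint_sq_cone:
  assumes f: "matrix_monotone_class f" and rc: "0 < r" "r < c" and ws: "set ws \<subseteq> disc c r"
    and "sq_cone k F" "k < 2 * length ws"
    and e: "e = poly (\<Prod>w\<leftarrow>ws. [:- w, 1:])"
  shows "continuous_on (circ c r) F \<and> Re (cint c r (\<lambda>z. f z / z * (F z / (e z * reflect e z)))) \<le> 0"
  using assms(5)
proof induction
  let ?S = "circ c r"
  have cp: "continuous_on ?S (reflect (poly a))" for a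
    by (rule continuous_on_reflect) (intro continuous_intros)
  {
    case (square a)
    then have "degree a < length ws" using assms(6) by linarith
    from cint_neg_inverse[OF f rc ws this refl]
    have "Re (cint c r (\<lambda>z. f z / z * ((poly a z / e z) * reflect (\<lambda>z. poly a z / e z) z))) \<le> 0"
      unfolding e .
    then show ?case by (auto simp: reflect_divide intro!: continuous_intros cp)
  next
    case (neg_square b)
    then have "degree b < length ws" using assms(6) by linarith
    from cint_pos[OF f rc polar_rational[OF this ws]]
    have "0 \<le> Re (cint c r (\<lambda>z. f z * ((poly b z / e z) * reflect (\<lambda>z. poly b z / e z) z)))"
      unfolding e .
    also have "cint c r (\<lambda>z. f z * ((poly b z / e z) * reflect (\<lambda>z. poly b z / e z) z))
      = cint c r (\<lambda>z. - (f z / z * (- z * (poly b z * reflect (poly b) z) / (e z * reflect e z))))"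
    proof (rule cint_cong[OF _ rc(1)])
      fix z assume "z \<in> ?S"
      then have "0 < Re z" using Re_pos_cball[OF rc(2)] sphere_cball by blast
      then have "z \<noteq> 0" by auto
      then show "f z * ((poly b z / e z) * reflect (\<lambda>z. poly b z / e z) z)
        = - (f z / z * (- z * (poly b z * reflect (poly b) z) / (e z * reflect e z)))"
        by (simp add: reflect_divide)
    qed
    finally show ?case unfolding cint_uminus by (auto intro!: continuous_intros cp)
  next
    case (add F G)
    have fc: "continuous_on ?S f"
      using f rc by (intro mm_continuous)
    have ne: "z \<noteq> 0" "e z \<noteq> 0" "reflect e z \<noteq> 0" if "z \<in> ?S" for z
    proof -
      have "0 < Re z" using Re_pos_cball[OF rc(2)] sphere_cball that by blast
      then show "z \<noteq> 0" by auto
      have "z \<notin> set ws" "cnj z \<notin> set ws" using ws that cnj_mem_sphere[of z c r] by auto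
      then show "e z \<noteq> 0" "reflect e z \<noteq> 0" unfolding e reflect_def using poly_linear_factors_eq_0 by auto
    qed
    have ec: "continuous_on ?S e" unfolding e by (intro continuous_intros)
    have c: "continuous_on ?S (\<lambda>z. f z / z * (H z / (e z * reflect e z)))" if "continuous_on ?S H" for H
      by (intro continuous_intros fc ec continuous_on_reflect that) (use ne in auto)
    have "cint c r (\<lambda>z. f z / z * ((F z + G z) / (e z * reflect e z)))
      = cint c r (\<lambda>z. f z / z * (F z / (e z * reflect e z))) + cint c r (\<lambda>z. f z / z * (G z / (e z * reflect e z)))"
      unfolding add_divide_distrib distrib_left by (rule cint_add) (use c add.IH rc in auto)
    then show ?case using add.IH by (auto intro!: continuous_intros)
  }
qed

section \<open>Hermitian matrices\<close>

definition ip :: "complex Matrix.vec \<Rightarrow> complex Matrix.vec \<Rightarrow> complex" where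
  "ip x y = (\<Sum>i<dim_vec x. cnj (x $ i) * y $ i)"

lemma qform_ip: "qform A x = ip x (A *\<^sub>v x)"
  by (simp add: qform_def ip_def)

lemma ip_add_right: "\<lbrakk>x \<in> carrier_vec n; y \<in> carrier_vec n; z \<in> carrier_vec n\<rbrakk> \<Longrightarrow> ip x (y + z) = ip x y + ip x z"
  by (simp add: ip_def distrib_left sum.distrib)

lemma ip_add_left: "\<lbrakk>x \<in> carrier_vec n; y \<in> carrier_vec n; z \<in> carrier_vec n\<rbrakk> \<Longrightarrow> ip (y + z) x = ip y x + ip z x"
  by (simp add: ip_def distrib_right sum.distrib)

lemma ip_diff_right: "\<lbrakk>x \<in> carrier_vec n; y \<in> carrier_vec n; z \<in> carrier_vec n\<rbrakk> \<Longrightarrow> ip x (y - z) = ip x y - ip x z"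
  by (simp add: ip_def right_diff_distrib sum_subtractf)

lemma ip_diff_left: "\<lbrakk>x \<in> carrier_vec n; y \<in> carrier_vec n; z \<in> carrier_vec n\<rbrakk> \<Longrightarrow> ip (y - z) x = ip y x - ip z x"
  by (simp add: ip_def left_diff_distrib sum_subtractf)

lemma ip_smult_right: "\<lbrakk>x \<in> carrier_vec n; y \<in> carrier_vec n\<rbrakk> \<Longrightarrow> ip x (k \<cdot>\<^sub>v y) = k * ip x y"
  by (simp add: ip_def sum_distrib_left mult_ac)

lemma ip_smult_left: "\<lbrakk>x \<in> carrier_vec n; y \<in> carrier_vec n\<rbrakk> \<Longrightarrow> ip (k \<cdot>\<^sub>v x) y = cnj k * ip x y"
  by (simp add: ip_def sum_distrib_left mult_ac)

lemma cnj_ip: "\<lbrakk>x \<in> carrier_vec n; y \<in> carrier_vec n\<rbrakk> \<Longrightarrow> cnj (ip x y) = ip y x"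
  by (simp add: ip_def mult.commute)

lemma ip_self: "ip x x = complex_of_real (\<Sum>i<dim_vec x. (cmod (x $ i))\<^sup>2)"
  unfolding ip_def of_real_sum by (intro sum.cong refl) (metis complex_norm_square mult.commute)

lemma ip_self_nonneg: "0 \<le> Re (ip x x)"
  by (simp add: ip_self sum_nonneg)

lemma ip_self_pos:
  assumes "x \<in> carrier_vec n" "x \<noteq> 0\<^sub>v n" shows "0 < Re (ip x x)"
proof -
  obtain i where "i < n" "x $ i \<noteq> 0" using assms by (metis carrier_vecD eq_vecI index_zero_vec)
  then have "0 < (\<Sum>i<dim_vec x. (cmod (x $ i))\<^sup>2)"
    using assms by (intro sum_pos2[of _ i]) auto
  then show ?thesis by (simp add: ip_self)
qed

lemma ip_mult_mat:
  assumes "A \<in> carrier_mat n m" "x \<in> carrier_vec m" "w \<in> carrier_vec n"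
  shows "ip w (A *\<^sub>v x) = (\<Sum>i<n. \<Sum>j<m. cnj (w $ i) * x $ j * A $$ (i,j))"
  using assms unfolding ip_def
  by (auto simp: scalar_prod_def sum_distrib_left mult_ac atLeast0LessThan intro!: sum.cong)

lemma adj_carrier: "A \<in> carrier_mat n m \<Longrightarrow> adj A \<in> carrier_mat m n"
  by (simp add: adj_def)

lemma ip_adj:
  assumes "A \<in> carrier_mat n m" "x \<in> carrier_vec m" "w \<in> carrier_vec n"
  shows "ip w (A *\<^sub>v x) = ip (adj A *\<^sub>v w) x"
proof -
  have "ip (adj A *\<^sub>v w) x = cnj (ip x (adj A *\<^sub>v w))"
    using assms adj_carrier[OF assms(1)] by (subst cnj_ip[of _ m]) auto
  also have "\<dots> = (\<Sum>j<m. \<Sum>i<n. cnj (w $ i) * x $ j * A $$ (i,j))"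
    unfolding ip_mult_mat[OF adj_carrier[OF assms(1)] assms(3,2)] cnj_sum
    by (intro sum.cong refl) (use assms in \<open>auto simp: adj_def\<close>)
  also have "\<dots> = (\<Sum>i<n. \<Sum>j<m. cnj (w $ i) * x $ j * A $$ (i,j))" by (rule sum.swap)
  finally show ?thesis using ip_mult_mat[OF assms] by simp
qed

lemma ip_hermitian:
  assumes "A \<in> carrier_mat n n" "hermitian A" "x \<in> carrier_vec n" "w \<in> carrier_vec n"
  shows "ip w (A *\<^sub>v x) = ip (A *\<^sub>v w) x"
  using ip_adj[OF assms(1,3,4)] assms(2) by (simp add: hermitian_def)

lemma hermitian_qform_real:
  assumes "A \<in> carrier_mat n n" "hermitian A" "x \<in> carrier_vec n"
  shows "Im (ip x (A *\<^sub>v x)) = 0"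
proof -
  have "cnj (ip x (A *\<^sub>v x)) = ip x (A *\<^sub>v x)"
    using ip_hermitian[OF assms assms(3)] cnj_ip[of x n "A *\<^sub>v x"] assms by simp
  then show ?thesis by (simp add: complex_eq_iff)
qed

lemma trace_commute:
  fixes A B :: "complex mat"
  assumes "A \<in> carrier_mat n n" "B \<in> carrier_mat n n"
  shows "(\<Sum>i<n. (A * B) $$ (i,i)) = (\<Sum>i<n. (B * A) $$ (i,i))"
proof -
  have "(\<Sum>i<n. (A * B) $$ (i,i)) = (\<Sum>i<n. \<Sum>j<n. A $$ (i,j) * B $$ (j,i))"
    using assms by (auto simp: scalar_prod_def atLeast0LessThan intro!: sum.cong)
  also have "\<dots> = (\<Sum>j<n. \<Sum>i<n. A $$ (i,j) * B $$ (j,i))" by (rule sum.swap)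
  also have "\<dots> = (\<Sum>i<n. (B * A) $$ (i,i))"
    using assms by (auto simp: scalar_prod_def atLeast0LessThan mult.commute intro!: sum.cong)
  finally show ?thesis .
qed

lemma trace_eigenvalues:
  fixes X :: "complex mat"
  assumes X: "X \<in> carrier_mat n n" and es: "char_poly X = (\<Prod>e\<leftarrow>es. [:- e, 1:])"
  shows "(\<Sum>i<n. X $$ (i,i)) = sum_list es"
proof -
  obtain B P Q where dec: "schur_decomposition X es = (B, P, Q)"
    using prod_cases3 by blast
  from schur_decomposition[OF X es dec]
  have sim: "similar_mat_wit X B P Q" and d: "diag_mat B = es" by auto
  from similar_mat_witD2[OF X sim] have c: "B \<in> carrier_mat n n" "P \<in> carrier_mat n n" "Q \<in> carrier_mat n n"
    and QP: "Q * P = 1\<^sub>m n" and XB: "X = P * B * Q" by auto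
  have "(\<Sum>i<n. X $$ (i,i)) = (\<Sum>i<n. (Q * (P * B)) $$ (i,i))"
    unfolding XB by (rule trace_commute) (use c in auto)
  also have "Q * (P * B) = (Q * P) * B" using c by (simp add: assoc_mult_mat[of _ n n _ n _ n])
  also have "\<dots> = B" using c by (simp add: QP)
  also have "(\<Sum>i<n. B $$ (i,i)) = sum_list es"
    unfolding d[symmetric] using c by (simp add: diag_mat_def interv_sum_list_conv_sum_set_nat atLeast0LessThan)
  finally show ?thesis .
qed

lemma hermitian_entry: "hermitian A \<Longrightarrow> A \<in> carrier_mat n n \<Longrightarrow> i < n \<Longrightarrow> j < n \<Longrightarrow> cnj (A $$ (j,i)) = A $$ (i,j)"
  unfolding hermitian_def adj_def by (metis carrier_matD index_mat(1) case_prod_conv)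

definition outer :: "nat \<Rightarrow> complex Matrix.vec \<Rightarrow> complex mat" where
  "outer n v = mat n n (\<lambda>(a,b). v $ a * cnj (v $ b))"

lemma outer_carrier [simp]: "outer n v \<in> carrier_mat n n"
  by (simp add: outer_def)

lemma ip_outer:
  assumes "v \<in> carrier_vec n" "x \<in> carrier_vec n" "w \<in> carrier_vec n"
  shows "ip w (outer n v *\<^sub>v x) = ip w v * ip v x"
proof -
  have "ip w (outer n v *\<^sub>v x) = (\<Sum>i<n. \<Sum>j<n. (cnj (w $ i) * v $ i) * (cnj (v $ j) * x $ j))"
    unfolding ip_mult_mat[OF outer_carrier assms(2,3)]
    by (intro sum.cong refl) (simp add: outer_def)
  then show ?thesis using assms by (simp add: ip_def sum_product)
qed

lemma psd_outer:
  assumes "v \<in> carrier_vec n" shows "psd (outer n v)"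
  unfolding psd_def
proof (intro conjI ballI)
  show "hermitian (outer n v)"
    unfolding hermitian_def adj_def by (auto simp: outer_def intro!: eq_matI)
  fix x :: "complex Matrix.vec" assume "x \<in> carrier_vec (dim_row (outer n v))"
  then have x: "x \<in> carrier_vec n" by (simp add: outer_def)
  have "ip x v * ip v x = cnj (ip v x) * ip v x" using cnj_ip[OF assms x] by simp
  also have "\<dots> = complex_of_real ((cmod (ip v x))\<^sup>2)" by (metis complex_norm_square mult.commute)
  finally show "0 \<le> Re (qform (outer n v) x)" by (simp add: qform_ip ip_outer[OF assms x x])
qed

text \<open>Replacing the eigenvalues already found by \<open>\<i>\<close> keeps the remaining ones real, so the trace of the
  deflated matrix detects an eigenvector orthogonal to the previous ones.\<close>

lemma orthonormal_eigenvectors: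
  assumes H: "H \<in> carrier_mat n n" "hermitian H" and "k \<le> n"
  shows "\<exists>v l. (\<forall>i<k. v i \<in> carrier_vec n \<and> H *\<^sub>v v i = complex_of_real (l i) \<cdot>\<^sub>v v i) \<and>
    (\<forall>i<k. \<forall>j<k. ip (v i) (v j) = (if i = j then 1 else 0))"
  using \<open>k \<le> n\<close>
proof (induction k)
  case (Suc k)
  have "k \<le> n" using Suc.prems by simp
  from Suc.IH[OF this] obtain v l
    where vl: "\<forall>i<k. v i \<in> carrier_vec n \<and> H *\<^sub>v v i = complex_of_real (l i) \<cdot>\<^sub>v v i"
      and orth': "\<forall>i<k. \<forall>j<k. ip (v i) (v j) = (if i = j then 1 else 0)"
    by (elim exE conjE)
  have v: "\<And>i. i < k \<Longrightarrow> v i \<in> carrier_vec n"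
    and Hv: "\<And>i. i < k \<Longrightarrow> H *\<^sub>v v i = complex_of_real (l i) \<cdot>\<^sub>v v i"
    using vl by blast+
  have orth: "\<And>i j. i < k \<Longrightarrow> j < k \<Longrightarrow> ip (v i) (v j) = (if i = j then 1 else 0)"
    using orth' by blast
  define M where "M = mat n n (\<lambda>(a,b). H $$ (a,b) + (\<Sum>i<k. (\<i> - l i) * (v i $ a * cnj (v i $ b))))"
  have M: "M \<in> carrier_mat n n" by (simp add: M_def)
  have ipM: "ip w (M *\<^sub>v x) = ip w (H *\<^sub>v x) + (\<Sum>i<k. (\<i> - l i) * (ip w (v i) * ip (v i) x))"
    if x: "x \<in> carrier_vec n" and w: "w \<in> carrier_vec n" for w x
  proof -
    have "ip w (M *\<^sub>v x) = (\<Sum>a<n. \<Sum>b<n. cnj (w $ a) * x $ b * H $$ (a,b))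
      + (\<Sum>a<n. \<Sum>b<n. \<Sum>i<k. (\<i> - l i) * ((cnj (w $ a) * v i $ a) * (cnj (v i $ b) * x $ b)))"
      unfolding ip_mult_mat[OF M x w] sum.distrib[symmetric]
      by (intro sum.cong refl) (simp add: M_def distrib_left sum_distrib_left mult_ac)
    also have "(\<Sum>a<n. \<Sum>b<n. \<Sum>i<k. (\<i> - l i) * ((cnj (w $ a) * v i $ a) * (cnj (v i $ b) * x $ b)))
      = (\<Sum>a<n. \<Sum>i<k. \<Sum>b<n. (\<i> - l i) * ((cnj (w $ a) * v i $ a) * (cnj (v i $ b) * x $ b)))"
      by (intro sum.cong refl sum.swap)
    also have "\<dots> = (\<Sum>i<k. \<Sum>a<n. \<Sum>b<n. (\<i> - l i) * ((cnj (w $ a) * v i $ a) * (cnj (v i $ b) * x $ b)))"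
      by (rule sum.swap)
    also have "\<dots> = (\<Sum>i<k. (\<i> - l i) * (ip w (v i) * ip (v i) x))"
    proof (intro sum.cong refl)
      fix i assume "i \<in> {..<k}"
      then have "v i \<in> carrier_vec n" using v by simp
      then show "(\<Sum>a<n. \<Sum>b<n. (\<i> - l i) * ((cnj (w $ a) * v i $ a) * (cnj (v i $ b) * x $ b)))
        = (\<i> - l i) * (ip w (v i) * ip (v i) x)"
        using w unfolding ip_def sum_product unfolding sum_distrib_left by simp
    qed
    finally show ?thesis unfolding ip_mult_mat[OF H(1) x w] .
  qed
  obtain es where es: "char_poly M = (\<Prod>e\<leftarrow>es. [:- e, 1:])" "length es = n"
    using char_poly_factorized[OF M] by auto
  have tr: "Im (\<Sum>a<n. M $$ (a,a)) = real k"
  proof -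
    have "(\<Sum>a<n. M $$ (a,a)) = (\<Sum>a<n. H $$ (a,a)) + (\<Sum>a<n. \<Sum>i<k. (\<i> - l i) * (cnj (v i $ a) * v i $ a))"
      by (simp add: M_def sum.distrib mult_ac)
    also have "(\<Sum>a<n. \<Sum>i<k. (\<i> - l i) * (cnj (v i $ a) * v i $ a)) = (\<Sum>i<k. \<Sum>a<n. (\<i> - l i) * (cnj (v i $ a) * v i $ a))"
      by (rule sum.swap)
    also have "\<dots> = (\<Sum>i<k. \<i> - l i)"
    proof (intro sum.cong refl)
      fix i assume i: "i \<in> {..<k}"
      then have "(\<Sum>a<n. (\<i> - l i) * (cnj (v i $ a) * v i $ a)) = (\<i> - l i) * ip (v i) (v i)"
        using v[of i] by (simp add: ip_def sum_distrib_left)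
      then show "(\<Sum>a<n. (\<i> - l i) * (cnj (v i $ a) * v i $ a)) = \<i> - l i" using orth[of i i] i by simp
    qed
    moreover have "Im (H $$ (a,a)) = 0" if "a < n" for a
      using hermitian_entry[OF H(2,1) that that] by (simp add: complex_eq_iff)
    ultimately show ?thesis by simp
  qed
  have "\<exists>\<mu>\<in>set es. \<mu> \<noteq> \<i>"
  proof (rule ccontr)
    assume "\<not> ?thesis"
    then have "es = replicate n \<i>" using es(2) by (intro replicate_eqI) auto
    then have "sum_list es = of_nat n * \<i>" by (simp add: sum_list_replicate)
    then have "Im (sum_list es) = real n" by simp
    then show False using tr trace_eigenvalues[OF M es(1)] Suc.prems by simp
  qed
  then obtain \<mu> where \<mu>: "\<mu> \<in> set es" "\<mu> \<noteq> \<i>" by blast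
  have "poly (char_poly M) \<mu> = 0" unfolding es(1) using \<mu>(1) poly_linear_factors_eq_0 by blast
  then have "eigenvalue M \<mu>" using eigenvalue_root_char_poly[OF M] by simp
  then obtain y where y: "y \<in> carrier_vec n" "y \<noteq> 0\<^sub>v n" "M *\<^sub>v y = \<mu> \<cdot>\<^sub>v y"
    using M by (auto simp: eigenvalue_def eigenvector_def)
  have vy: "ip (v j) y = 0" if j: "j < k" for j
  proof -
    have "\<mu> * ip (v j) y = ip (v j) (M *\<^sub>v y)" using y v[OF j] by (simp add: ip_smult_right)
    also have "\<dots> = ip (v j) (H *\<^sub>v y) + (\<Sum>i<k. (\<i> - l i) * (ip (v j) (v i) * ip (v i) y))"
      by (rule ipM[OF y(1) v[OF j]])
    also have "(\<Sum>i<k. (\<i> - l i) * (ip (v j) (v i) * ip (v i) y)) = (\<Sum>i<k. if i = j then (\<i> - l j) * ip (v j) y else 0)"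
      using orth j by (intro sum.cong) auto
    also have "\<dots> = (\<i> - l j) * ip (v j) y" using j by simp
    also have "ip (v j) (H *\<^sub>v y) = l j * ip (v j) y"
      unfolding ip_hermitian[OF H y(1) v[OF j]] Hv[OF j] using y v[OF j] by (simp add: ip_smult_left)
    finally have "(\<mu> - \<i>) * ip (v j) y = 0" by (simp add: algebra_simps)
    then show ?thesis using \<mu>(2) by simp
  qed
  have Hy: "H *\<^sub>v y = \<mu> \<cdot>\<^sub>v y"
  proof (rule eq_vecI)
    fix a assume "a < dim_vec (\<mu> \<cdot>\<^sub>v y)"
    then have a: "a < n" using y by simp
    have u: "unit_vec n a \<in> carrier_vec n" by simp
    have e: "ip (unit_vec n a) x = x $ a" if "x \<in> carrier_vec n" for x
      using a that by (simp add: ip_def unit_vec_def if_distrib[of cnj] if_distrib[of "\<lambda>x. x * _"] cong: if_cong)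
    have "ip (unit_vec n a) (M *\<^sub>v y) = ip (unit_vec n a) (H *\<^sub>v y)"
      unfolding ipM[OF y(1) u] using vy by simp
    then show "(H *\<^sub>v y) $ a = (\<mu> \<cdot>\<^sub>v y) $ a" using e[of "M *\<^sub>v y"] e[of "H *\<^sub>v y"] M H(1) y by simp
  qed (use H(1) y in auto)
  define s where "s = Re (ip y y)"
  have s: "0 < s" "ip y y = complex_of_real s" using ip_self_pos[OF y(1,2)] by (simp_all add: s_def ip_self)
  have "Im (\<mu> * ip y y) = 0"
    using hermitian_qform_real[OF H y(1)] unfolding Hy using y(1) by (simp add: ip_smult_right[of y n])
  then have mu: "\<mu> = complex_of_real (Re \<mu>)" using s by (simp add: complex_eq_iff)
  define q where "q = 1 / sqrt s"
  have q: "q * (q * s) = 1" using s(1) by (simp add: q_def)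
  define z where "z = complex_of_real q \<cdot>\<^sub>v y"
  have z: "z \<in> carrier_vec n" using y by (simp add: z_def)
  have Hz: "H *\<^sub>v z = complex_of_real (Re \<mu>) \<cdot>\<^sub>v z"
  proof -
    have "H *\<^sub>v z = complex_of_real q \<cdot>\<^sub>v (\<mu> \<cdot>\<^sub>v y)"
      unfolding z_def Hy[symmetric] by (rule mult_mat_vec[OF H(1) y(1)])
    also have "\<dots> = \<mu> \<cdot>\<^sub>v z" by (simp add: z_def smult_smult_assoc mult.commute)
    finally show ?thesis using mu by simp
  qed
  have zz: "ip z z = 1"
  proof -
    have "ip z z = complex_of_real (q * (q * s))"
      unfolding z_def using y s by (simp add: ip_smult_left[of _ n] ip_smult_right[of _ n])
    then show ?thesis unfolding q by simp
  qed
  have vz: "ip (v j) z = 0" "ip z (v j) = 0" if "j < k" for j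
  proof -
    show "ip (v j) z = 0" using vy[OF that] v[OF that] y by (simp add: z_def ip_smult_right[of _ n])
    then show "ip z (v j) = 0" using cnj_ip[OF v[OF that] z] by simp
  qed
  show ?case
    by (rule exI[of _ "v(k := z)"], rule exI[of _ "l(k := Re \<mu>)"])
       (use v Hv orth z Hz zz vz in \<open>auto simp: less_Suc_eq\<close>)
qed auto

lemma spectral_theorem:
  assumes H: "H \<in> carrier_mat n n" "hermitian H"
  obtains v :: "nat \<Rightarrow> complex Matrix.vec" and l :: "nat \<Rightarrow> real"
  where "\<And>i. i < n \<Longrightarrow> v i \<in> carrier_vec n" "\<And>i. i < n \<Longrightarrow> ip (v i) (v i) = 1"
    "\<And>i. i < n \<Longrightarrow> H *\<^sub>v v i = complex_of_real (l i) \<cdot>\<^sub>v v i"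
    "\<And>a b. a < n \<Longrightarrow> b < n \<Longrightarrow> (\<Sum>i<n. v i $ a * cnj (v i $ b)) = (if a = b then 1 else 0)"
proof -
  from orthonormal_eigenvectors[OF H order_refl] obtain v l
    where vl: "\<forall>i<n. v i \<in> carrier_vec n \<and> H *\<^sub>v v i = complex_of_real (l i) \<cdot>\<^sub>v v i"
      and orth': "\<forall>i<n. \<forall>j<n. ip (v i) (v j) = (if i = j then 1 else 0)"
    by (elim exE conjE)
  have v: "\<And>i. i < n \<Longrightarrow> v i \<in> carrier_vec n"
    and Hv: "\<And>i. i < n \<Longrightarrow> H *\<^sub>v v i = complex_of_real (l i) \<cdot>\<^sub>v v i"
    using vl by blast+
  have orth: "\<And>i j. i < n \<Longrightarrow> j < n \<Longrightarrow> ip (v i) (v j) = (if i = j then 1 else 0)"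
    using orth' by blast
  define V where "V = mat n n (\<lambda>(a,j). v j $ a)"
  define V' where "V' = mat n n (\<lambda>(j,a). cnj (v j $ a))"
  have c: "V \<in> carrier_mat n n" "V' \<in> carrier_mat n n" by (simp_all add: V_def V'_def)
  have "V' * V = 1\<^sub>m n"
  proof (rule eq_matI)
    fix i j assume "i < dim_row (1\<^sub>m n :: complex mat)" "j < dim_col (1\<^sub>m n :: complex mat)"
    then have ij: "i < n" "j < n" by auto
    then have "(V' * V) $$ (i,j) = ip (v i) (v j)"
      using v[OF ij(1)] by (simp add: V_def V'_def scalar_prod_def ip_def atLeast0LessThan)
    then show "(V' * V) $$ (i,j) = 1\<^sub>m n $$ (i,j)" using orth ij by simp
  qed (use c in auto)
  from mat_mult_left_right_inverse[OF c(2,1) this] have VV: "V * V' = 1\<^sub>m n" .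
  have "(\<Sum>i<n. v i $ a * cnj (v i $ b)) = (if a = b then 1 else 0)" if "a < n" "b < n" for a b
  proof -
    have "(V * V') $$ (a,b) = (\<Sum>i<n. v i $ a * cnj (v i $ b))"
      using that by (simp add: V_def V'_def scalar_prod_def atLeast0LessThan)
    then show ?thesis using that by (simp add: VV)
  qed
  moreover have "\<And>i. i < n \<Longrightarrow> ip (v i) (v i) = 1" using orth by simp
  ultimately show thesis using that[of v l] v Hv by blast
qed


lemma spectral_entries:
  fixes v :: "nat \<Rightarrow> complex Matrix.vec" and l g :: "nat \<Rightarrow> real"
  assumes H: "H \<in> carrier_mat n n"
    and v: "\<And>i. i < n \<Longrightarrow> v i \<in> carrier_vec n"
      "\<And>i. i < n \<Longrightarrow> H *\<^sub>v v i = complex_of_real (l i) \<cdot>\<^sub>v v i"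
    and ab: "a < n" "b < n"
  shows "(\<Sum>c<n. H $$ (a,c) * (\<Sum>i<n. complex_of_real (g i) * (v i $ c * cnj (v i $ b))))
    = (\<Sum>i<n. complex_of_real (l i * g i) * (v i $ a * cnj (v i $ b)))"
proof -
  have Hv: "(\<Sum>c<n. H $$ (a,c) * v i $ c) = complex_of_real (l i) * v i $ a" if "i < n" for i
  proof -
    have "(H *\<^sub>v v i) $ a = (\<Sum>c<n. H $$ (a,c) * v i $ c)"
      using H v(1)[OF that] ab by (simp add: scalar_prod_def atLeast0LessThan)
    then show ?thesis using v(1,2)[OF that] ab by simp
  qed
  have "(\<Sum>c<n. H $$ (a,c) * (\<Sum>i<n. complex_of_real (g i) * (v i $ c * cnj (v i $ b))))
    = (\<Sum>c<n. \<Sum>i<n. (complex_of_real (g i) * cnj (v i $ b)) * (H $$ (a,c) * v i $ c))"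
    by (simp add: sum_distrib_left mult_ac)
  also have "\<dots> = (\<Sum>i<n. \<Sum>c<n. (complex_of_real (g i) * cnj (v i $ b)) * (H $$ (a,c) * v i $ c))"
    by (rule sum.swap)
  also have "\<dots> = (\<Sum>i<n. complex_of_real (l i * g i) * (v i $ a * cnj (v i $ b)))"
    by (intro sum.cong refl) (simp add: sum_distrib_left[symmetric] Hv)
  finally show ?thesis .
qed

lemma linear_functional_coeffs:
  fixes L :: "complex mat \<Rightarrow> complex"
  assumes add: "\<And>A B. A \<in> carrier_mat n n \<Longrightarrow> B \<in> carrier_mat n n \<Longrightarrow> L (A + B) = L A + L B"
    and smult: "\<And>c A. A \<in> carrier_mat n n \<Longrightarrow> L (c \<cdot>\<^sub>m A) = c * L A"
  obtains \<kappa> where "\<And>M. M \<in> carrier_mat n n \<Longrightarrow> L M = (\<Sum>i<n. \<Sum>j<n. \<kappa> i j * M $$ (i,j))"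
proof -
  define E :: "nat \<times> nat \<Rightarrow> complex mat" where "E = (\<lambda>p. mat n n (\<lambda>q. if q = p then 1 else 0))"
  have E: "E p \<in> carrier_mat n n" for p by (simp add: E_def)
  have "L M = (\<Sum>i<n. \<Sum>j<n. L (E (i,j)) * M $$ (i,j))" if M: "M \<in> carrier_mat n n" for M
  proof -
    define part where "part = (\<lambda>S. mat n n (\<lambda>q. if q \<in> S then M $$ q else 0))"
    have pc: "part S \<in> carrier_mat n n" for S by (simp add: part_def)
    have "L (part S) = (\<Sum>p\<in>S. L (E p) * M $$ p)" if "finite S" for S
      using that
    proof induction
      case empty
      have "part {} = 0 \<cdot>\<^sub>m part {}" by (rule eq_matI) (auto simp: part_def)
      then show ?case using smult[OF pc, of 0 "{}"] by simp
    next
      case (insert p S)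
      have "part (insert p S) = part S + (M $$ p) \<cdot>\<^sub>m E p"
        using insert.hyps by (intro eq_matI) (auto simp: part_def E_def)
      then show ?case using insert by (simp add: add pc smult E add.commute mult.commute)
    qed
    from this[of "{..<n} \<times> {..<n}"]
    have "L (part ({..<n} \<times> {..<n})) = (\<Sum>i<n. \<Sum>j<n. L (E (i,j)) * M $$ (i,j))"
      by (simp add: sum.cartesian_product case_prod_beta)
    moreover have "part ({..<n} \<times> {..<n}) = M" by (rule eq_matI) (use M in \<open>auto simp: part_def\<close>)
    ultimately show ?thesis by simp
  qed
  then show thesis by (rule that[of "\<lambda>i j. L (E (i,j))"])
qed

lemma mat_vec_smult_right:
  fixes A :: "complex mat"
  assumes "A \<in> carrier_mat n m" "v \<in> carrier_vec m"
  shows "A *\<^sub>v (k \<cdot>\<^sub>v v) = k \<cdot>\<^sub>v (A *\<^sub>v v)"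
  by (rule mult_mat_vec[OF assms])

lemma inverse_matrix_exists:
  fixes X :: "complex mat"
  assumes X: "X \<in> carrier_mat n n" and inj: "\<And>v. v \<in> carrier_vec n \<Longrightarrow> X *\<^sub>v v = 0\<^sub>v n \<Longrightarrow> v = 0\<^sub>v n"
  obtains R where "R \<in> carrier_mat n n" "X * R = 1\<^sub>m n"
proof -
  have "det X \<noteq> 0" using det_0_iff_vec_prod_zero[OF X] inj by blast
  then have "X * ((1 / det X) \<cdot>\<^sub>m adj_mat X) = 1\<^sub>m n"
    using adj_mat[OF X] X by (subst mult_smult_distrib[of _ n n _ n]) (auto simp: intro!: eq_matI)
  with smult_carrier_mat[OF adj_mat(1)[OF X]] show thesis by (rule that)
qed

lemma re_part_carrier: "A \<in> carrier_mat n n \<Longrightarrow> re_part A \<in> carrier_mat n n"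
  using adj_carrier[of A n n] by (simp add: re_part_def)

lemma re_part_hermitian: "A \<in> carrier_mat n n \<Longrightarrow> hermitian (re_part A)"
  unfolding hermitian_def re_part_def adj_def by (auto intro!: eq_matI)

definition im_part :: "complex mat \<Rightarrow> complex mat" where
  "im_part A = (- \<i> / 2) \<cdot>\<^sub>m (A - adj A)"

lemma im_part_carrier: "A \<in> carrier_mat n n \<Longrightarrow> im_part A \<in> carrier_mat n n"
  using adj_carrier[of A n n] minus_carrier_mat[of "adj A" n n A] by (simp add: im_part_def)

lemma im_part_hermitian: "A \<in> carrier_mat n n \<Longrightarrow> hermitian (im_part A)"
  unfolding hermitian_def im_part_def adj_def by (auto intro!: eq_matI simp: algebra_simps)

lemma re_im_decomposition:
  "A \<in> carrier_mat n n \<Longrightarrow> A = re_part A + \<i> \<cdot>\<^sub>m im_part A"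
  unfolding re_part_def im_part_def adj_def by (auto intro!: eq_matI simp: algebra_simps)

lemma re_im_mult_vec:
  assumes "A \<in> carrier_mat n n" "x \<in> carrier_vec n"
  shows "A *\<^sub>v x = re_part A *\<^sub>v x + \<i> \<cdot>\<^sub>v (im_part A *\<^sub>v x)"
  by (subst re_im_decomposition[OF assms(1)])
     (simp add: add_mult_distrib_mat_vec[of _ n n] re_part_carrier im_part_carrier assms smult_mat_vec[of _ n n])

lemma ip_re_im:
  assumes A: "A \<in> carrier_mat n n" and x: "x \<in> carrier_vec n"
  shows "Re (ip x (re_part A *\<^sub>v x)) = Re (ip x (A *\<^sub>v x))" "Re (ip x (im_part A *\<^sub>v x)) = Im (ip x (A *\<^sub>v x))"
proof -
  have "ip x (A *\<^sub>v x) = ip x (re_part A *\<^sub>v x) + \<i> * ip x (im_part A *\<^sub>v x)"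
    unfolding re_im_mult_vec[OF A x] using re_part_carrier[OF A] im_part_carrier[OF A] x
    by (simp add: ip_add_right[of _ n] ip_smult_right[of _ n])
  moreover have "Im (ip x (re_part A *\<^sub>v x)) = 0" "Im (ip x (im_part A *\<^sub>v x)) = 0"
    using hermitian_qform_real re_part_carrier[OF A] re_part_hermitian[OF A] im_part_carrier[OF A] im_part_hermitian[OF A] x by blast+
  ultimately show "Re (ip x (re_part A *\<^sub>v x)) = Re (ip x (A *\<^sub>v x))" "Re (ip x (im_part A *\<^sub>v x)) = Im (ip x (A *\<^sub>v x))"
    by simp_all
qed

lemma shift_mult_vec:
  fixes A :: "complex mat"
  assumes "A \<in> carrier_mat n n" "x \<in> carrier_vec n"
  shows "(A + k \<cdot>\<^sub>m 1\<^sub>m n) *\<^sub>v x = A *\<^sub>v x + k \<cdot>\<^sub>v x"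
  using assms smult_mat_vec[OF one_carrier_mat assms(2), of k]
  by (simp add: add_mult_distrib_mat_vec[of _ n n])

lemma accretive_injective:
  assumes A: "A \<in> carrier_mat n n" and pos: "\<And>x. x \<in> carrier_vec n \<Longrightarrow> x \<noteq> 0\<^sub>v n \<Longrightarrow> 0 < Re (ip x (A *\<^sub>v x))"
    and v: "v \<in> carrier_vec n" "A *\<^sub>v v = 0\<^sub>v n"
  shows "v = 0\<^sub>v n"
proof (rule ccontr)
  assume "v \<noteq> 0\<^sub>v n"
  then have "0 < Re (ip v (A *\<^sub>v v))" by (rule pos[OF v(1)])
  then show False using v by (simp add: ip_def)
qed

lemma accretive_shift_pos:
  assumes A: "A \<in> carrier_mat n n" and pos: "\<And>x. x \<in> carrier_vec n \<Longrightarrow> x \<noteq> 0\<^sub>v n \<Longrightarrow> 0 < Re (ip x (A *\<^sub>v x))"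
    and t: "0 \<le> t" and x: "x \<in> carrier_vec n" "x \<noteq> 0\<^sub>v n"
  shows "0 < Re (ip x ((A + complex_of_real t \<cdot>\<^sub>m 1\<^sub>m n) *\<^sub>v x))"
proof -
  have "ip x ((A + complex_of_real t \<cdot>\<^sub>m 1\<^sub>m n) *\<^sub>v x) = ip x (A *\<^sub>v x) + t * ip x x"
    unfolding shift_mult_vec[OF A x(1)] using A x by (simp add: ip_add_right[of _ n] ip_smult_right[of _ n])
  moreover have "0 \<le> t * Re (ip x x)" using t ip_self_nonneg by simp
  ultimately show ?thesis using pos[OF x] by simp
qed

text \<open>Generalized Cauchy--Schwarz for \<open>\<bar>Q\<bar> \<le> \<tau> P\<close>, obtained by polarization.\<close>

lemma sector_bound:
  assumes P: "P \<in> carrier_mat n n" "hermitian P" and Q: "Q \<in> carrier_mat n n" "hermitian Q"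
    and bound: "\<And>x. x \<in> carrier_vec n \<Longrightarrow> \<bar>Re (ip x (Q *\<^sub>v x))\<bar> \<le> \<tau> * Re (ip x (P *\<^sub>v x))"
    and \<tau>: "0 \<le> \<tau>" and w: "w \<in> carrier_vec n" and s: "s \<in> carrier_vec n" and eq: "P *\<^sub>v s = Q *\<^sub>v w"
  shows "Re (ip s (P *\<^sub>v s)) \<le> \<tau>\<^sup>2 * Re (ip w (P *\<^sub>v w))"
proof -
  define \<rho> where "\<rho> = Re (ip s (P *\<^sub>v s))"
  define \<omega> where "\<omega> = Re (ip w (P *\<^sub>v w))"
  have expand: "Re (ip (w + complex_of_real a \<cdot>\<^sub>v s) (X *\<^sub>v (w + complex_of_real a \<cdot>\<^sub>v s)))
      = Re (ip w (X *\<^sub>v w)) + 2 * a * Re (ip s (X *\<^sub>v w)) + a\<^sup>2 * Re (ip s (X *\<^sub>v s))"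
    if X: "X \<in> carrier_mat n n" "hermitian X" for X a
  proof -
    have Xw: "X *\<^sub>v w \<in> carrier_vec n" and Xs: "X *\<^sub>v s \<in> carrier_vec n" using X w s by auto
    have as: "complex_of_real a \<cdot>\<^sub>v s \<in> carrier_vec n" using s by simp
    have "X *\<^sub>v (w + complex_of_real a \<cdot>\<^sub>v s) = X *\<^sub>v w + complex_of_real a \<cdot>\<^sub>v (X *\<^sub>v s)"
      using X s w by (simp add: mult_add_distrib_mat_vec[of _ n n] mat_vec_smult_right[of _ n n])
    moreover have "ip w (X *\<^sub>v s) = cnj (ip s (X *\<^sub>v w))"
      using ip_hermitian[OF X s w] cnj_ip[OF s Xw] by simp
    ultimately show ?thesis using w s Xw Xs as
      by (simp add: ip_add_left[of _ n] ip_add_right[of _ n] ip_smult_left[of _ n] ip_smult_right[of _ n] power2_eq_square algebra_simps)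
  qed
  have key: "4 * a * \<rho> \<le> 2 * \<tau> * (\<omega> + a\<^sup>2 * \<rho>)" for a
  proof -
    have c: "w + complex_of_real a \<cdot>\<^sub>v s \<in> carrier_vec n" "w + complex_of_real (- a) \<cdot>\<^sub>v s \<in> carrier_vec n"
      using w s by auto
    define A B where "A = Re (ip w (Q *\<^sub>v w))" and "B = Re (ip s (Q *\<^sub>v s))"
    define C where "C = Re (ip s (P *\<^sub>v w))"
    have "A + 2 * a * \<rho> + a\<^sup>2 * B \<le> \<tau> * (\<omega> + 2 * a * C + a\<^sup>2 * \<rho>)"
      using bound[OF c(1)] unfolding expand[OF Q] expand[OF P] eq[symmetric] A_def B_def C_def \<rho>_def \<omega>_def by linarith
    moreover have "- (A - 2 * a * \<rho> + a\<^sup>2 * B) \<le> \<tau> * (\<omega> - 2 * a * C + a\<^sup>2 * \<rho>)"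
      using bound[OF c(2)] unfolding expand[OF Q] expand[OF P] eq[symmetric] A_def B_def C_def \<rho>_def \<omega>_def by simp
    ultimately have "(A + 2 * a * \<rho> + a\<^sup>2 * B) - (A - 2 * a * \<rho> + a\<^sup>2 * B)
      \<le> \<tau> * (\<omega> + 2 * a * C + a\<^sup>2 * \<rho>) + \<tau> * (\<omega> - 2 * a * C + a\<^sup>2 * \<rho>)" by linarith
    then show ?thesis by (simp add: algebra_simps)
  qed
  show ?thesis
  proof (cases "\<tau> = 0")
    case True
    then show ?thesis using key[of 1] by (simp add: \<rho>_def)
  next
    case False
    then have \<tau>p: "0 < \<tau>" using \<tau> by simp
    have "4 * (1 / \<tau>) * \<rho> * \<tau> \<le> 2 * \<tau> * (\<omega> + (1 / \<tau>)\<^sup>2 * \<rho>) * \<tau>"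
      by (rule mult_right_mono[OF key \<tau>])
    moreover have "4 * (1 / \<tau>) * \<rho> * \<tau> = 4 * \<rho>" using \<tau>p by simp
    moreover have "2 * \<tau> * (\<omega> + (1 / \<tau>)\<^sup>2 * \<rho>) * \<tau> = 2 * (\<tau>\<^sup>2 * \<omega>) + 2 * \<rho>"
      using \<tau>p by (simp add: power2_eq_square field_simps)
    ultimately show ?thesis by (simp add: \<rho>_def \<omega>_def)
  qed
qed

section \<open>Positive linear maps and resolvents\<close>

lemma accretive_cos_bound:
  assumes A: "A \<in> carrier_mat n n"
    and pos: "\<And>x. x \<in> carrier_vec n \<Longrightarrow> x \<noteq> 0\<^sub>v n \<Longrightarrow> 0 < Re (ip x (A *\<^sub>v x))"
    and sec: "\<And>x. x \<in> carrier_vec n \<Longrightarrow> \<bar>Im (ip x (A *\<^sub>v x))\<bar> \<le> \<tau> * Re (ip x (A *\<^sub>v x))"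
    and \<tau>: "0 \<le> \<tau>" and c: "c * (1 + \<tau>\<^sup>2) = 1" and t: "0 < t"
    and R: "R \<in> carrier_mat n n" "(A + complex_of_real t \<cdot>\<^sub>m 1\<^sub>m n) * R = 1\<^sub>m n"
    and W: "W \<in> carrier_mat n n" "(re_part A + complex_of_real t \<cdot>\<^sub>m 1\<^sub>m n) * W = 1\<^sub>m n"
    and y: "y \<in> carrier_vec n"
  shows "c * Re (ip y (A *\<^sub>v (R *\<^sub>v y))) \<le> Re (ip y y) - t * Re (ip y (W *\<^sub>v y))"
proof -
  define P Q where "P = re_part A" and "Q = im_part A"
  have P: "P \<in> carrier_mat n n" "hermitian P" and Q: "Q \<in> carrier_mat n n" "hermitian Q"
    using A by (simp_all add: P_def Q_def re_part_carrier re_part_hermitian im_part_carrier im_part_hermitian)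
  have ReP: "Re (ip x (P *\<^sub>v x)) = Re (ip x (A *\<^sub>v x))" and ReQ: "Re (ip x (Q *\<^sub>v x)) = Im (ip x (A *\<^sub>v x))"
    if "x \<in> carrier_vec n" for x
    using ip_re_im[OF A that] by (simp_all add: P_def Q_def)
  have Ppos: "0 < Re (ip x (P *\<^sub>v x))" if "x \<in> carrier_vec n" "x \<noteq> 0\<^sub>v n" for x
    using pos[OF that] ReP[OF that(1)] by simp
  have Pnn: "0 \<le> Re (ip x (P *\<^sub>v x))" if "x \<in> carrier_vec n" for x
    using Ppos[OF that] P(1) that by (cases "x = 0\<^sub>v n") (auto simp: ip_def less_imp_le)
  obtain S where S: "S \<in> carrier_mat n n" "P * S = 1\<^sub>m n"
    using inverse_matrix_exists[OF P(1)] accretive_injective[OF P(1) Ppos] by blast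
  define w where "w = R *\<^sub>v y"
  define h where "h = W *\<^sub>v y"
  define a where "a = A *\<^sub>v w"
  define s where "s = S *\<^sub>v (Q *\<^sub>v w)"
  define g where "g = complex_of_real c \<cdot>\<^sub>v (w + \<i> \<cdot>\<^sub>v s)"
  define k where "k = complex_of_real c \<cdot>\<^sub>v a"
  define p where "p = P *\<^sub>v h"
  have w: "w \<in> carrier_vec n" and h: "h \<in> carrier_vec n" and a: "a \<in> carrier_vec n" and s: "s \<in> carrier_vec n"
    and g: "g \<in> carrier_vec n" and k: "k \<in> carrier_vec n" and p: "p \<in> carrier_vec n"
    using A R W S Q P y by (auto simp: w_def h_def a_def s_def g_def k_def p_def)
  have yw: "y = a + complex_of_real t \<cdot>\<^sub>v w"
  proof -
    have "(A + complex_of_real t \<cdot>\<^sub>m 1\<^sub>m n) *\<^sub>v w = ((A + complex_of_real t \<cdot>\<^sub>m 1\<^sub>m n) * R) *\<^sub>v y"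
      unfolding w_def using A R y by (intro assoc_mult_mat_vec[symmetric, of _ n n _ n]) auto
    then show ?thesis using shift_mult_vec[OF A w] y R(2) by (simp add: a_def)
  qed
  have yh: "y = p + complex_of_real t \<cdot>\<^sub>v h"
  proof -
    have "(P + complex_of_real t \<cdot>\<^sub>m 1\<^sub>m n) *\<^sub>v h = ((P + complex_of_real t \<cdot>\<^sub>m 1\<^sub>m n) * W) *\<^sub>v y"
      unfolding h_def using P W y by (intro assoc_mult_mat_vec[symmetric, of _ n n _ n]) auto
    then show ?thesis using shift_mult_vec[OF P(1) h] y W(2) by (simp add: p_def P_def)
  qed
  have Ps: "P *\<^sub>v s = Q *\<^sub>v w"
  proof -
    have "P *\<^sub>v s = (P * S) *\<^sub>v (Q *\<^sub>v w)"
      unfolding s_def using P S Q w by (intro assoc_mult_mat_vec[symmetric, of _ n n _ n]) auto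
    then show ?thesis using Q w by (simp add: S(2))
  qed
  have Pg: "P *\<^sub>v g = k"
  proof -
    have "P *\<^sub>v g = complex_of_real c \<cdot>\<^sub>v (P *\<^sub>v w + \<i> \<cdot>\<^sub>v (P *\<^sub>v s))"
      unfolding g_def using P w s
      by (simp add: mult_add_distrib_mat_vec[of _ n n] mat_vec_smult_right[of _ n n])
    also have "\<dots> = k" unfolding Ps k_def a_def re_im_mult_vec[OF A w] P_def[symmetric] Q_def[symmetric] ..
    finally show ?thesis .
  qed
  define \<omega> where "\<omega> = Re (ip w (P *\<^sub>v w))"
  define \<rho> where "\<rho> = Re (ip s (P *\<^sub>v s))"
  have \<rho>: "\<rho> \<le> \<tau>\<^sup>2 * \<omega>" unfolding \<rho>_def \<omega>_def
    by (rule sector_bound[OF P Q _ \<tau> w s Ps]) (use sec ReP ReQ in simp)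
  have \<omega>0: "0 \<le> \<omega>" unfolding \<omega>_def by (rule Pnn[OF w])
  have c0: "0 < c" and c1: "c \<le> 1"
  proof -
    have "0 < 1 + \<tau>\<^sup>2" by (simp add: add_pos_nonneg)
    then have *: "c = 1 / (1 + \<tau>\<^sup>2)" using c by (simp add: field_simps)
    show "0 < c" "c \<le> 1" unfolding * by (simp_all add: add_pos_nonneg)
  qed
  have wa: "Re (ip a w) = \<omega>" "Re (ip w a) = \<omega>"
  proof -
    show "Re (ip w a) = \<omega>" unfolding a_def \<omega>_def ReP[OF w] ..
    then show "Re (ip a w) = \<omega>" using cnj_ip[OF w a] by (metis cnj.simps(1))
  qed
  have gPg: "Re (ip g (P *\<^sub>v g)) \<le> c * \<omega>"
  proof -
    have js: "\<i> \<cdot>\<^sub>v s \<in> carrier_vec n" using s by simp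
    have Pw: "P *\<^sub>v w \<in> carrier_vec n" and Ps': "P *\<^sub>v s \<in> carrier_vec n" using P w s by auto
    have "P *\<^sub>v (w + \<i> \<cdot>\<^sub>v s) = P *\<^sub>v w + \<i> \<cdot>\<^sub>v (P *\<^sub>v s)"
      using P w s by (simp add: mult_add_distrib_mat_vec[of _ n n] mat_vec_smult_right[of _ n n])
    then have "Re (ip (w + \<i> \<cdot>\<^sub>v s) (P *\<^sub>v (w + \<i> \<cdot>\<^sub>v s)))
      = \<omega> + \<rho> - Im (ip w (P *\<^sub>v s)) + Im (ip s (P *\<^sub>v w))"
      using w s js Pw Ps'
      by (simp add: ip_add_left[of _ n] ip_add_right[of _ n] ip_smult_left[of _ n] ip_smult_right[of _ n] \<omega>_def \<rho>_def)
    moreover have "Im (ip w (P *\<^sub>v s)) = 0"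
      unfolding Ps by (rule hermitian_qform_real[OF Q w])
    moreover have "Im (ip s (P *\<^sub>v w)) = 0"
    proof -
      have "ip s (P *\<^sub>v w) = cnj (ip w (P *\<^sub>v s))"
        using ip_hermitian[OF P w s] cnj_ip[OF w Ps'] by simp
      then show ?thesis using \<open>Im (ip w (P *\<^sub>v s)) = 0\<close> by simp
    qed
    ultimately have "Re (ip (w + \<i> \<cdot>\<^sub>v s) (P *\<^sub>v (w + \<i> \<cdot>\<^sub>v s))) = \<omega> + \<rho>" by simp
    moreover have "ip g (P *\<^sub>v g) = complex_of_real (c\<^sup>2) * ip (w + \<i> \<cdot>\<^sub>v s) (P *\<^sub>v (w + \<i> \<cdot>\<^sub>v s))"
      unfolding g_def using P w js
      by (simp add: mat_vec_smult_right[of _ n n] ip_smult_left[of _ n] ip_smult_right[of _ n] power2_eq_square)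
    ultimately have "Re (ip g (P *\<^sub>v g)) = c\<^sup>2 * (\<omega> + \<rho>)" by (simp del: of_real_power)
    also have "\<dots> \<le> c\<^sup>2 * (\<omega> + \<tau>\<^sup>2 * \<omega>)" using \<rho> by (intro mult_left_mono) auto
    also have "\<dots> = c * (c * (1 + \<tau>\<^sup>2)) * \<omega>" by (simp add: power2_eq_square algebra_simps)
    also have "\<dots> = c * \<omega>" unfolding c by simp
    finally show ?thesis .
  qed
  have hg: "Re (ip k h) = Re (ip g p)"
    using ip_hermitian[OF P h g] by (simp add: Pg p_def)
  have e1: "Re (ip y y) - t * Re (ip y h) = Re (ip p p) + t * Re (ip h p)"
  proof -
    have "ip p h = cnj (ip h p)" using cnj_ip[OF h p] by simp
    then show ?thesis unfolding yh using p h
      by (simp add: ip_add_left[of _ n] ip_add_right[of _ n] ip_smult_left[of _ n] ip_smult_right[of _ n] algebra_simps)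
  qed
  have e2: "Re (ip k y) = Re (ip k p) + t * Re (ip k h)"
    unfolding yh using p h k by (simp add: ip_add_right[of _ n] ip_smult_right[of _ n])
  have sq1: "0 \<le> Re (ip p p) - 2 * Re (ip k p) + Re (ip k k)"
  proof -
    have "ip p k = cnj (ip k p)" using cnj_ip[OF k p] by simp
    then have "Re (ip (p - k) (p - k)) = Re (ip p p) - 2 * Re (ip k p) + Re (ip k k)"
      using p k by (simp add: ip_diff_left[of _ n] ip_diff_right[of _ n])
    then show ?thesis using ip_self_nonneg[of "p - k"] by simp
  qed
  have sq2: "0 \<le> Re (ip h p) - 2 * Re (ip g p) + Re (ip g k)"
  proof -
    have "P *\<^sub>v (h - g) = p - k"
      unfolding p_def Pg[symmetric] using P h g by (intro mult_minus_distrib_mat_vec[of _ n n]) auto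
    moreover have "Re (ip h k) = Re (ip g p)"
      using cnj_ip[OF h k] hg by (metis cnj.simps(1))
    ultimately have "Re (ip (h - g) (P *\<^sub>v (h - g))) = Re (ip h p) - 2 * Re (ip g p) + Re (ip g k)"
      using h g p k by (simp add: ip_diff_left[of _ n] ip_diff_right[of _ n])
    then show ?thesis using Pnn[of "h - g"] h g by simp
  qed
  define \<alpha> where "\<alpha> = Re (ip a a)"
  have \<alpha>0: "0 \<le> \<alpha>" unfolding \<alpha>_def by (rule ip_self_nonneg)
  have ky: "Re (ip k y) = c * (\<alpha> + t * \<omega>)"
    unfolding k_def yw using a w wa
    by (simp add: ip_add_right[of _ n] ip_smult_left[of _ n] ip_smult_right[of _ n] \<alpha>_def algebra_simps)
  have kk: "Re (ip k k) = c\<^sup>2 * \<alpha>"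
    unfolding k_def using a by (simp add: ip_smult_left[of _ n] ip_smult_right[of _ n] \<alpha>_def power2_eq_square)
  have ya: "Re (ip y a) = \<alpha> + t * \<omega>"
    unfolding yw using a w wa by (simp add: ip_add_left[of _ n] ip_smult_left[of _ n] \<alpha>_def)
  have "t * Re (ip g k) \<le> t * (c * \<omega>)" using gPg t by (simp add: Pg)
  moreover have "t * (2 * Re (ip g p)) \<le> t * (Re (ip h p) + Re (ip g k))" using sq2 t by (intro mult_left_mono) auto
  ultimately have "2 * Re (ip k y) - Re (ip k k) - t * (c * \<omega>) \<le> Re (ip p p) + t * Re (ip h p)"
    using sq1 unfolding e2 hg by (simp add: algebra_simps)
  then have "2 * (c * (\<alpha> + t * \<omega>)) - c\<^sup>2 * \<alpha> - t * (c * \<omega>) \<le> Re (ip y y) - t * Re (ip y h)"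
    unfolding e1 ky kk .
  moreover have "c\<^sup>2 * \<alpha> \<le> c * \<alpha>"
    using c0 c1 \<alpha>0 by (simp add: power2_eq_square mult_left_le_one_le mult_right_mono)
  ultimately have "c * (\<alpha> + t * \<omega>) \<le> Re (ip y y) - t * Re (ip y h)"
    by (simp add: algebra_simps)
  then show ?thesis by (simp add: ya[symmetric] a_def w_def h_def)
qed

lemma ip_add_mat:
  assumes "A \<in> carrier_mat n m" "B \<in> carrier_mat n m" "x \<in> carrier_vec m" "w \<in> carrier_vec n"
  shows "ip w ((A + B) *\<^sub>v x) = ip w (A *\<^sub>v x) + ip w (B *\<^sub>v x)"
  using assms by (simp add: add_mult_distrib_mat_vec[of _ n m] ip_add_right[of _ n])

lemma ip_smult_mat:
  assumes "A \<in> carrier_mat n m" "x \<in> carrier_vec m" "w \<in> carrier_vec n"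
  shows "ip w ((k \<cdot>\<^sub>m A) *\<^sub>v x) = k * ip w (A *\<^sub>v x)"
  using assms by (simp add: smult_mat_vec[of _ n m] ip_smult_right[of _ n])

context
  fixes n r :: nat and \<Phi> :: "complex mat \<Rightarrow> complex mat"
  assumes Phi: "positive_linear_map n r \<Phi>" and unit: "unital n r \<Phi>"
begin

lemma Phi_carrier: "A \<in> carrier_mat n n \<Longrightarrow> \<Phi> A \<in> carrier_mat r r"
  and Phi_add: "A \<in> carrier_mat n n \<Longrightarrow> B \<in> carrier_mat n n \<Longrightarrow> \<Phi> (A + B) = \<Phi> A + \<Phi> B"
  and Phi_smult: "A \<in> carrier_mat n n \<Longrightarrow> \<Phi> (k \<cdot>\<^sub>m A) = k \<cdot>\<^sub>m \<Phi> A"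
  and Phi_psd: "A \<in> carrier_mat n n \<Longrightarrow> psd A \<Longrightarrow> psd (\<Phi> A)"
  and Phi_one: "\<Phi> (1\<^sub>m n) = 1\<^sub>m r"
  using Phi unit unfolding positive_linear_map_def unital_def by blast+

lemma ip_Phi_add:
  assumes "x \<in> carrier_vec r" "w \<in> carrier_vec r" "A \<in> carrier_mat n n" "B \<in> carrier_mat n n"
  shows "ip w (\<Phi> (A + B) *\<^sub>v x) = ip w (\<Phi> A *\<^sub>v x) + ip w (\<Phi> B *\<^sub>v x)"
  unfolding Phi_add[OF assms(3,4)] by (rule ip_add_mat) (use assms Phi_carrier in auto)

lemma ip_Phi_smult:
  assumes "x \<in> carrier_vec r" "w \<in> carrier_vec r" "A \<in> carrier_mat n n"
  shows "ip w (\<Phi> (k \<cdot>\<^sub>m A) *\<^sub>v x) = k * ip w (\<Phi> A *\<^sub>v x)"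
  unfolding Phi_smult[OF assms(3)] by (rule ip_smult_mat) (use assms Phi_carrier in auto)

lemma ip_Phi_combination:
  fixes v :: "nat \<Rightarrow> complex Matrix.vec"
  assumes x: "x \<in> carrier_vec r" and w: "w \<in> carrier_vec r" and M: "M \<in> carrier_mat n n"
    and eq: "\<And>a b. a < n \<Longrightarrow> b < n \<Longrightarrow> M $$ (a,b) = (\<Sum>i<n. complex_of_real (g i) * (v i $ a * cnj (v i $ b)))"
  shows "ip w (\<Phi> M *\<^sub>v x) = (\<Sum>i<n. complex_of_real (g i) * ip w (\<Phi> (outer n (v i)) *\<^sub>v x))"
proof -
  obtain \<kappa> where \<kappa>: "\<And>M. M \<in> carrier_mat n n \<Longrightarrow> ip w (\<Phi> M *\<^sub>v x) = (\<Sum>a<n. \<Sum>b<n. \<kappa> a b * M $$ (a,b))"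
    by (rule linear_functional_coeffs[of n "\<lambda>M. ip w (\<Phi> M *\<^sub>v x)"])
       (use ip_Phi_add[OF x w] ip_Phi_smult[OF x w] in auto)
  have "ip w (\<Phi> M *\<^sub>v x) = (\<Sum>a<n. \<Sum>b<n. \<Sum>i<n. g i * (\<kappa> a b * outer n (v i) $$ (a,b)))"
    unfolding \<kappa>[OF M] by (intro sum.cong refl) (simp add: eq outer_def sum_distrib_left mult_ac)
  also have "\<dots> = (\<Sum>a<n. \<Sum>i<n. \<Sum>b<n. g i * (\<kappa> a b * outer n (v i) $$ (a,b)))"
    by (intro sum.cong refl sum.swap)
  also have "\<dots> = (\<Sum>i<n. \<Sum>a<n. \<Sum>b<n. g i * (\<kappa> a b * outer n (v i) $$ (a,b)))"
    by (rule sum.swap)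
  also have "\<dots> = (\<Sum>i<n. g i * ip w (\<Phi> (outer n (v i)) *\<^sub>v x))"
    by (simp add: \<kappa>[OF outer_carrier] sum_distrib_left)
  finally show ?thesis .
qed

lemma Phi_spectral:
  assumes H: "H \<in> carrier_mat n n" "hermitian H"
  obtains v :: "nat \<Rightarrow> complex Matrix.vec" and l :: "nat \<Rightarrow> real"
  where "\<And>i. i < n \<Longrightarrow> v i \<in> carrier_vec n" "\<And>i. i < n \<Longrightarrow> ip (v i) (v i) = 1"
    "\<And>i. i < n \<Longrightarrow> H *\<^sub>v v i = complex_of_real (l i) \<cdot>\<^sub>v v i"
    "\<And>w x. w \<in> carrier_vec r \<Longrightarrow> x \<in> carrier_vec r \<Longrightarrow>
        ip w x = (\<Sum>i<n. ip w (\<Phi> (outer n (v i)) *\<^sub>v x))"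
    "\<And>w x. w \<in> carrier_vec r \<Longrightarrow> x \<in> carrier_vec r \<Longrightarrow>
        ip w (\<Phi> H *\<^sub>v x) = (\<Sum>i<n. complex_of_real (l i) * ip w (\<Phi> (outer n (v i)) *\<^sub>v x))"
    "\<And>W w x. W \<in> carrier_mat n n \<Longrightarrow> H * W = 1\<^sub>m n \<Longrightarrow> (\<And>i. i < n \<Longrightarrow> l i \<noteq> 0) \<Longrightarrow> w \<in> carrier_vec r \<Longrightarrow> x \<in> carrier_vec r \<Longrightarrow>
        ip w (\<Phi> W *\<^sub>v x) = (\<Sum>i<n. complex_of_real (1 / l i) * ip w (\<Phi> (outer n (v i)) *\<^sub>v x))"
proof -
  obtain v :: "nat \<Rightarrow> complex Matrix.vec" and l :: "nat \<Rightarrow> real"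
    where v: "\<And>i. i < n \<Longrightarrow> v i \<in> carrier_vec n" "\<And>i. i < n \<Longrightarrow> ip (v i) (v i) = 1"
    and Hv: "\<And>i. i < n \<Longrightarrow> H *\<^sub>v v i = complex_of_real (l i) \<cdot>\<^sub>v v i"
    and compl: "\<And>a b. a < n \<Longrightarrow> b < n \<Longrightarrow> (\<Sum>i<n. v i $ a * cnj (v i $ b)) = (if a = b then 1 else 0)"
    using spectral_theorem[OF H] by blast
  have ent: "(\<Sum>c<n. H $$ (a,c) * (\<Sum>i<n. complex_of_real (g i) * (v i $ c * cnj (v i $ b))))
    = (\<Sum>i<n. complex_of_real (l i * g i) * (v i $ a * cnj (v i $ b)))" if "a < n" "b < n" for a b and g :: "nat \<Rightarrow> real"
    by (rule spectral_entries[OF H(1) v(1) Hv that])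
  have one: "ip w x = (\<Sum>i<n. ip w (\<Phi> (outer n (v i)) *\<^sub>v x))" if "w \<in> carrier_vec r" "x \<in> carrier_vec r" for w x
    using ip_Phi_combination[OF that(2,1), of "1\<^sub>m n" "\<lambda>_. 1" v] compl that by (simp add: Phi_one)
  have HH: "ip w (\<Phi> H *\<^sub>v x) = (\<Sum>i<n. complex_of_real (l i) * ip w (\<Phi> (outer n (v i)) *\<^sub>v x))"
    if "w \<in> carrier_vec r" "x \<in> carrier_vec r" for w x
  proof (rule ip_Phi_combination[OF that(2,1) H(1)])
    fix a b assume ab: "a < n" "b < n"
    have "H $$ (a,b) = (\<Sum>c<n. if c = b then H $$ (a,c) else 0)" using ab by simp
    also have "\<dots> = (\<Sum>c<n. H $$ (a,c) * (\<Sum>i<n. complex_of_real 1 * (v i $ c * cnj (v i $ b))))"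
      using ab compl by (intro sum.cong refl) simp
    also have "\<dots> = (\<Sum>i<n. complex_of_real (l i) * (v i $ a * cnj (v i $ b)))"
      using ent[OF ab, of "\<lambda>_. 1"] by simp
    finally show "H $$ (a,b) = (\<Sum>i<n. complex_of_real (l i) * (v i $ a * cnj (v i $ b)))" .
  qed
  have WW: "ip w (\<Phi> W *\<^sub>v x) = (\<Sum>i<n. complex_of_real (1 / l i) * ip w (\<Phi> (outer n (v i)) *\<^sub>v x))"
    if W: "W \<in> carrier_mat n n" "H * W = 1\<^sub>m n" and l: "\<And>i. i < n \<Longrightarrow> l i \<noteq> 0"
      and wx: "w \<in> carrier_vec r" "x \<in> carrier_vec r" for W w x
  proof (rule ip_Phi_combination[OF wx(2,1) W(1)])
    define W' where "W' = mat n n (\<lambda>(a,b). \<Sum>i<n. complex_of_real (1 / l i) * (v i $ a * cnj (v i $ b)))"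
    have W': "W' \<in> carrier_mat n n" by (simp add: W'_def)
    have "H * W' = 1\<^sub>m n"
    proof (rule eq_matI)
      fix a b assume "a < dim_row (1\<^sub>m n :: complex mat)" "b < dim_col (1\<^sub>m n :: complex mat)"
      then have ab: "a < n" "b < n" by auto
      have "(H * W') $$ (a,b) = (\<Sum>c<n. H $$ (a,c) * (\<Sum>i<n. complex_of_real (1 / l i) * (v i $ c * cnj (v i $ b))))"
        using ab H(1) by (simp add: W'_def scalar_prod_def atLeast0LessThan)
      also have "\<dots> = (\<Sum>i<n. complex_of_real (l i * (1 / l i)) * (v i $ a * cnj (v i $ b)))"
        by (rule ent[OF ab])
      also have "\<dots> = (\<Sum>i<n. v i $ a * cnj (v i $ b))" using l by (intro sum.cong refl) simp
      finally show "(H * W') $$ (a,b) = 1\<^sub>m n $$ (a,b)" using compl ab by simp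
    qed (use H W' in auto)
    moreover have "W * H = 1\<^sub>m n" by (rule mat_mult_left_right_inverse[OF H(1) W])
    ultimately have "W = W'"
      using assoc_mult_mat[OF W(1) H(1) W'] W(1) W' by simp
    then show "W $$ (a,b) = (\<Sum>i<n. complex_of_real (1 / l i) * (v i $ a * cnj (v i $ b)))" if "a < n" "b < n" for a b
      using that by (simp add: W'_def)
  qed
  show thesis by (rule that[OF v Hv one HH WW])
qed

lemma Phi_hermitian_real:
  assumes H: "H \<in> carrier_mat n n" "hermitian H" and x: "x \<in> carrier_vec r"
  shows "Im (ip x (\<Phi> H *\<^sub>v x)) = 0"
proof -
  obtain v :: "nat \<Rightarrow> complex Matrix.vec" and l :: "nat \<Rightarrow> real"
    where v: "\<And>i. i < n \<Longrightarrow> v i \<in> carrier_vec n"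
    and HH: "\<And>w x. w \<in> carrier_vec r \<Longrightarrow> x \<in> carrier_vec r \<Longrightarrow>
        ip w (\<Phi> H *\<^sub>v x) = (\<Sum>i<n. complex_of_real (l i) * ip w (\<Phi> (outer n (v i)) *\<^sub>v x))"
    by (rule Phi_spectral[OF H]) blast
  have "Im (ip x (\<Phi> (outer n (v i)) *\<^sub>v x)) = 0" if "i < n" for i
    using Phi_psd[OF outer_carrier psd_outer[OF v[OF that]]] x
    by (intro hermitian_qform_real[of _ r] Phi_carrier outer_carrier) (auto simp: psd_def)
  then show ?thesis unfolding HH[OF x x] by simp
qed

lemma Phi_re_part:
  assumes M: "M \<in> carrier_mat n n" and x: "x \<in> carrier_vec r"
  shows "Re (ip x (\<Phi> M *\<^sub>v x)) = Re (ip x (\<Phi> (re_part M) *\<^sub>v x))"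
proof -
  have c: "re_part M \<in> carrier_mat n n" "im_part M \<in> carrier_mat n n"
    using M by (simp_all add: re_part_carrier im_part_carrier)
  have "ip x (\<Phi> M *\<^sub>v x) = ip x (\<Phi> (re_part M) *\<^sub>v x) + \<i> * ip x (\<Phi> (im_part M) *\<^sub>v x)"
    by (subst re_im_decomposition[OF M]) (simp add: ip_Phi_add[OF x x] ip_Phi_smult[OF x x] c)
  then show ?thesis using Phi_hermitian_real[OF c(2) im_part_hermitian[OF M] x] by simp
qed

lemma Phi_re_nonneg:
  assumes M: "M \<in> carrier_mat n n" and nn: "\<And>y. y \<in> carrier_vec n \<Longrightarrow> 0 \<le> Re (ip y (M *\<^sub>v y))"
    and x: "x \<in> carrier_vec r"
  shows "0 \<le> Re (ip x (\<Phi> M *\<^sub>v x))"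
proof -
  have c: "re_part M \<in> carrier_mat n n" using M by (rule re_part_carrier)
  have "psd (re_part M)"
    unfolding psd_def qform_ip using re_part_hermitian[OF M] nn ip_re_im(1)[OF M] c by auto
  then have "psd (\<Phi> (re_part M))" by (rule Phi_psd[OF c])
  then show ?thesis unfolding Phi_re_part[OF M x] psd_def qform_ip using Phi_carrier[OF c] x by auto
qed

lemma Phi_inverse_ineq:
  assumes Z: "Z \<in> carrier_mat n n" "hermitian Z"
    and pos: "\<And>y. y \<in> carrier_vec n \<Longrightarrow> y \<noteq> 0\<^sub>v n \<Longrightarrow> 0 < Re (ip y (Z *\<^sub>v y))"
    and W: "W \<in> carrier_mat n n" "Z * W = 1\<^sub>m n"
    and x: "x \<in> carrier_vec r" and w: "w \<in> carrier_vec r"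
  shows "2 * Re (ip w x) - Re (ip w (\<Phi> Z *\<^sub>v w)) \<le> Re (ip x (\<Phi> W *\<^sub>v x))"
proof -
  obtain v :: "nat \<Rightarrow> complex Matrix.vec" and l :: "nat \<Rightarrow> real"
    where v: "\<And>i. i < n \<Longrightarrow> v i \<in> carrier_vec n" "\<And>i. i < n \<Longrightarrow> ip (v i) (v i) = 1"
    and Zv: "\<And>i. i < n \<Longrightarrow> Z *\<^sub>v v i = complex_of_real (l i) \<cdot>\<^sub>v v i"
    and one: "\<And>w x. w \<in> carrier_vec r \<Longrightarrow> x \<in> carrier_vec r \<Longrightarrow>
        ip w x = (\<Sum>i<n. ip w (\<Phi> (outer n (v i)) *\<^sub>v x))"
    and ZZ: "\<And>w x. w \<in> carrier_vec r \<Longrightarrow> x \<in> carrier_vec r \<Longrightarrow>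
        ip w (\<Phi> Z *\<^sub>v x) = (\<Sum>i<n. complex_of_real (l i) * ip w (\<Phi> (outer n (v i)) *\<^sub>v x))"
    and WW: "\<And>W w x. W \<in> carrier_mat n n \<Longrightarrow> Z * W = 1\<^sub>m n \<Longrightarrow> (\<And>i. i < n \<Longrightarrow> l i \<noteq> 0) \<Longrightarrow> w \<in> carrier_vec r \<Longrightarrow> x \<in> carrier_vec r \<Longrightarrow>
        ip w (\<Phi> W *\<^sub>v x) = (\<Sum>i<n. complex_of_real (1 / l i) * ip w (\<Phi> (outer n (v i)) *\<^sub>v x))"
    by (rule Phi_spectral[OF Z]) blast
  have l: "0 < l i" if "i < n" for i
  proof -
    have "v i \<noteq> 0\<^sub>v n" using v(2)[OF that] by (auto simp: ip_def)
    from pos[OF v(1)[OF that] this] show ?thesis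
      unfolding Zv[OF that] using v[OF that] by (simp add: ip_smult_right[of _ n])
  qed
  define q where "q = (\<lambda>i w x. ip w (\<Phi> (outer n (v i)) *\<^sub>v x))"
  have step: "2 * Re (q i w x) - l i * Re (q i w w) \<le> 1 / l i * Re (q i x x)" if i: "i < n" for i
  proof -
    define F where "F = \<Phi> (outer n (v i))"
    have F: "F \<in> carrier_mat r r" unfolding F_def by (rule Phi_carrier[OF outer_carrier])
    have psd: "psd F" unfolding F_def by (rule Phi_psd[OF outer_carrier psd_outer[OF v(1)[OF i]]])
    have herm: "hermitian F" using psd by (simp add: psd_def)
    define z where "z = x - complex_of_real (l i) \<cdot>\<^sub>v w"
    have z: "z \<in> carrier_vec r" using x w by (simp add: z_def)
    have Fx: "F *\<^sub>v x \<in> carrier_vec r" and Fw: "F *\<^sub>v w \<in> carrier_vec r" and lw: "complex_of_real (l i) \<cdot>\<^sub>v w \<in> carrier_vec r"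
      using F x w by auto
    have "F *\<^sub>v z = F *\<^sub>v x - complex_of_real (l i) \<cdot>\<^sub>v (F *\<^sub>v w)"
      unfolding z_def using F x w by (simp add: mult_minus_distrib_mat_vec[of _ r r] mat_vec_smult_right[of _ r r])
    moreover have "ip x (F *\<^sub>v w) = cnj (ip w (F *\<^sub>v x))"
      using ip_hermitian[OF F herm w x] cnj_ip[OF w Fx] by simp
    ultimately have "Re (ip z (F *\<^sub>v z)) = Re (ip x (F *\<^sub>v x)) - 2 * l i * Re (ip w (F *\<^sub>v x)) + (l i)\<^sup>2 * Re (ip w (F *\<^sub>v w))"
      using x w Fx Fw lw unfolding z_def
      by (simp add: ip_diff_left[of _ r] ip_diff_right[of _ r] ip_smult_left[of _ r] ip_smult_right[of _ r] power2_eq_square algebra_simps)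
    moreover have "0 \<le> Re (ip z (F *\<^sub>v z))" using psd z F unfolding psd_def qform_ip by auto
    ultimately have "0 \<le> Re (q i x x) - 2 * l i * Re (q i w x) + (l i)\<^sup>2 * Re (q i w w)"
      by (simp add: q_def F_def)
    then have "0 \<le> 1 / l i * (Re (q i x x) - 2 * l i * Re (q i w x) + (l i)\<^sup>2 * Re (q i w w))"
      using l[OF i] by simp
    also have "\<dots> = 1 / l i * Re (q i x x) - 2 * Re (q i w x) + l i * Re (q i w w)"
      using l[OF i] by (simp add: power2_eq_square field_simps)
    finally show ?thesis by simp
  qed
  have l0: "l i \<noteq> 0" if "i < n" for i using l[OF that] by simp
  have "2 * Re (ip w x) - Re (ip w (\<Phi> Z *\<^sub>v w)) = (\<Sum>i<n. 2 * Re (q i w x) - l i * Re (q i w w))"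
    unfolding one[OF w x] ZZ[OF w w] q_def by (simp add: sum_subtractf sum_distrib_left)
  also have "\<dots> \<le> (\<Sum>i<n. 1 / l i * Re (q i x x))" by (rule sum_mono) (use step in auto)
  also have "\<dots> = Re (ip x (\<Phi> W *\<^sub>v x))"
  proof -
    have "ip x (\<Phi> W *\<^sub>v x) = (\<Sum>i<n. complex_of_real (1 / l i) * ip x (\<Phi> (outer n (v i)) *\<^sub>v x))"
      by (rule WW[OF W l0 x x])
    then show ?thesis by (simp add: q_def)
  qed
  finally show ?thesis .
qed

lemma Phi_accretive:
  assumes A: "A \<in> carrier_mat n n"
    and pos: "\<And>y. y \<in> carrier_vec n \<Longrightarrow> y \<noteq> 0\<^sub>v n \<Longrightarrow> 0 < Re (ip y (A *\<^sub>v y))"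
    and x: "x \<in> carrier_vec r" "x \<noteq> 0\<^sub>v r"
  shows "0 < Re (ip x (\<Phi> A *\<^sub>v x))"
proof -
  have P: "re_part A \<in> carrier_mat n n" "hermitian (re_part A)"
    using A by (simp_all add: re_part_carrier re_part_hermitian)
  have Ppos: "0 < Re (ip y (re_part A *\<^sub>v y))" if "y \<in> carrier_vec n" "y \<noteq> 0\<^sub>v n" for y
    using pos[OF that] ip_re_im(1)[OF A that(1)] by simp
  obtain W where W: "W \<in> carrier_mat n n" "re_part A * W = 1\<^sub>m n"
    using inverse_matrix_exists[OF P(1)] accretive_injective[OF P(1) Ppos] by blast
  define a where "a = Re (ip x (\<Phi> (re_part A) *\<^sub>v x))"
  define b where "b = Re (ip x (\<Phi> W *\<^sub>v x))"
  define s where "s = Re (ip x x)"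
  have s: "0 < s" unfolding s_def by (rule ip_self_pos[OF x])
  have ineq: "2 * k * s - k\<^sup>2 * a \<le> b" for k
  proof -
    have "complex_of_real k \<cdot>\<^sub>v x \<in> carrier_vec r" using x by simp
    from Phi_inverse_ineq[OF P Ppos W x(1) this] show ?thesis
      using Phi_carrier[OF P(1)] x
      by (simp add: a_def b_def s_def mat_vec_smult_right[of _ r r] ip_smult_left[of _ r] ip_smult_right[of _ r] power2_eq_square algebra_simps)
  qed
  have "0 < a"
  proof (rule ccontr)
    assume "\<not> 0 < a"
    define k where "k = (\<bar>b\<bar> + 1) / s"
    have "k\<^sup>2 * a \<le> 0" using \<open>\<not> 0 < a\<close> by (simp add: mult_nonneg_nonpos)
    then have "2 * k * s \<le> b" using ineq[of k] by linarith
    then show False using s by (simp add: k_def)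
  qed
  then show ?thesis unfolding Phi_re_part[OF A x(1)] a_def .
qed

lemma resolvent_ineq:
  assumes A: "A \<in> carrier_mat n n"
    and pos: "\<And>x. x \<in> carrier_vec n \<Longrightarrow> x \<noteq> 0\<^sub>v n \<Longrightarrow> 0 < Re (ip x (A *\<^sub>v x))"
    and sec: "\<And>x. x \<in> carrier_vec n \<Longrightarrow> \<bar>Im (ip x (A *\<^sub>v x))\<bar> \<le> \<tau> * Re (ip x (A *\<^sub>v x))"
    and \<tau>: "0 \<le> \<tau>" and c: "c * (1 + \<tau>\<^sup>2) = 1" and t: "0 < t"
    and R: "R \<in> carrier_mat n n" "(A + complex_of_real t \<cdot>\<^sub>m 1\<^sub>m n) * R = 1\<^sub>m n"
    and R': "R' \<in> carrier_mat r r" "(\<Phi> A + complex_of_real t \<cdot>\<^sub>m 1\<^sub>m r) * R' = 1\<^sub>m r"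
    and x: "x \<in> carrier_vec r"
  shows "c * Re (ip x (\<Phi> (A * R) *\<^sub>v x)) \<le> Re (ip x (\<Phi> A *\<^sub>v (R' *\<^sub>v x)))"
proof -
  define Z where "Z = re_part A + complex_of_real t \<cdot>\<^sub>m 1\<^sub>m n"
  have P: "re_part A \<in> carrier_mat n n" "hermitian (re_part A)"
    using A by (simp_all add: re_part_carrier re_part_hermitian)
  have Z: "Z \<in> carrier_mat n n" using P by (simp add: Z_def)
  have Zh: "hermitian Z"
  proof -
    have "adj Z = Z"
      unfolding Z_def adj_def by (rule eq_matI) (use P hermitian_entry[OF P(2,1)] in auto)
    then show ?thesis using Z by (simp add: hermitian_def)
  qed
  have Ppos: "0 < Re (ip y (re_part A *\<^sub>v y))" if "y \<in> carrier_vec n" "y \<noteq> 0\<^sub>v n" for y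
    using pos[OF that] ip_re_im(1)[OF A that(1)] by simp
  have Zpos: "0 < Re (ip y (Z *\<^sub>v y))" if "y \<in> carrier_vec n" "y \<noteq> 0\<^sub>v n" for y
    unfolding Z_def using accretive_shift_pos[OF P(1) Ppos _ that] t by simp
  obtain W where W: "W \<in> carrier_mat n n" "Z * W = 1\<^sub>m n"
    using inverse_matrix_exists[OF Z] accretive_injective[OF Z Zpos] by blast
  have \<Phi>A: "\<Phi> A \<in> carrier_mat r r" by (rule Phi_carrier[OF A])
  define w where "w = R' *\<^sub>v x"
  have w: "w \<in> carrier_vec r" using R' x by (simp add: w_def)
  have xw: "x = \<Phi> A *\<^sub>v w + complex_of_real t \<cdot>\<^sub>v w"
  proof -
    have "(\<Phi> A + complex_of_real t \<cdot>\<^sub>m 1\<^sub>m r) *\<^sub>v w = ((\<Phi> A + complex_of_real t \<cdot>\<^sub>m 1\<^sub>m r) * R') *\<^sub>v x"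
      unfolding w_def using \<Phi>A R' x by (intro assoc_mult_mat_vec[symmetric, of _ r r _ r]) auto
    then show ?thesis using shift_mult_vec[OF \<Phi>A w] x R'(2) by simp
  qed
  have \<Phi>Aw: "\<Phi> A *\<^sub>v w \<in> carrier_vec r" using \<Phi>A w by simp
  have wx: "ip w x = ip w (\<Phi> A *\<^sub>v w) + t * ip w w"
    by (subst xw) (use w \<Phi>Aw in \<open>simp add: ip_add_right[of _ r] ip_smult_right[of _ r]\<close>)
  have "ip w (\<Phi> Z *\<^sub>v w) = ip w (\<Phi> (re_part A) *\<^sub>v w) + t * ip w w"
    unfolding Z_def using P w by (simp add: ip_Phi_add ip_Phi_smult Phi_one)
  then have ZA: "Re (ip w (\<Phi> Z *\<^sub>v w)) = Re (ip w x)"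
    unfolding wx using Phi_re_part[OF A w] by simp
  have c1: "Re (ip w x) \<le> Re (ip x (\<Phi> W *\<^sub>v x))"
    using Phi_inverse_ineq[OF Z Zh Zpos W x w] unfolding ZA by simp
  have AR: "A * R \<in> carrier_mat n n" using A R by simp
  define M where "M = 1\<^sub>m n + complex_of_real (- t) \<cdot>\<^sub>m W + complex_of_real (- c) \<cdot>\<^sub>m (A * R)"
  have M: "M \<in> carrier_mat n n" using W AR by (simp add: M_def)
  have "0 \<le> Re (ip x (\<Phi> M *\<^sub>v x))"
  proof (rule Phi_re_nonneg[OF M _ x])
    fix y :: "complex Matrix.vec" assume y: "y \<in> carrier_vec n"
    have "ip y (M *\<^sub>v y) = ip y y - t * ip y (W *\<^sub>v y) - c * ip y (A * R *\<^sub>v y)"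
      unfolding M_def using y W AR
      by (simp add: ip_add_mat[of _ n n] ip_smult_mat[of _ n n] del: of_real_minus) simp
    also have "A * R *\<^sub>v y = A *\<^sub>v (R *\<^sub>v y)" by (rule assoc_mult_mat_vec[OF A R(1) y])
    finally show "0 \<le> Re (ip y (M *\<^sub>v y))"
      using accretive_cos_bound[OF A pos sec \<tau> c t R W(1) W(2)[unfolded Z_def] y] by simp
  qed
  also have "ip x (\<Phi> M *\<^sub>v x) = ip x x - t * ip x (\<Phi> W *\<^sub>v x) - c * ip x (\<Phi> (A * R) *\<^sub>v x)"
    unfolding M_def using x W AR
    by (simp add: ip_Phi_add ip_Phi_smult Phi_one del: of_real_minus) simp
  finally have "c * Re (ip x (\<Phi> (A * R) *\<^sub>v x)) \<le> Re (ip x x) - t * Re (ip x (\<Phi> W *\<^sub>v x))" by simp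
  also have "\<dots> \<le> Re (ip x x) - t * Re (ip w x)" using c1 t by simp
  also have "Re (ip x x) - t * Re (ip w x) = Re (ip x (\<Phi> A *\<^sub>v w))"
  proof -
    have "ip x x = ip x (\<Phi> A *\<^sub>v w) + t * ip x w"
      by (subst (2) xw) (use x w \<Phi>Aw in \<open>simp add: ip_add_right[of _ r] ip_smult_right[of _ r]\<close>)
    moreover have "ip x w = cnj (ip w x)" using cnj_ip[OF w x] by simp
    ultimately show ?thesis by simp
  qed
  finally show ?thesis by (simp add: w_def)
qed

end

section \<open>Rational resolvents and the inequality\<close>

lemma resolvent_inverse:
  assumes X: "X \<in> carrier_mat n n" and z: "\<not> eigenvalue X z"
  shows "resolvent X z \<in> carrier_mat n n" "(z \<cdot>\<^sub>m 1\<^sub>m n - X) * resolvent X z = 1\<^sub>m n"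
proof -
  let ?Y = "z \<cdot>\<^sub>m 1\<^sub>m n - X"
  have Y: "?Y \<in> carrier_mat n n" using X by (intro minus_carrier_mat)
  obtain R where R: "R \<in> carrier_mat n n" "?Y * R = 1\<^sub>m n"
  proof (rule inverse_matrix_exists[OF Y])
    fix v :: "complex Matrix.vec" assume v: "v \<in> carrier_vec n" "?Y *\<^sub>v v = 0\<^sub>v n"
    have "?Y *\<^sub>v v = z \<cdot>\<^sub>v v - X *\<^sub>v v"
      using X v by (simp add: minus_mult_distrib_mat_vec[of _ n n] smult_mat_vec[of _ n n])
    then have "z \<cdot>\<^sub>v v - X *\<^sub>v v = 0\<^sub>v n" using v by simp
    then have "X *\<^sub>v v = z \<cdot>\<^sub>v v"
    proof -
      assume *: "z \<cdot>\<^sub>v v - X *\<^sub>v v = 0\<^sub>v n"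
      show ?thesis
      proof (rule eq_vecI)
        fix i assume "i < dim_vec (z \<cdot>\<^sub>v v)"
        then have i: "i < n" using v by simp
        have "(z \<cdot>\<^sub>v v - X *\<^sub>v v) $ i = 0" using * i by simp
        then show "(X *\<^sub>v v) $ i = (z \<cdot>\<^sub>v v) $ i" using i X v by simp
      qed (use X v in simp)
    qed
    then show "v = 0\<^sub>v n" using z v X unfolding eigenvalue_def eigenvector_def by auto
  qed
  have "resolvent X z = R" by (rule resolvent_eqI[OF X R])
  then show "resolvent X z \<in> carrier_mat n n" "?Y * resolvent X z = 1\<^sub>m n" using R by simp_all
qed

lemma resolvent_identity:
  assumes X: "X \<in> carrier_mat n n" and z: "\<not> eigenvalue X z"
  shows "z \<cdot>\<^sub>m resolvent X z = 1\<^sub>m n + X * resolvent X z"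
proof -
  note R = resolvent_inverse[OF X z]
  have "z \<cdot>\<^sub>m resolvent X z - X * resolvent X z = 1\<^sub>m n"
    using R X by (simp add: minus_mult_distrib_mat[of _ n n] mult_smult_assoc_mat[of _ n n])
  then have *: "(z \<cdot>\<^sub>m resolvent X z - X * resolvent X z) $$ (i,j) = 1\<^sub>m n $$ (i,j)" for i j by simp
  show ?thesis
  proof (rule eq_matI)
    fix i j assume "i < dim_row (1\<^sub>m n + X * resolvent X z)" "j < dim_col (1\<^sub>m n + X * resolvent X z)"
    then have ij: "i < n" "j < n" using X R by auto
    then show "(z \<cdot>\<^sub>m resolvent X z) $$ (i,j) = (1\<^sub>m n + X * resolvent X z) $$ (i,j)"
      using *[of i j] X R(1) by (auto simp: algebra_simps)
  qed (use X R in auto)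
qed

lemma resolvent_rational:
  fixes X :: "complex mat" and k :: "nat \<Rightarrow> nat \<Rightarrow> complex"
  assumes X: "X \<in> carrier_mat n n" and n: "0 < n"
  obtains p where "degree p < n"
    "\<And>z. \<not> eigenvalue X z \<Longrightarrow> (\<Sum>i<n. \<Sum>j<n. k i j * resolvent X z $$ (i,j)) = poly p z / poly (char_poly X) z"
proof -
  let ?C = "char_poly_matrix X"
  have C: "?C \<in> carrier_mat n n" using X by simp
  have deg1: "degree (?C $$ (i,j)) \<le> 1" if "i < n" "j < n" for i j
    using that X by (auto simp: char_poly_matrix_def intro!: degree_add_le)
  have deg: "degree (adj_mat ?C $$ (i,j)) \<le> n - 1" if ij: "i < n" "j < n" for i j
  proof -
    have "degree (det (mat_delete ?C j i)) \<le> 1 * (n - 1)"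
    proof (rule degree_det_le)
      show "mat_delete ?C j i \<in> carrier_mat (n - 1) (n - 1)" by (rule mat_delete_carrier[OF C])
      fix a b assume "a < n - 1" "b < n - 1"
      then show "degree (mat_delete ?C j i $$ (a,b)) \<le> 1"
        using C by (auto simp: mat_delete_def intro!: deg1[unfolded One_nat_def])
    qed
    moreover have "adj_mat ?C $$ (i,j) = (- 1) ^ (j + i) * det (mat_delete ?C j i)"
      using ij C by (simp add: adj_mat_def cofactor_def)
    moreover have "degree ((- 1) ^ (j + i) * det (mat_delete ?C j i)) = degree (det (mat_delete ?C j i))"
      by (cases "even (j + i)") auto
    ultimately show ?thesis by simp
  qed
  define p where "p = (\<Sum>i<n. \<Sum>j<n. Polynomial.smult (k i j) (adj_mat ?C $$ (i,j)))"
  have "degree p \<le> n - 1" unfolding p_def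
    by (intro degree_sum_le) (auto intro!: degree_sum_le order_trans[OF degree_smult_le] deg[unfolded One_nat_def])
  then have "degree p < n" using n by simp
  moreover have "(\<Sum>i<n. \<Sum>j<n. k i j * resolvent X z $$ (i,j)) = poly p z / poly (char_poly X) z"
    if "\<not> eigenvalue X z" for z
    unfolding resolvent_adj_mat[OF X that] p_def
    by (simp add: poly_sum sum_divide_distrib)
  ultimately show thesis by (rule that)
qed

lemma resolvent_functional_rational:
  fixes L :: "complex mat \<Rightarrow> complex"
  assumes X: "X \<in> carrier_mat n n" and n: "0 < n"
    and "\<And>A B. A \<in> carrier_mat n n \<Longrightarrow> B \<in> carrier_mat n n \<Longrightarrow> L (A + B) = L A + L B"
    and "\<And>c A. A \<in> carrier_mat n n \<Longrightarrow> L (c \<cdot>\<^sub>m A) = c * L A"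
  obtains p where "degree p < n"
    "\<And>z. \<not> eigenvalue X z \<Longrightarrow> L (resolvent X z) = poly p z / poly (char_poly X) z"
proof -
  obtain \<kappa> where \<kappa>: "\<And>M. M \<in> carrier_mat n n \<Longrightarrow> L M = (\<Sum>i<n. \<Sum>j<n. \<kappa> i j * M $$ (i,j))"
    by (rule linear_functional_coeffs[of n L]) (use assms in auto)
  obtain p where "degree p < n"
    "\<And>z. \<not> eigenvalue X z \<Longrightarrow> (\<Sum>i<n. \<Sum>j<n. \<kappa> i j * resolvent X z $$ (i,j)) = poly p z / poly (char_poly X) z"
    by (rule resolvent_rational[OF X n, of \<kappa>]) blast
  then show thesis using \<kappa>[OF resolvent_inverse(1)[OF X]] by (intro that[of p]) auto
qed

lemma resolvent_functional_cint:
  fixes L :: "complex mat \<Rightarrow> complex"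
  assumes X: "X \<in> carrier_mat n n" and f: "f holomorphic_on slitD" and rc: "0 < r" "r < c"
    and ev: "{e. eigenvalue X e} \<subseteq> disc c r"
    and add: "\<And>A B. A \<in> carrier_mat n n \<Longrightarrow> B \<in> carrier_mat n n \<Longrightarrow> L (A + B) = L A + L B"
    and smult: "\<And>c A. A \<in> carrier_mat n n \<Longrightarrow> L (c \<cdot>\<^sub>m A) = c * L A"
  shows "L (mfun f X) = cint c r (\<lambda>z. f z * L (resolvent X z))"
    "continuous_on (circ c r) (\<lambda>z. L (resolvent X z))"
proof -
  obtain \<kappa> where \<kappa>: "\<And>M. M \<in> carrier_mat n n \<Longrightarrow> L M = (\<Sum>i<n. \<Sum>j<n. \<kappa> i j * M $$ (i,j))"
    by (rule linear_functional_coeffs[of n L]) (use add smult in auto)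
  have ne: "\<not> eigenvalue X z" if "z \<in> circ c r" for z
    using ev that by auto
  have mc: "mfun f X \<in> carrier_mat n n" unfolding mfun_eq_cint[OF X f rc ev] by simp
  show "L (mfun f X) = cint c r (\<lambda>z. f z * L (resolvent X z))"
    unfolding \<kappa>[OF mc] mfun_functional[OF X f rc ev]
    by (rule cint_cong[OF _ rc(1)]) (simp add: \<kappa> resolvent_inverse(1)[OF X ne])
  have "continuous_on (circ c r) (\<lambda>z. \<Sum>i<n. \<Sum>j<n. \<kappa> i j * resolvent X z $$ (i,j))"
    using ne by (intro continuous_intros holomorphic_continuous_sphere[OF resolvent_holomorphic[OF X]]) auto
  then show "continuous_on (circ c r) (\<lambda>z. L (resolvent X z))"
    by (rule continuous_on_eq) (simp add: \<kappa> resolvent_inverse(1)[OF X ne])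
qed

lemma accretive_eigenvalue:
  assumes X: "X \<in> carrier_mat n n" and pos: "\<And>x. x \<in> carrier_vec n \<Longrightarrow> x \<noteq> 0\<^sub>v n \<Longrightarrow> 0 < Re (ip x (X *\<^sub>v x))"
    and "eigenvalue X e"
  shows "0 < Re e"
proof -
  obtain v where v: "v \<in> carrier_vec n" "v \<noteq> 0\<^sub>v n" "X *\<^sub>v v = e \<cdot>\<^sub>v v"
    using assms(3) X unfolding eigenvalue_def eigenvector_def by auto
  have "ip v (X *\<^sub>v v) = e * complex_of_real (Re (ip v v))"
    unfolding v(3) using v by (simp add: ip_smult_right[of _ n] ip_self)
  then have "Re (ip v (X *\<^sub>v v)) = Re e * Re (ip v v)" by simp
  then show ?thesis using pos[OF v(1,2)] ip_self_pos[OF v(1,2)] by (simp add: zero_less_mult_iff)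
qed

lemma ip_mult_add:
  assumes "X \<in> carrier_mat n n" "A \<in> carrier_mat n n" "B \<in> carrier_mat n n" "x \<in> carrier_vec n"
  shows "ip x (X *\<^sub>v ((A + B) *\<^sub>v x)) = ip x (X *\<^sub>v (A *\<^sub>v x)) + ip x (X *\<^sub>v (B *\<^sub>v x))"
  using assms by (simp add: add_mult_distrib_mat_vec[of _ n n] mult_add_distrib_mat_vec[of _ n n] ip_add_right[of _ n])

lemma ip_mult_smult:
  assumes "X \<in> carrier_mat n n" "A \<in> carrier_mat n n" "x \<in> carrier_vec n"
  shows "ip x (X *\<^sub>v ((k \<cdot>\<^sub>m A) *\<^sub>v x)) = k * ip x (X *\<^sub>v (A *\<^sub>v x))"
  using assms by (simp add: smult_mat_vec[of _ n n] mat_vec_smult_right[of _ n n] ip_smult_right[of _ n])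

lemma neg_resolvent_shift:
  assumes X: "X \<in> carrier_mat n n" and t: "\<not> eigenvalue X (complex_of_real (- t))"
  defines "R \<equiv> (- 1) \<cdot>\<^sub>m resolvent X (complex_of_real (- t))"
  shows "R \<in> carrier_mat n n" "(X + complex_of_real t \<cdot>\<^sub>m 1\<^sub>m n) * R = 1\<^sub>m n" "resolvent X (complex_of_real (- t)) = (- 1) \<cdot>\<^sub>m R"
proof -
  note S = resolvent_inverse[OF X t]
  show "R \<in> carrier_mat n n" using S(1) by (simp add: R_def)
  have "(X + complex_of_real t \<cdot>\<^sub>m 1\<^sub>m n) * R
     = (- 1) \<cdot>\<^sub>m ((X + complex_of_real t \<cdot>\<^sub>m 1\<^sub>m n) * resolvent X (complex_of_real (- t)))"
    unfolding R_def by (rule mult_smult_distrib[of _ n n _ n]) (use X S in auto)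
  also have "\<dots> = ((- 1) \<cdot>\<^sub>m (X + complex_of_real t \<cdot>\<^sub>m 1\<^sub>m n)) * resolvent X (complex_of_real (- t))"
    by (rule mult_smult_assoc_mat[symmetric, of _ n n _ n]) (use X S in auto)
  also have "(- 1) \<cdot>\<^sub>m (X + complex_of_real t \<cdot>\<^sub>m 1\<^sub>m n) = complex_of_real (- t) \<cdot>\<^sub>m 1\<^sub>m n - X"
    by (rule eq_matI) (use X in auto)
  finally show "(X + complex_of_real t \<cdot>\<^sub>m 1\<^sub>m n) * R = 1\<^sub>m n" using S by simp
  show "resolvent X (complex_of_real (- t)) = (- 1) \<cdot>\<^sub>m R"
    unfolding R_def by (rule eq_matI) auto
qed

text \<open>On the circle \<open>z s(z) = c + s\<^sub>1(z)\<close> with \<open>s\<^sub>1\<close> strictly proper rational, and the constant is killed by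
  Cauchy's theorem; so the sign of \<open>s\<^sub>1\<close> on the negative half-axis decides the sign of the integral.\<close>

lemma cint_stieltjes_nonneg:
  assumes f: "matrix_monotone_class f" and rc: "0 < r" "r < c"
    and ws: "set ws \<subseteq> disc c r" and e: "e = (\<Prod>w\<leftarrow>ws. [:- w, 1:])"
    and q: "degree q < length ws"
    and neg: "\<And>t. 0 < t \<Longrightarrow> Re (poly q (complex_of_real (- t)) / poly e (complex_of_real (- t))) \<le> 0"
    and sc: "continuous_on (circ c r) s"
    and zs: "\<And>z. z \<in> circ c r \<Longrightarrow> z * s z = a + poly q z / poly e z"
  shows "0 \<le> Re (cint c r (\<lambda>z. f z * s z))"
proof -
  let ?S = "circ c r"
  define s1 where "s1 = (\<lambda>z. poly q z / poly e z)"
  have Re0: "0 < Re z" if "z \<in> ?S" for z using Re_pos_cball[OF rc(2)] sphere_cball that by blast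
  have z0: "z \<noteq> 0" if "z \<in> ?S" for z using Re0[OF that] by auto
  have e0: "poly e z = 0 \<longleftrightarrow> z \<in> set ws" for z unfolding e by (rule poly_linear_factors_eq_0)
  have eS: "poly e z \<noteq> 0" "poly e (cnj z) \<noteq> 0" if "z \<in> ?S" for z
  proof -
    have "cnj z \<in> ?S" using that cnj_mem_sphere by blast
    then show "poly e z \<noteq> 0" "poly e (cnj z) \<noteq> 0" using that ws unfolding e0 by auto
  qed
  have fc: "continuous_on ?S f" by (rule mm_continuous[OF f rc(2)])
  have s1c: "continuous_on ?S s1" unfolding s1_def
    by (intro continuous_intros) (use eS in auto)
  have r1c: "continuous_on ?S (reflect s1)" by (rule continuous_on_reflect[OF s1c])
  have fzc: "continuous_on ?S (\<lambda>z. f z / z)" by (intro continuous_intros fc) (use z0 in auto)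
  have fz0: "cint c r (\<lambda>z. f z / z) = 0"
  proof (rule cint_holomorphic[OF _ rc(1)])
    have "z \<noteq> 0" if "z \<in> cball (complex_of_real c) r" for z
      using Re_pos_cball[OF rc(2) that] by auto
    then show "(\<lambda>z. f z / z) holomorphic_on cball (complex_of_real c) r"
      by (intro holomorphic_intros holomorphic_on_subset[OF mm_holomorphic[OF f] cball_subset_slitD[OF rc(2)]]) auto
  qed
  have "cint c r (\<lambda>z. f z * s z) = cint c r (\<lambda>z. a * (f z / z) + f z / z * s1 z)"
  proof (rule cint_cong[OF _ rc(1)])
    fix z assume z: "z \<in> ?S"
    have "f z * s z = f z / z * (z * s z)" using z0[OF z] by simp
    also have "\<dots> = f z / z * (a + s1 z)" unfolding zs[OF z] s1_def ..
    finally show "f z * s z = a * (f z / z) + f z / z * s1 z" by (simp add: algebra_simps add_divide_distrib)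
  qed
  also have "\<dots> = a * cint c r (\<lambda>z. f z / z) + cint c r (\<lambda>z. f z / z * s1 z)"
    unfolding cint_cmult[OF fzc rc(1), symmetric]
    by (rule cint_add[OF continuous_on_mult_left[OF fzc] continuous_on_mult[OF fzc s1c] rc(1)])
  finally have T: "cint c r (\<lambda>z. f z * s z) = cint c r (\<lambda>z. f z / z * s1 z)" using fz0 by simp
  define N where "N = - (q * map_poly cnj e + map_poly cnj q * e)"
  have degs: "degree e = length ws" unfolding e by (simp add: degree_linear_factors)
  have "degree N \<le> degree q + degree e"
    unfolding N_def degree_minus
    by (intro degree_add_le order_trans[OF degree_mult_le]) (auto intro: add_mono degree_map_poly_le)
  then have degN: "degree N < 2 * length ws" using q degs by simp
  have "sq_cone (degree N) (poly N)"
  proof (rule sq_cone_poly[of "{}"])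
    fix t :: real assume t: "0 < t"
    let ?z = "complex_of_real (- t)"
    have "poly e ?z \<noteq> 0" using ws t Re_pos_cball[OF rc(2)] ball_subset_cball unfolding e0 by fastforce
    then have qe: "poly q ?z = s1 ?z * poly e ?z" by (simp add: s1_def)
    have "poly N ?z = - (poly q ?z * cnj (poly e ?z) + cnj (poly q ?z * cnj (poly e ?z)))"
      unfolding N_def by simp
    also have "poly q ?z * cnj (poly e ?z) = s1 ?z * complex_of_real ((cmod (poly e ?z))\<^sup>2)"
      unfolding qe complex_norm_square by simp
    finally have "poly N ?z = complex_of_real (- 2 * Re (s1 ?z) * (cmod (poly e ?z))\<^sup>2)"
      by (simp add: complex_eq_iff del: of_real_power)
    moreover have "0 \<le> - 2 * Re (s1 ?z) * (cmod (poly e ?z))\<^sup>2"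
      using neg[OF t] by (intro mult_nonneg_nonneg[of "- 2 * Re (s1 ?z)"]) (simp_all add: s1_def)
    ultimately show "poly N ?z \<in> \<real>\<^sub>\<ge>\<^sub>0" by (simp only: nonneg_Reals_of_real_iff)
  qed simp
  from cint_sq_cone[OF f rc ws this degN refl]
  have "Re (cint c r (\<lambda>z. f z / z * (poly N z / (poly e z * reflect (poly e) z)))) \<le> 0"
    by (simp add: e)
  also have "cint c r (\<lambda>z. f z / z * (poly N z / (poly e z * reflect (poly e) z)))
    = cint c r (\<lambda>z. - (f z / z * s1 z + reflect (\<lambda>z. f z / z * s1 z) z))"
  proof (rule cint_cong[OF _ rc(1)])
    fix z assume z: "z \<in> ?S"
    have "cnj (f (cnj z)) = f z" using mm_reflect[OF f Re0[OF z]] by (simp add: reflect_def)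
    then have sym: "reflect (\<lambda>z. f z / z * s1 z) z = f z / z * reflect s1 z" by (simp add: reflect_def)
    have quot: "poly N z / (poly e z * reflect (poly e) z) = - (s1 z + reflect s1 z)"
      using eS[OF z] by (simp add: N_def s1_def reflect_def field_simps)
    show "f z / z * (poly N z / (poly e z * reflect (poly e) z)) = - (f z / z * s1 z + reflect (\<lambda>z. f z / z * s1 z) z)"
      unfolding sym quot by (simp only: distrib_left mult_minus_right)
  qed
  also have "\<dots> = - (cint c r (\<lambda>z. f z / z * s1 z) + cnj (cint c r (\<lambda>z. f z / z * s1 z)))"
    unfolding cint_uminus cint_reflect[OF rc(1), symmetric]
    by (simp only: cint_add[OF continuous_on_mult[OF fzc s1c] continuous_on_reflect[OF continuous_on_mult[OF fzc s1c]] rc(1)])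
  finally show ?thesis unfolding T by simp
qed

lemma hermitianI: "M \<in> carrier_mat n n \<Longrightarrow> adj M = M \<Longrightarrow> hermitian M"
  using carrier_matD(1)[of M n n] by (simp add: hermitian_def)

lemma qform_re_part:
  "A \<in> carrier_mat n n \<Longrightarrow> x \<in> carrier_vec n \<Longrightarrow> Re (qform (re_part A) x) = Re (qform A x)"
  by (simp add: qform_ip ip_re_im(1))

lemma numerical_range_sector:
  assumes A: "A \<in> carrier_mat n n" and W: "numerical_range A \<subseteq> sector \<alpha>" and x: "x \<in> carrier_vec n"
  shows "\<bar>Im (ip x (A *\<^sub>v x))\<bar> \<le> tan \<alpha> * Re (ip x (A *\<^sub>v x))"
proof (cases "x = 0\<^sub>v n")
  case True
  then show ?thesis using A by (simp add: ip_def)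
next
  case False
  define s where "s = Re (ip x x)"
  have s: "0 < s" "ip x x = complex_of_real s" using ip_self_pos[OF x False] by (simp_all add: s_def ip_self)
  define q where "q = 1 / sqrt s"
  have q: "q * (q * s) = 1" "0 < q" using s(1) by (simp_all add: q_def)
  define y where "y = complex_of_real q \<cdot>\<^sub>v x"
  have y: "y \<in> carrier_vec n" using x by (simp add: y_def)
  have "ip y y = complex_of_real (q * (q * s))"
    unfolding y_def using x s by (simp add: ip_smult_left[of _ n] ip_smult_right[of _ n])
  then have "(\<Sum>i<dim_vec y. (cmod (y $ i))\<^sup>2) = 1" unfolding q(1) ip_self by (rule of_real_eq_iff[THEN iffD1])
  then have "qform A y \<in> numerical_range A" unfolding numerical_range_def using y A by auto
  then have "qform A y \<in> sector \<alpha>" using W by blast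
  moreover have "qform A y = complex_of_real (q * q) * ip x (A *\<^sub>v x)"
    unfolding qform_ip y_def using A x
    by (simp add: mat_vec_smult_right[of _ n n] ip_smult_left[of _ n] ip_smult_right[of _ n])
  ultimately have "\<bar>q * q * Im (ip x (A *\<^sub>v x))\<bar> \<le> tan \<alpha> * (q * q * Re (ip x (A *\<^sub>v x)))"
    unfolding sector_def by (simp del: of_real_mult)
  then have "q * q * \<bar>Im (ip x (A *\<^sub>v x))\<bar> \<le> q * q * (tan \<alpha> * Re (ip x (A *\<^sub>v x)))"
    by (simp add: abs_mult mult_ac)
  then show ?thesis using q(2) by simp
qed

theorem mainTheorem15:
  fixes f :: "complex \<Rightarrow> complex" and \<Phi> :: "complex mat \<Rightarrow> complex mat"
    and A :: "complex mat" and n r :: nat and \<alpha> :: real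
  assumes "matrix_monotone_class f"
    and "positive_linear_map n r \<Phi>" and "unital n r \<Phi>"
    and "A \<in> carrier_mat n n" and "accretive A"
    and "0 \<le> \<alpha>" and "\<alpha> < pi / 2"
    and "numerical_range A \<subseteq> sector \<alpha>"
  shows "loewner_le ((cos \<alpha>)\<^sup>2 \<cdot>\<^sub>m re_part (\<Phi> (mfun f A))) (re_part (mfun f (\<Phi> A)))"
proof -
  note f = assms(1) and Phi = assms(2,3) and A = assms(4)
  define \<gamma> where "\<gamma> = (cos \<alpha>)\<^sup>2"
  have B: "\<Phi> A \<in> carrier_mat r r" by (rule Phi_carrier[OF Phi A])
  have FA: "mfun f A \<in> carrier_mat n n" and FB: "mfun f (\<Phi> A) \<in> carrier_mat r r"
    using A B by (auto simp: mfun_def Let_def)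
  have PF: "\<Phi> (mfun f A) \<in> carrier_mat r r" by (rule Phi_carrier[OF Phi FA])
  have cosp: "0 < cos \<alpha>" using assms(6,7) by (intro cos_gt_zero_pi) auto
  have tan0: "0 \<le> tan \<alpha>" using assms(6,7) by (cases "\<alpha> = 0") (auto intro!: less_imp_le tan_gt_zero)
  have \<gamma>: "\<gamma> * (1 + (tan \<alpha>)\<^sup>2) = 1"
    using cosp tan_sec[of \<alpha>] by (simp add: \<gamma>_def power_inverse)
  have posA: "0 < Re (ip x (A *\<^sub>v x))" if "x \<in> carrier_vec n" "x \<noteq> 0\<^sub>v n" for x
    using assms(5) that A re_part_carrier[OF A] ip_re_im(1)[OF A that(1)]
    unfolding accretive_def pd_def qform_ip by auto
  have posB: "0 < Re (ip x (\<Phi> A *\<^sub>v x))" if "x \<in> carrier_vec r" "x \<noteq> 0\<^sub>v r" for x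
    by (rule Phi_accretive[OF Phi A posA that])
  have main: "\<gamma> * Re (ip x (\<Phi> (mfun f A) *\<^sub>v x)) \<le> Re (ip x (mfun f (\<Phi> A) *\<^sub>v x))"
    if x: "x \<in> carrier_vec r" for x
  proof (cases "r = 0")
    case True
    then show ?thesis using x by (simp add: ip_def)
  next
    case False
    then have r0: "0 < r" by simp
    have n0: "0 < n"
    proof (rule ccontr)
      assume "\<not> 0 < n"
      then have "(1\<^sub>m n :: complex mat) = 0 \<cdot>\<^sub>m 1\<^sub>m n" by (intro eq_matI) auto
      then have "(1\<^sub>m r :: complex mat) = 0 \<cdot>\<^sub>m 1\<^sub>m r"
        using Phi_one[OF Phi] Phi_smult[OF Phi, of "1\<^sub>m n" 0] by (metis one_carrier_mat)
      then have "(1\<^sub>m r :: complex mat) $$ (0,0) = (0 \<cdot>\<^sub>m 1\<^sub>m r) $$ (0,0)" by simp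
      then show False using r0 by simp
    qed
    obtain es1 where es1: "char_poly A = (\<Prod>w\<leftarrow>es1. [:- w, 1:])" "length es1 = n"
      using char_poly_factorized[OF A] by auto
    obtain es2 where es2: "char_poly (\<Phi> A) = (\<Prod>w\<leftarrow>es2. [:- w, 1:])" "length es2 = r"
      using char_poly_factorized[OF B] by auto
    have set1: "set es1 = {e. eigenvalue A e}"
      using eigenvalue_root_char_poly[OF A] poly_linear_factors_eq_0[of es1] es1(1) by auto
    have set2: "set es2 = {e. eigenvalue (\<Phi> A) e}"
      using eigenvalue_root_char_poly[OF B] poly_linear_factors_eq_0[of es2] es2(1) by auto
    define ws where "ws = es1 @ es2"
    have pw: "0 < Re w" if "w \<in> set ws" for w
      using that accretive_eigenvalue[OF A posA] accretive_eigenvalue[OF B posB]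
      unfolding ws_def set_append set1 set2 by blast
    obtain c \<rho> where rc: "0 < \<rho>" "\<rho> < c" and ws: "set ws \<subseteq> ball (complex_of_real c) \<rho>"
      by (rule enclosing_disc[OF finite_set pw])
    let ?S = "sphere (complex_of_real c) \<rho>"
    have evA: "{e. eigenvalue A e} \<subseteq> ball (complex_of_real c) \<rho>"
      and evB: "{e. eigenvalue (\<Phi> A) e} \<subseteq> ball (complex_of_real c) \<rho>"
      using ws unfolding ws_def set_append set1 set2 by blast+
    have neS: "\<not> eigenvalue A z" "\<not> eigenvalue (\<Phi> A) z" if "z \<in> ?S" for z
      using that evA evB by auto
    have neN: "\<not> eigenvalue A (complex_of_real (- t))" "\<not> eigenvalue (\<Phi> A) (complex_of_real (- t))" if "0 < t" for t
      using accretive_eigenvalue[OF A posA, of "complex_of_real (- t)"]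
        accretive_eigenvalue[OF B posB, of "complex_of_real (- t)"] that by auto
    have fh: "f holomorphic_on slitD" by (rule mm_holomorphic[OF f])
    have intA: "ip x (\<Phi> (mfun f A) *\<^sub>v x) = cint c \<rho> (\<lambda>z. f z * ip x (\<Phi> (resolvent A z) *\<^sub>v x))
      \<and> continuous_on ?S (\<lambda>z. ip x (\<Phi> (resolvent A z) *\<^sub>v x))"
      by (rule conjI; rule resolvent_functional_cint[where L = "\<lambda>M. ip x (\<Phi> M *\<^sub>v x)", OF A fh rc evA])
         (simp_all add: ip_Phi_add[OF Phi x x] ip_Phi_smult[OF Phi x x])
    have intB: "ip x (mfun f (\<Phi> A) *\<^sub>v x) = cint c \<rho> (\<lambda>z. f z * ip x (resolvent (\<Phi> A) z *\<^sub>v x))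
      \<and> continuous_on ?S (\<lambda>z. ip x (resolvent (\<Phi> A) z *\<^sub>v x))"
      by (rule conjI; rule resolvent_functional_cint[where L = "\<lambda>M. ip x (M *\<^sub>v x)", OF B fh rc evB])
         (simp_all add: ip_add_mat[OF _ _ x x] ip_smult_mat[OF _ x x])
    note intA = intA[THEN conjunct1] intA[THEN conjunct2] and intB = intB[THEN conjunct1] intB[THEN conjunct2]
    define s where "s = (\<lambda>z. ip x (resolvent (\<Phi> A) z *\<^sub>v x) - \<gamma> * ip x (\<Phi> (resolvent A z) *\<^sub>v x))"
    have AM: "A * M \<in> carrier_mat n n" if "M \<in> carrier_mat n n" for M using A that by simp
    obtain p1 where p1: "degree p1 < n"
      "\<And>z. \<not> eigenvalue A z \<Longrightarrow> ip x (\<Phi> (A * resolvent A z) *\<^sub>v x) = poly p1 z / poly (char_poly A) z"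
      by (rule resolvent_functional_rational[OF A n0, where L = "\<lambda>M. ip x (\<Phi> (A * M) *\<^sub>v x)"])
         (use A AM in \<open>simp_all add: mult_add_distrib_mat[of _ n n] mult_smult_distrib[of _ n n]
            ip_Phi_add[OF Phi x x] ip_Phi_smult[OF Phi x x]\<close>)
    obtain p2 where p2: "degree p2 < r"
      "\<And>z. \<not> eigenvalue (\<Phi> A) z \<Longrightarrow> ip x (\<Phi> A *\<^sub>v (resolvent (\<Phi> A) z *\<^sub>v x)) = poly p2 z / poly (char_poly (\<Phi> A)) z"
      by (rule resolvent_functional_rational[OF B r0, where L = "\<lambda>M. ip x (\<Phi> A *\<^sub>v (M *\<^sub>v x))"])
         (use B x in \<open>simp_all add: ip_mult_add[of _ r] ip_mult_smult[of _ r]\<close>)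
    define e where "e = (\<Prod>w\<leftarrow>ws. [:- w, 1:])"
    have e_prod: "e = char_poly A * char_poly (\<Phi> A)" by (simp add: e_def ws_def es1(1) es2(1))
    define q where "q = p2 * char_poly A - Polynomial.smult (complex_of_real \<gamma>) (p1 * char_poly (\<Phi> A))"
    have dA: "degree (char_poly A) = n" and dB: "degree (char_poly (\<Phi> A)) = r"
      using degree_monic_char_poly[OF A] degree_monic_char_poly[OF B] by auto
    have "degree (p2 * char_poly A) \<le> n + r - 1" "degree (p1 * char_poly (\<Phi> A)) \<le> n + r - 1"
      using degree_mult_le[of p2 "char_poly A"] degree_mult_le[of p1 "char_poly (\<Phi> A)"] p1(1) p2(1) dA dB by linarith+
    then have "degree q \<le> n + r - 1"
      unfolding q_def by (intro degree_diff_le) (auto intro: order_trans[OF degree_smult_le])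
    then have dq: "degree q < length ws" using n0 es1(2) es2(2) by (simp add: ws_def)
    have qe: "poly q z / poly e z = ip x (\<Phi> A *\<^sub>v (resolvent (\<Phi> A) z *\<^sub>v x)) - \<gamma> * ip x (\<Phi> (A * resolvent A z) *\<^sub>v x)"
      if z: "\<not> eigenvalue A z" "\<not> eigenvalue (\<Phi> A) z" for z
    proof -
      have nz: "poly (char_poly A) z \<noteq> 0" "poly (char_poly (\<Phi> A)) z \<noteq> 0"
        using z eigenvalue_root_char_poly[OF A] eigenvalue_root_char_poly[OF B] by auto
      show ?thesis unfolding p1(2)[OF z(1)] p2(2)[OF z(2)] e_prod q_def
        using nz by (simp add: field_simps)
    qed
    have nn: "0 \<le> Re (cint c \<rho> (\<lambda>z. f z * s z))"
    proof (rule cint_stieltjes_nonneg[OF f rc ws e_def dq])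
      show "continuous_on ?S s" unfolding s_def
        by (intro continuous_intros intA(2) intB(2))
      show "z * s z = complex_of_real (1 - \<gamma>) * ip x x + poly q z / poly e z" if z: "z \<in> ?S" for z
      proof -
        note RA = resolvent_inverse(1)[OF A neS(1)[OF z]] and RB = resolvent_inverse(1)[OF B neS(2)[OF z]]
        have "z * ip x (resolvent (\<Phi> A) z *\<^sub>v x) = ip x ((1\<^sub>m r + \<Phi> A * resolvent (\<Phi> A) z) *\<^sub>v x)"
          unfolding resolvent_identity[OF B neS(2)[OF z], symmetric] using RB x by (simp add: ip_smult_mat[of _ r r])
        also have "\<dots> = ip x x + ip x (\<Phi> A *\<^sub>v (resolvent (\<Phi> A) z *\<^sub>v x))"
          using B RB x by (simp add: ip_add_mat[of _ r r] assoc_mult_mat_vec[of _ r r _ r])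
        finally have 1: "z * ip x (resolvent (\<Phi> A) z *\<^sub>v x) = ip x x + ip x (\<Phi> A *\<^sub>v (resolvent (\<Phi> A) z *\<^sub>v x))" .
        have "z * ip x (\<Phi> (resolvent A z) *\<^sub>v x) = ip x (\<Phi> (1\<^sub>m n + A * resolvent A z) *\<^sub>v x)"
          unfolding resolvent_identity[OF A neS(1)[OF z], symmetric] by (rule ip_Phi_smult[OF Phi x x RA, symmetric])
        also have "\<dots> = ip x x + ip x (\<Phi> (A * resolvent A z) *\<^sub>v x)"
          using ip_Phi_add[OF Phi x x one_carrier_mat AM[OF RA]] x by (simp add: Phi_one[OF Phi])
        finally have 2: "z * ip x (\<Phi> (resolvent A z) *\<^sub>v x) = ip x x + ip x (\<Phi> (A * resolvent A z) *\<^sub>v x)" .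
        have "z * s z = z * ip x (resolvent (\<Phi> A) z *\<^sub>v x) - \<gamma> * (z * ip x (\<Phi> (resolvent A z) *\<^sub>v x))"
          by (simp add: s_def algebra_simps)
        then show ?thesis unfolding 1 2 qe[OF neS[OF z]] by (simp add: algebra_simps)
      qed
      show "Re (poly q (complex_of_real (- t)) / poly e (complex_of_real (- t))) \<le> 0" if t: "0 < t" for t
      proof -
        note SA = neg_resolvent_shift[OF A neN(1)[OF t]] and SB = neg_resolvent_shift[OF B neN(2)[OF t]]
        define RA where "RA = (- 1) \<cdot>\<^sub>m resolvent A (complex_of_real (- t))"
        define RB where "RB = (- 1) \<cdot>\<^sub>m resolvent (\<Phi> A) (complex_of_real (- t))"
        have cA: "RA \<in> carrier_mat n n" and cB: "RB \<in> carrier_mat r r" unfolding RA_def RB_def by (rule SA(1), rule SB(1))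
        have "\<gamma> * Re (ip x (\<Phi> (A * RA) *\<^sub>v x)) \<le> Re (ip x (\<Phi> A *\<^sub>v (RB *\<^sub>v x)))"
          unfolding RA_def RB_def
          by (rule resolvent_ineq[OF Phi A posA numerical_range_sector[OF A assms(8)] tan0 \<gamma> t SA(1,2) SB(1,2) x])
        moreover have "ip x (\<Phi> A *\<^sub>v (resolvent (\<Phi> A) (complex_of_real (- t)) *\<^sub>v x)) = - ip x (\<Phi> A *\<^sub>v (RB *\<^sub>v x))"
          unfolding SB(3)[folded RB_def] using ip_mult_smult[OF B cB x, of "- 1"] by simp
        moreover have "ip x (\<Phi> (A * resolvent A (complex_of_real (- t))) *\<^sub>v x) = - ip x (\<Phi> (A * RA) *\<^sub>v x)"
          unfolding SA(3)[folded RA_def] mult_smult_distrib[OF A cA]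
          using ip_Phi_smult[OF Phi x x AM[OF cA], of "- 1"] by simp
        ultimately show ?thesis unfolding qe[OF neN[OF t]] by simp
      qed
    qed
    have "ip x (mfun f (\<Phi> A) *\<^sub>v x) - \<gamma> * ip x (\<Phi> (mfun f A) *\<^sub>v x) = cint c \<rho> (\<lambda>z. f z * s z)"
    proof -
      have fc: "continuous_on ?S f" by (rule mm_continuous[OF f rc(2)])
      have "cint c \<rho> (\<lambda>z. f z * s z) = cint c \<rho> (\<lambda>z. f z * ip x (resolvent (\<Phi> A) z *\<^sub>v x)
          + (- complex_of_real \<gamma>) * (f z * ip x (\<Phi> (resolvent A z) *\<^sub>v x)))"
        by (rule cint_cong[OF _ rc(1)]) (simp add: s_def algebra_simps)
      also have "\<dots> = cint c \<rho> (\<lambda>z. f z * ip x (resolvent (\<Phi> A) z *\<^sub>v x))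
          + (- complex_of_real \<gamma>) * cint c \<rho> (\<lambda>z. f z * ip x (\<Phi> (resolvent A z) *\<^sub>v x))"
        unfolding cint_cmult[OF continuous_on_mult[OF fc intA(2)] rc(1), symmetric]
        by (rule cint_add[OF continuous_on_mult[OF fc intB(2)]
              continuous_on_mult_left[OF continuous_on_mult[OF fc intA(2)]] rc(1)])
      finally show ?thesis unfolding intA(1)[symmetric] intB(1)[symmetric] by simp
    qed
    then have "0 \<le> Re (ip x (mfun f (\<Phi> A) *\<^sub>v x) - \<gamma> * ip x (\<Phi> (mfun f A) *\<^sub>v x))" using nn by simp
    then show ?thesis by simp
  qed
  let ?L = "(cos \<alpha>)\<^sup>2 \<cdot>\<^sub>m re_part (\<Phi> (mfun f A))" and ?R = "re_part (mfun f (\<Phi> A))"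
  have cL: "re_part (\<Phi> (mfun f A)) \<in> carrier_mat r r" and cR: "?R \<in> carrier_mat r r"
    using PF FB by (simp_all add: re_part_carrier)
  have cL': "complex_of_real \<gamma> \<cdot>\<^sub>m re_part (\<Phi> (mfun f A)) \<in> carrier_mat r r" using cL by simp
  have D: "?R - complex_of_real \<gamma> \<cdot>\<^sub>m re_part (\<Phi> (mfun f A)) \<in> carrier_mat r r"
    using cL' by (intro minus_carrier_mat)
  have "psd (?R - complex_of_real \<gamma> \<cdot>\<^sub>m re_part (\<Phi> (mfun f A)))"
    unfolding psd_def
  proof (intro conjI ballI)
    show "hermitian (?R - complex_of_real \<gamma> \<cdot>\<^sub>m re_part (\<Phi> (mfun f A)))"
    proof -
      have "adj (?R - complex_of_real \<gamma> \<cdot>\<^sub>m re_part (\<Phi> (mfun f A))) = ?R - complex_of_real \<gamma> \<cdot>\<^sub>m re_part (\<Phi> (mfun f A))"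
        unfolding adj_def
        by (rule eq_matI) (use cL cR hermitian_entry[OF re_part_hermitian[OF FB] cR]
            hermitian_entry[OF re_part_hermitian[OF PF] cL] in auto)
      with D show ?thesis by (rule hermitianI)
    qed
    fix x :: "complex Matrix.vec"
    assume "x \<in> carrier_vec (dim_row (?R - complex_of_real \<gamma> \<cdot>\<^sub>m re_part (\<Phi> (mfun f A))))"
    then have x: "x \<in> carrier_vec r" unfolding carrier_matD(1)[OF D] .
    have "Re (qform (?R - complex_of_real \<gamma> \<cdot>\<^sub>m re_part (\<Phi> (mfun f A))) x)
      = Re (qform ?R x) - \<gamma> * Re (qform (re_part (\<Phi> (mfun f A))) x)"
      by (simp only: qform_minus[OF cR cL' x]) (simp add: qform_ip ip_smult_mat[OF cL x x])
    also have "\<dots> = Re (ip x (mfun f (\<Phi> A) *\<^sub>v x)) - \<gamma> * Re (ip x (\<Phi> (mfun f A) *\<^sub>v x))"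
      unfolding qform_re_part[OF FB x] qform_re_part[OF PF x] by (simp add: qform_ip)
    finally show "0 \<le> Re (qform (?R - complex_of_real \<gamma> \<cdot>\<^sub>m re_part (\<Phi> (mfun f A))) x)"
      using main[OF x] by simp
  qed
  moreover have "complex_of_real \<gamma> = (cos \<alpha>)\<^sup>2" by (simp add: \<gamma>_def)
  ultimately show ?thesis
    unfolding loewner_le_def using cL cR by (simp add: \<gamma>_def)
qed

end
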